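(* Let $(\mathcal{X},\rho,\mu)$ be a space of homogeneous type satisfying the weak reverse doubling (WRD) condition and let $\Omega\subseteq\mathcal{X}$ be an open set satisfying the weak measure density (WMD) condition. Let $p,p_1,q\in(0,\infty)$ satisfy $q<\min\{p,p_1\}$ and let $\phi\in\mathcal{G}^{\rm dec}_p$ satisfy both the nearness condition and that there exists $C_{(\phi)}\in(0,\infty)$ such that, for any $x\in\mathcal{X}$ and $r\in(0,\infty)$, $\int_r^\infty\frac{\phi(x,t)}{t}\,dt\le C_{(\phi)}\phi(x,r)$. Assume either that there exists $\widetilde{C}_{(\phi)}\in[1,\infty)$ such that, for any ball $B\subset\mathcal{X}$, $\frac1{\widetilde C_{(\phi)}}\le\phi(B)[\mu(B)]^{\frac1p}\le\widetilde C_{(\phi)}$, or that both $\lim_{r\to0^+}\inf_{x\in B}\phi(x,r)=\infty$ for any ball $B\subset\mathcal{X}$ and $\lim_{r\to\infty}\phi(x,r)[\mu(B(x,r))]^{\frac1p}=\infty$ for any $x\in\mathcal{X}$. Then there exist $C,\widetilde C\in(0,\infty)$ such that, for any $f\in[L_{p,p_1,\phi}(\Omega)/\mathbb{R}]\cap\bigcup_{s\in(0,1)}\dot W^{s,q}_{L_{p,p_1,\phi}}(\Omega)$, $$C\|f\|_{L_{p,p_1,\phi}(\Omega)/\mathbb{R}}\le\liminf_{s\to0^+}s^{\frac1q}\left\|\left\{\int_\Omega\frac{|f(\cdot)-f(y)|^q}{U(\cdot,y)[\rho(\cdot,y)]^{sq}}\,d\mu(y)\right\}^{\frac1q}\right\|_{L_{p,p_1,\phi}(\Omega)}\le\limsup_{s\to0^+}s^{\frac1q}\left\|\left\{\int_\Omega\frac{|f(\cdot)-f(y)|^q}{U(\cdot,y)[\rho(\cdot,y)]^{sq}}\,d\mu(y)\right\}^{\frac1q}\right\|_{L_{p,p_1,\phi}(\Omega)}\le\widetilde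 C\|f\|_{L_{p,p_1,\phi}(\Omega)/\mathbb{R}}.$$
   Context: A quasi-metric on a nonempty set $\mathcal{X}$ is $\rho:\mathcal{X}\times\mathcal{X}\to[0,\infty)$ with $\rho(x,y)=0$ iff $x=y$, $\rho(x,y)=\rho(y,x)$, and $\rho(x,z)\le K_0[\rho(x,y)+\rho(y,z)]$ for some constant $K_0\in[1,\infty)$. Balls: $B(x,r):=\{y:\rho(x,y)<r\}$. $(\mathcal{X},\rho,\mu)$ is a space of homogeneous type if $\rho$ is a quasi-metric, $\mu$ is a nonnegative measure on a $\sigma$-algebra containing all balls, and there is $L_{(\mu)}\in[1,\infty)$ with $0<\mu(B(x,2r))\le L_{(\mu)}\mu(B(x,r))<\infty$ for all $x,r$. WRD condition: there exist $x_0\in\mathcal{X}$ and $\lambda,C_{(\mu)}\in(1,\infty)$ with $\liminf_{r\to\infty}\frac{\mu(B(x_0,\lambda r))}{\mu(B(x_0,r))}\ge C_{(\mu)}$. WMD condition for $\Omega$: there exist $x_0\in\mathcal{X}$ and $C_0\in(0,1]$ with $\liminf_{r\to\infty}\frac{\mu(B(x_0,r)\cap\Omega)}{\mu(B(x_0,r))}\ge C_0$. $U(x,y):=\min\{\mu(B(x,\rho(x,y))),\mu(B(y,\rho(x,y)))\}$. The integrand $|f(x)-f(y)|^q/(U(x,y)[\rho(x,y)]^{sq})$ is read as $0$ at $y=x$. For $\phi:\mathcal{X}\times(0,\infty)\to(0,\infty)$ and a ball $B=B(x,r)$, write $\phi(B):=\phi(x,r)$. $\phi$ satisfies the nearness condition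 if there is $C>0$ with $\frac1C\le\frac{\phi(x,r)}{\phi(y,r)}\le C$ whenever $\rho(x,y)\le r$. A function $\psi:\mathcal{X}\times(0,\infty)\to(0,\infty)$ is almost increasing (resp. almost decreasing) in $r$ if there is $C>0$ with $\psi(x,r)\le C\psi(x,s)$ (resp. $C\psi(x,r)\ge\psi(x,s)$) for all $x\in\mathcal{X}$ and $0<r<s<\infty$. $\mathcal{G}^{\rm dec}_p$ is the set of $\phi:\mathcal{X}\times(0,\infty)\to(0,\infty)$ such that $r\mapsto[\mu(B(x,r))]^{1/p}\phi(x,r)$ is almost increasing and $r\mapsto\phi(x,r)$ is almost decreasing. Lorentz quasi-norm: $\|f\|_{L^{p,p_1}(\mathcal{X})}:=\{\int_0^\infty[t^{1/p}f^*(t)]^{p_1}\frac{dt}{t}\}^{1/p_1}$ with $f^*(t):=\inf\{s\in(0,\infty):\mu(\{|f|>s\})\le t\}$. $L^{p,p_1}_{\mathrm{loc}}(\mathcal{X})$: measurable $f$ such that each $x\in\mathcal{X}$ has some $r_x>0$ with $\|f\mathbf{1}_{B(x,r_x)}\|_{L^{p,p_1}(\mathcal{X})}<\infty$. $L_{p,p_1,\phi}(\mathcal{X})$ (generalized Lorentz--Morrey space): all $f\in L^{p,p_1}_{\mathrm{loc}}(\mathcal{X})$ with $\|f\|_{L_{p,p_1,\phi}(\mathcal{X})}:=\sup_B\frac{\|f\mathbf{1}_B\|_{L^{p,p_1}(\mathcal{X})}}{\phi(B)[\mu(B)]^{1/p}}<\infty$, supremum over all balls. For $Y=L_{p,p_1,\phi}$: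 $Y(\Omega)$ is the set of measurable $f$ on $\Omega$ that are restrictions of some $g\in Y(\mathcal{X})$, with $\|f\|_{Y(\Omega)}:=\inf\{\|g\|_{Y(\mathcal{X})}:g\in Y(\mathcal{X}),g|_\Omega=f\}$ (and $\infty$ if no such $g$); $\dot W^{s,q}_Y(\Omega)$ is the set of measurable $f$ on $\Omega$ with $\big\|\{\int_\Omega\frac{|f(\cdot)-f(y)|^q}{U(\cdot,y)[\rho(\cdot,y)]^{sq}}d\mu(y)\}^{1/q}\big\|_{Y(\Omega)}<\infty$; $Y(\Omega)/\mathbb{R}$ is the set of measurable $f$ on $\Omega$ (modulo additive real constants) with $\|f\|_{Y(\Omega)/\mathbb{R}}:=\inf_{a\in\mathbb{R}}\|f+a\|_{Y(\Omega)}<\infty$. $s\to0^+$ means $s\in(0,1)$, $s\to0$.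
   Formalization: The estimate is stated for those f for which the inner function {∫_Ω …dμ(y)}^{1/q} is measurable on Ω for every s∈(0,1), as its norm presupposes; this is automatic when ρ is jointly measurable, but not from measurability of balls alone. *)

theory Defs
  imports "HOL-Analysis.Analysis"
begin

(* The set X is "space M" throughout. Functions on X or on a subset \<Omega> are total Isabelle
   functions of which only the values on that set matter. *)

section \<open>Spaces of homogeneous type\<close>

definition quasi_metric_on :: "'a set \<Rightarrow> ('a \<Rightarrow> 'a \<Rightarrow> real) \<Rightarrow> bool" where
  "quasi_metric_on X \<rho> \<longleftrightarrow> X \<noteq> {} \<and>
     (\<forall>x\<in>X. \<forall>y\<in>X. 0 \<le> \<rho> x y) \<and>
     (\<forall>x\<in>X. \<forall>y\<in>X. \<rho> x y = 0 \<longleftrightarrow> x = y) \<and>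
     (\<forall>x\<in>X. \<forall>y\<in>X. \<rho> x y = \<rho> y x) \<and>
     (\<exists>K0\<ge>1. \<forall>x\<in>X. \<forall>y\<in>X. \<forall>z\<in>X. \<rho> x z \<le> K0 * (\<rho> x y + \<rho> y z))"

definition qball :: "'a measure \<Rightarrow> ('a \<Rightarrow> 'a \<Rightarrow> real) \<Rightarrow> 'a \<Rightarrow> real \<Rightarrow> 'a set" where
  "qball M \<rho> x r = {y \<in> space M. \<rho> x y < r}"

definition qopen :: "'a measure \<Rightarrow> ('a \<Rightarrow> 'a \<Rightarrow> real) \<Rightarrow> 'a set \<Rightarrow> bool" where
  "qopen M \<rho> \<Omega> \<longleftrightarrow> \<Omega> \<subseteq> space M \<and> (\<forall>x\<in>\<Omega>. \<exists>r>0. qball M \<rho> x r \<subseteq> \<Omega>)"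

definition homogeneous_type :: "'a measure \<Rightarrow> ('a \<Rightarrow> 'a \<Rightarrow> real) \<Rightarrow> bool" where
  "homogeneous_type M \<rho> \<longleftrightarrow> quasi_metric_on (space M) \<rho> \<and>
     (\<forall>x\<in>space M. \<forall>r>0. qball M \<rho> x r \<in> sets M) \<and>
     (\<exists>L::real. 1 \<le> L \<and> (\<forall>x\<in>space M. \<forall>r>0.
        0 < emeasure M (qball M \<rho> x (2 * r)) \<and>
        emeasure M (qball M \<rho> x (2 * r)) \<le> ennreal L * emeasure M (qball M \<rho> x r) \<and>
        ennreal L * emeasure M (qball M \<rho> x r) < \<infinity>))"

definition WRD :: "'a measure \<Rightarrow> ('a \<Rightarrow> 'a \<Rightarrow> real) \<Rightarrow> bool" where
  "WRD M \<rho> \<longleftrightarrow> (\<exists>x0\<in>space M. \<exists>\<theta> C :: real. 1 < \<theta> \<and> 1 < C \<and>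
     ennreal C \<le> Liminf at_top (\<lambda>r::real.
       emeasure M (qball M \<rho> x0 (\<theta> * r)) / emeasure M (qball M \<rho> x0 r)))"

definition WMD :: "'a measure \<Rightarrow> ('a \<Rightarrow> 'a \<Rightarrow> real) \<Rightarrow> 'a set \<Rightarrow> bool" where
  "WMD M \<rho> \<Omega> \<longleftrightarrow> (\<exists>x0\<in>space M. \<exists>C0::real. 0 < C0 \<and> C0 \<le> 1 \<and>
     ennreal C0 \<le> Liminf at_top (\<lambda>r::real.
       emeasure M (qball M \<rho> x0 r \<inter> \<Omega>) / emeasure M (qball M \<rho> x0 r)))"

definition Umin :: "'a measure \<Rightarrow> ('a \<Rightarrow> 'a \<Rightarrow> real) \<Rightarrow> 'a \<Rightarrow> 'a \<Rightarrow> ennreal" where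
  "Umin M \<rho> x y =
     min (emeasure M (qball M \<rho> x (\<rho> x y))) (emeasure M (qball M \<rho> y (\<rho> x y)))"

section \<open>Conditions on the growth function\<close>

definition nearness :: "'a measure \<Rightarrow> ('a \<Rightarrow> 'a \<Rightarrow> real) \<Rightarrow> ('a \<Rightarrow> real \<Rightarrow> real) \<Rightarrow> bool" where
  "nearness M \<rho> \<phi> \<longleftrightarrow> (\<exists>C>0. \<forall>x\<in>space M. \<forall>y\<in>space M. \<forall>r>0. \<rho> x y \<le> r \<longrightarrow>
     1 / C \<le> \<phi> x r / \<phi> y r \<and> \<phi> x r / \<phi> y r \<le> C)"

definition almost_increasing :: "'a set \<Rightarrow> ('a \<Rightarrow> real \<Rightarrow> real) \<Rightarrow> bool" where
  "almost_increasing X \<psi> \<longleftrightarrow> (\<exists>C>0. \<forall>x\<in>X. \<forall>r s. 0 < r \<and> r < s \<longrightarrow> \<psi> x r \<le> C * \<psi> x s)"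

definition almost_decreasing :: "'a set \<Rightarrow> ('a \<Rightarrow> real \<Rightarrow> real) \<Rightarrow> bool" where
  "almost_decreasing X \<psi> \<longleftrightarrow> (\<exists>C>0. \<forall>x\<in>X. \<forall>r s. 0 < r \<and> r < s \<longrightarrow> \<psi> x s \<le> C * \<psi> x r)"

definition Gdec ::
  "'a measure \<Rightarrow> ('a \<Rightarrow> 'a \<Rightarrow> real) \<Rightarrow> real \<Rightarrow> ('a \<Rightarrow> real \<Rightarrow> real) set" where
  "Gdec M \<rho> p = {\<phi>. (\<forall>x\<in>space M. \<forall>r>0. 0 < \<phi> x r) \<and>
     almost_increasing (space M) (\<lambda>x r. measure M (qball M \<rho> x r) powr (1 / p) * \<phi> x r) \<and>
     almost_decreasing (space M) \<phi>}"

section \<open>Lorentz and generalized Lorentz--Morrey spaces\<close>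

(* Only used with exponents a > 0, for which \<infinity>^a = \<infinity>. *)
definition ennpowr :: "ennreal \<Rightarrow> real \<Rightarrow> ennreal" where
  "ennpowr x a = (if x = \<infinity> then \<infinity> else ennreal (enn2real x powr a))"

definition rearrangement :: "'a measure \<Rightarrow> ('a \<Rightarrow> ereal) \<Rightarrow> real \<Rightarrow> ennreal" where
  "rearrangement M f t =
     (INF s\<in>{s::real. 0 < s \<and> emeasure M {x \<in> space M. ereal s < \<bar>f x\<bar>} \<le> ennreal t}. ennreal s)"

definition lorentz_norm :: "'a measure \<Rightarrow> real \<Rightarrow> real \<Rightarrow> ('a \<Rightarrow> ereal) \<Rightarrow> ennreal" where
  "lorentz_norm M p p1 f = ennpowr
     (\<integral>\<^sup>+t\<in>{0<..}. ennpowr (ennreal (t powr (1 / p)) * rearrangement M f t) p1 / ennreal t \<partial>lborel)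
     (1 / p1)"

definition lorentz_loc ::
  "'a measure \<Rightarrow> ('a \<Rightarrow> 'a \<Rightarrow> real) \<Rightarrow> real \<Rightarrow> real \<Rightarrow> ('a \<Rightarrow> ereal) set" where
  "lorentz_loc M \<rho> p p1 = {f \<in> borel_measurable M. \<forall>x\<in>space M. \<exists>r>0.
     lorentz_norm M p p1 (\<lambda>y. f y * indicator (qball M \<rho> x r) y) < \<infinity>}"

definition LM_norm :: "'a measure \<Rightarrow> ('a \<Rightarrow> 'a \<Rightarrow> real) \<Rightarrow> real \<Rightarrow> real \<Rightarrow>
    ('a \<Rightarrow> real \<Rightarrow> real) \<Rightarrow> ('a \<Rightarrow> ereal) \<Rightarrow> ennreal" where
  "LM_norm M \<rho> p p1 \<phi> f = (SUP (x, r)\<in>space M \<times> {0<..}.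
     lorentz_norm M p p1 (\<lambda>y. f y * indicator (qball M \<rho> x r) y) /
     ennreal (\<phi> x r * measure M (qball M \<rho> x r) powr (1 / p)))"

definition LM_space :: "'a measure \<Rightarrow> ('a \<Rightarrow> 'a \<Rightarrow> real) \<Rightarrow> real \<Rightarrow> real \<Rightarrow>
    ('a \<Rightarrow> real \<Rightarrow> real) \<Rightarrow> ('a \<Rightarrow> ereal) set" where
  "LM_space M \<rho> p p1 \<phi> = {f \<in> lorentz_loc M \<rho> p p1. LM_norm M \<rho> p p1 \<phi> f < \<infinity>}"

section \<open>Spaces on a subset\<close>

(* The infimum of the empty set is \<infinity> in ennreal. *)
definition LM_norm_on :: "'a measure \<Rightarrow> ('a \<Rightarrow> 'a \<Rightarrow> real) \<Rightarrow> real \<Rightarrow> real \<Rightarrow>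
    ('a \<Rightarrow> real \<Rightarrow> real) \<Rightarrow> 'a set \<Rightarrow> ('a \<Rightarrow> ereal) \<Rightarrow> ennreal" where
  "LM_norm_on M \<rho> p p1 \<phi> \<Omega> f =
     (INF g\<in>{g \<in> LM_space M \<rho> p p1 \<phi>. \<forall>x\<in>\<Omega>. g x = f x}. LM_norm M \<rho> p p1 \<phi> g)"

definition LM_quotient_norm :: "'a measure \<Rightarrow> ('a \<Rightarrow> 'a \<Rightarrow> real) \<Rightarrow> real \<Rightarrow> real \<Rightarrow>
    ('a \<Rightarrow> real \<Rightarrow> real) \<Rightarrow> 'a set \<Rightarrow> ('a \<Rightarrow> real) \<Rightarrow> ennreal" where
  "LM_quotient_norm M \<rho> p p1 \<phi> \<Omega> f =
     (INF a\<in>(UNIV :: real set). LM_norm_on M \<rho> p p1 \<phi> \<Omega> (\<lambda>x. ereal (f x + a)))"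

(* Consists of representatives f; all notions below are invariant under f \<mapsto> f + a. *)
definition LM_quotient :: "'a measure \<Rightarrow> ('a \<Rightarrow> 'a \<Rightarrow> real) \<Rightarrow> real \<Rightarrow> real \<Rightarrow>
    ('a \<Rightarrow> real \<Rightarrow> real) \<Rightarrow> 'a set \<Rightarrow> ('a \<Rightarrow> real) set" where
  "LM_quotient M \<rho> p p1 \<phi> \<Omega> = {f \<in> borel_measurable (restrict_space M \<Omega>).
     LM_quotient_norm M \<rho> p p1 \<phi> \<Omega> f < \<infinity>}"

definition gagliardo :: "'a measure \<Rightarrow> ('a \<Rightarrow> 'a \<Rightarrow> real) \<Rightarrow> 'a set \<Rightarrow> real \<Rightarrow> real \<Rightarrow>
    ('a \<Rightarrow> real) \<Rightarrow> 'a \<Rightarrow> ennreal" where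
  "gagliardo M \<rho> \<Omega> s q f x = ennpowr
     (\<integral>\<^sup>+y\<in>\<Omega>. (if y = x then 0
        else ennreal (\<bar>f x - f y\<bar> powr q) / (Umin M \<rho> x y * ennreal (\<rho> x y powr (s * q)))) \<partial>M)
     (1 / q)"

definition LM_sobolev_norm :: "'a measure \<Rightarrow> ('a \<Rightarrow> 'a \<Rightarrow> real) \<Rightarrow> real \<Rightarrow> real \<Rightarrow>
    ('a \<Rightarrow> real \<Rightarrow> real) \<Rightarrow> 'a set \<Rightarrow> real \<Rightarrow> real \<Rightarrow> ('a \<Rightarrow> real) \<Rightarrow> ennreal" where
  "LM_sobolev_norm M \<rho> p p1 \<phi> \<Omega> s q f =
     LM_norm_on M \<rho> p p1 \<phi> \<Omega> (\<lambda>x. enn2ereal (gagliardo M \<rho> \<Omega> s q f x))"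

definition LM_sobolev :: "'a measure \<Rightarrow> ('a \<Rightarrow> 'a \<Rightarrow> real) \<Rightarrow> real \<Rightarrow> real \<Rightarrow>
    ('a \<Rightarrow> real \<Rightarrow> real) \<Rightarrow> 'a set \<Rightarrow> real \<Rightarrow> real \<Rightarrow> ('a \<Rightarrow> real) set" where
  "LM_sobolev M \<rho> p p1 \<phi> \<Omega> s q = {f \<in> borel_measurable (restrict_space M \<Omega>).
     LM_sobolev_norm M \<rho> p p1 \<phi> \<Omega> s q f < \<infinity>}"

(* The quasi-norm of a function on \<Omega> presupposes that the function is measurable. A quasi-metric
   all of whose balls are measurable need not be jointly measurable, so this is not automatic for
   the inner function of the Sobolev quasi-norm; without it LM_norm_on would return \<infinity>, as the
   infimum of the empty set. It holds for every measurable f when \<rho> is jointly measurable, see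
   the lemma below. *)
definition gagliardo_measurable :: "'a measure \<Rightarrow> ('a \<Rightarrow> 'a \<Rightarrow> real) \<Rightarrow> 'a set \<Rightarrow> real \<Rightarrow>
    ('a \<Rightarrow> real) \<Rightarrow> bool" where
  "gagliardo_measurable M \<rho> \<Omega> q f \<longleftrightarrow>
     (\<forall>s\<in>{0<..<1}. gagliardo M \<rho> \<Omega> s q f \<in> borel_measurable (restrict_space M \<Omega>))"

lemma sigma_finite_homogeneous_type:
  assumes "homogeneous_type M \<rho>"
  shows "sigma_finite_measure M"
proof -
  obtain x0 where x0: "x0 \<in> space M"
    using assms unfolding homogeneous_type_def quasi_metric_on_def by auto
  obtain L :: real where L: "1 \<le> L" and
    fin: "\<And>r. 0 < r \<Longrightarrow> ennreal L * emeasure M (qball M \<rho> x0 r) < \<infinity>"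
    using assms x0 unfolding homogeneous_type_def by blast
  have fin': "emeasure M (qball M \<rho> x0 r) \<noteq> \<infinity>" if "0 < r" for r
    using fin[OF that] L by (auto simp: ennreal_mult_top)
  show ?thesis
  proof
    let ?A = "range (\<lambda>n::nat. qball M \<rho> x0 (real (Suc n)))"
    have "\<Union> ?A = space M"
    proof -
      have "\<exists>n. \<rho> x0 y < real (Suc n)" for y
        using reals_Archimedean2[of "\<rho> x0 y"] by (metis less_trans lessI of_nat_less_iff)
      then show ?thesis by (auto simp: qball_def)
    qed
    moreover have "?A \<subseteq> sets M"
      using assms x0 unfolding homogeneous_type_def by auto
    ultimately show "\<exists>A. countable A \<and> A \<subseteq> sets M \<and> \<Union> A = space M \<and> (\<forall>a\<in>A. emeasure M a \<noteq> \<infinity>)"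
      using fin' by (intro exI[of _ ?A]) auto
  qed
qed

lemma gagliardo_measurable_if_jointly_measurable:
  assumes H: "homogeneous_type M \<rho>"
    and \<rho>: "(\<lambda>z. \<rho> (fst z) (snd z)) \<in> borel_measurable (M \<Otimes>\<^sub>M M)"
    and \<Omega>: "\<Omega> \<in> sets M"
    and f: "f \<in> borel_measurable (restrict_space M \<Omega>)"
  shows "gagliardo_measurable M \<rho> \<Omega> q f"
proof -
  interpret sigma_finite_measure M using H by (rule sigma_finite_homogeneous_type)
  define F where "F = (\<lambda>x. f x * indicator \<Omega> x)"
  have F[measurable]: "F \<in> borel_measurable M"
    using f \<Omega> borel_measurable_restrict_space_iff[of \<Omega> M f] by (auto simp: F_def mult.commute)
  note [measurable] = \<Omega>
  have \<rho>'[measurable]: "(\<lambda>z. \<rho> (u z) (v z)) \<in> borel_measurable N"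
    if "u \<in> measurable N M" "v \<in> measurable N M" for u v and N :: "'b measure"
    using measurable_compose[OF measurable_Pair[OF that] \<rho>] by simp
  have \<rho>2[measurable]: "(\<lambda>z. \<rho> (u z) (v z)) \<in> borel_measurable N"
    if "u \<in> measurable N M" "v \<in> measurable N M" for u v and N :: "(('a \<times> 'a) \<times> 'a) measure"
    using measurable_compose[OF measurable_Pair[OF that] \<rho>] by simp
  have \<rho>3[measurable]: "(\<lambda>z. \<rho> (u z) (v z)) \<in> borel_measurable N"
    if "u \<in> measurable N M" "v \<in> measurable N M" for u v and N :: "('a \<times> 'a) measure"
    using measurable_compose[OF measurable_Pair[OF that] \<rho>] by simp
  have ball: "(\<lambda>z. emeasure M (qball M \<rho> (u z) (\<rho> (fst z) (snd z)))) \<in> borel_measurable (M \<Otimes>\<^sub>M M)"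
    if [measurable]: "u \<in> measurable (M \<Otimes>\<^sub>M M) M" for u
  proof -
    let ?Q = "{w \<in> space ((M \<Otimes>\<^sub>M M) \<Otimes>\<^sub>M M). \<rho> (u (fst w)) (snd w) < \<rho> (fst (fst w)) (snd (fst w))}"
    have Q: "?Q \<in> sets ((M \<Otimes>\<^sub>M M) \<Otimes>\<^sub>M M)" by measurable
    show ?thesis
    proof (rule measurable_cong[THEN iffD1, OF _ measurable_emeasure_Pair[OF Q]])
      fix z assume "z \<in> space (M \<Otimes>\<^sub>M M)"
      then show "emeasure M (Pair z -` ?Q) = emeasure M (qball M \<rho> (u z) (\<rho> (fst z) (snd z)))"
        by (intro arg_cong[where f = "emeasure M"]) (auto simp: qball_def space_pair_measure)
    qed
  qed
  have U[measurable]: "(\<lambda>z. Umin M \<rho> (fst z) (snd z)) \<in> borel_measurable (M \<Otimes>\<^sub>M M)"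
    unfolding Umin_def using ball[of fst] ball[of snd] by measurable
  have eq: "(if y = x then 0 else c) = (if \<rho> x y = 0 then 0 else c)"
    if "x \<in> space M" "y \<in> space M" for x y and c :: ennreal
    using H that unfolding homogeneous_type_def quasi_metric_on_def by metis
  show ?thesis
    unfolding gagliardo_measurable_def
  proof
    fix s :: real
    let ?k = "\<lambda>x y. (if \<rho> x y = 0 then 0 else ennreal (\<bar>F x - F y\<bar> powr q) /
      (Umin M \<rho> x y * ennreal (\<rho> x y powr (s * q)))) * indicator \<Omega> y"
    have "(\<lambda>z. ?k (fst z) (snd z)) \<in> borel_measurable (M \<Otimes>\<^sub>M M)" by measurable
    then have "case_prod ?k \<in> borel_measurable (M \<Otimes>\<^sub>M M)" by (simp add: split_beta')
    then have "(\<lambda>x. \<integral>\<^sup>+y. ?k x y \<partial>M) \<in> borel_measurable M"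
      by (rule borel_measurable_nn_integral)
    then have 1: "(\<lambda>x. ennpowr (\<integral>\<^sup>+y. ?k x y \<partial>M) (1 / q)) \<in> borel_measurable (restrict_space M \<Omega>)"
      unfolding ennpowr_def by (intro measurable_restrict_space1) measurable
    have 2: "gagliardo M \<rho> \<Omega> s q f x = ennpowr (\<integral>\<^sup>+y. ?k x y \<partial>M) (1 / q)"
      if x: "x \<in> space (restrict_space M \<Omega>)" for x
    proof -
      have "x \<in> space M" "x \<in> \<Omega>"
        using x sets.sets_into_space[OF \<Omega>] by (auto simp: space_restrict_space)
      then show ?thesis
        unfolding gagliardo_def
        by (intro arg_cong2[where f = ennpowr] nn_integral_cong refl)
           (auto simp: eq F_def split: split_indicator)
    qed
    show "gagliardo M \<rho> \<Omega> s q f \<in> borel_measurable (restrict_space M \<Omega>)"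
      using 1 measurable_cong[THEN iffD2, OF 2 1] by blast
  qed
qed

end

theory Submission
  imports Defs
begin

text \<open>
  Write \<open>J s f x\<close> for the integral whose \<open>1 / q\<close>-th power is the inner function of the Sobolev
  quasi-norm. The kernel \<open>1 / (U(x,y) \<rho>(x,y) powr (s q))\<close> restricted to \<open>\<rho>(x,y) \<ge> R\<close> has total mass of
  the order \<open>1 / s\<close>, and for small \<open>s\<close> this mass sits at infinity. There \<open>f y\<close> is negligible on
  average, so \<open>s * J s f x\<close> behaves like \<open>|f x| powr q\<close>, if \<open>f\<close> is normalised by an additive constant
  such that it belongs to the Lorentz--Morrey space.

  For the upper bound the part \<open>\<rho>(x,y) < 1\<close> is dominated by \<open>s * J s0 f x\<close> for a fixed \<open>s0\<close>, which
  disappears in the limit. In the other part the terms with \<open>f x\<close> give \<open>|f x| powr q\<close>, and the terms with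
  \<open>f y\<close> give a convex combination \<open>smear\<close> of averages of \<open>|f| powr q\<close> over dyadic scales
  (\<open>seminorm_integral_upper\<close>). Such averages are bounded on \<open>L\<^sup>1\<close> and \<open>L\<^sup>\<infinity>\<close> uniformly in \<open>s\<close>, hence by
  interpolation on the Lorentz space, because \<open>q < p\<close> (\<open>smear_dyadic_lorentz\<close>), and by a splitting into a
  near and a far part on the Lorentz--Morrey space (\<open>smear_morrey\<close>).

  For the lower bound weak reverse doubling and weak measure density provide annuli around \<open>x\<close>
  at all large geometric scales in each of which \<open>\<Omega>\<close> has a fixed portion of the measure
  (\<open>annulus_mass\<close>). The mean of \<open>|f| powr q\<close> over a ball of radius \<open>r\<close> is at most a multiple of
  \<open>\<phi> x r powr q\<close>, and \<open>\<phi> x r\<close> tends to zero by the integral condition. So every far annulus contributes a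
  fixed multiple of \<open>|f x| powr q\<close> times a power of its radius, and the sum over the annuli is of order
  \<open>1 / s\<close> (\<open>seminorm_lower\<close>). This is a pointwise bound for small \<open>s\<close>, and the Fatou property
  turns it into a bound of quasi-norms (\<open>morrey_Fatou\<close>).

  The Lorentz quasi-norm is used throughout in the equivalent form of a sum over the measures of
  the dyadic level sets, \<open>dyadic_lorentz\<close>. The quasi-metric is not assumed to be jointly measurable.
  The averages therefore have their centres in a countable net, and the kernel, which may fail to be
  measurable in \<open>y\<close>, is only compared with measurable majorants and minorants.
\<close>

section \<open>Powers of extended nonnegative reals\<close>

lemma ennpowr_ennreal [simp]: "0 \<le> x \<Longrightarrow> ennpowr (ennreal x) a = ennreal (x powr a)"
  by (simp add: ennpowr_def)

lemma ennpowr_top [simp]: "ennpowr top a = top"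
  by (simp add: ennpowr_def)

lemma ennpowr_0 [simp]: "ennpowr 0 a = 0"
  by (simp add: ennpowr_def)

lemma ennpowr_mono:
  assumes "x \<le> y" "0 < a" shows "ennpowr x a \<le> ennpowr y a"
proof (cases y)
  case (real r)
  then obtain t where "x = ennreal t" "0 \<le> t" "t \<le> r"
    using assms by (cases x) (auto simp: top_unique)
  then show ?thesis using real assms by (auto intro!: ennreal_leI powr_mono2)
qed auto

lemma ennpowr_mult:
  assumes "0 < c" shows "ennpowr (ennreal c * x) a = ennreal (c powr a) * ennpowr x a"
  using assms
  by (cases x) (auto simp: ennreal_mult[symmetric] powr_mult ennreal_mult_top)

lemma ennpowr_ennpowr:
  shows "ennpowr (ennpowr x a) b = ennpowr x (a * b)"
  by (cases x) (auto simp: powr_powr)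

lemma ennpowr_1 [simp]: "ennpowr x 1 = x"
  by (cases x) auto

lemma ennpowr_less_iff:
  assumes "0 < a" shows "ennpowr x a < ennpowr y a \<longleftrightarrow> x < y"
proof -
  have *: "x \<le> y" if "ennpowr x a \<le> ennpowr y a" for x y
  proof -
    have "ennpowr (ennpowr x a) (1 / a) \<le> ennpowr (ennpowr y a) (1 / a)"
      using that assms by - (rule ennpowr_mono, auto)
    then show ?thesis using assms by (simp add: ennpowr_ennpowr)
  qed
  show ?thesis using *[of y x] ennpowr_mono[of y x a] assms by (auto simp: not_le[symmetric])
qed

lemma ennpowr_le_iff:
  assumes "0 < a" shows "ennpowr x a \<le> ennpowr y a \<longleftrightarrow> x \<le> y"
  using ennpowr_less_iff[OF assms, of y x] by (auto simp: not_less[symmetric])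

lemma ennpowr_max:
  assumes "0 < a" shows "ennpowr (max x y) a = max (ennpowr x a) (ennpowr y a)"
  using ennpowr_le_iff[OF assms] by (auto simp: max_def)

lemma ennpowr_add_le:
  assumes "0 < a" shows "ennpowr (x + y) a \<le> ennreal (2 powr a) * (ennpowr x a + ennpowr y a)"
proof -
  have "ennpowr (x + y) a \<le> ennpowr (ennreal 2 * max x y) a"
    using assms by (intro ennpowr_mono) (auto simp: mult_2 intro!: add_mono)
  also have "\<dots> = ennreal (2 powr a) * max (ennpowr x a) (ennpowr y a)"
    using assms by (subst ennpowr_mult) (auto simp: ennpowr_max)
  also have "\<dots> \<le> ennreal (2 powr a) * (ennpowr x a + ennpowr y a)"
    by (intro mult_left_mono) (auto simp: add_increasing add_increasing2)
  finally show ?thesis .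
qed

lemma ennpowr_SUP:
  assumes "0 < a" shows "ennpowr (SUP n. f n) a = (SUP n::nat. ennpowr (f n) a)"
proof (rule antisym)
  show "(SUP n. ennpowr (f n) a) \<le> ennpowr (SUP n. f n) a"
    using assms by (intro SUP_least ennpowr_mono SUP_upper) auto
  have "f n \<le> ennpowr (SUP n. ennpowr (f n) a) (1 / a)" for n
  proof -
    have "ennpowr (ennpowr (f n) a) (1 / a) \<le> ennpowr (SUP n. ennpowr (f n) a) (1 / a)"
      using assms by (intro ennpowr_mono SUP_upper) auto
    then show ?thesis using assms by (simp add: ennpowr_ennpowr)
  qed
  then have "ennpowr (SUP n. f n) a \<le> ennpowr (ennpowr (SUP n. ennpowr (f n) a) (1 / a)) a"
    using assms by (intro ennpowr_mono SUP_least)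
  then show "ennpowr (SUP n. f n) a \<le> (SUP n. ennpowr (f n) a)"
    using assms by (simp add: ennpowr_ennpowr)
qed

lemma measurable_ennpowr [measurable]:
  assumes [measurable]: "f \<in> borel_measurable N"
  shows "(\<lambda>x. ennpowr (f x) a) \<in> borel_measurable N"
  unfolding ennpowr_def by measurable

section \<open>Dyadic sums\<close>

abbreviation int_sum :: "(int \<Rightarrow> ennreal) \<Rightarrow> ennreal" where
  "int_sum a \<equiv> (\<integral>\<^sup>+k. a k \<partial>count_space UNIV)"

lemma int_sum_upper: "a k \<le> int_sum a"
  by (rule nn_integral_ge_point) simp

lemma int_sum_mono: "(\<And>k. a k \<le> b k) \<Longrightarrow> int_sum a \<le> int_sum b"
  by (rule nn_integral_mono) simp

lemma int_sum_shift: "int_sum (\<lambda>k. a (k + m)) = int_sum a"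
proof -
  have "bij_betw (\<lambda>k::int. k + m) UNIV UNIV"
    by (rule bij_betw_byWitness[where f' = "\<lambda>k. k - m"]) auto
  then show ?thesis by (rule nn_integral_bij_count_space)
qed

lemma int_sum_cmult: "int_sum (\<lambda>k. c * a k) = c * int_sum a"
  by (rule nn_integral_cmult) simp

lemma int_sum_swap:
  "int_sum (\<lambda>k. int_sum (\<lambda>l. a k l)) = int_sum (\<lambda>l. int_sum (\<lambda>k. a k l))"
  by (rule nn_integral_count_space_nn_integral[symmetric]) auto

lemma geometric_ennreal_suminf:
  fixes b c :: real
  assumes "0 < b" "0 \<le> c"
  shows "(\<Sum>n. ennreal (c * 2 powr (- (real n * b)))) = ennreal (c / (1 - 2 powr (- b)))"
proof -
  have eq: "2 powr (- (real n * b)) = (2 powr (- b)) ^ n" for n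
    by (simp add: powr_power mult.commute)
  have l: "(2::real) powr (- b) < 1" using assms by (simp add: powr_less_one)
  have "(\<lambda>n. c * (2 powr (- b)) ^ n) sums (c * (1 / (1 - 2 powr (- b))))"
    using l by (intro sums_mult geometric_sums) simp
  then have "(\<lambda>n. c * 2 powr (- (real n * b))) sums (c / (1 - 2 powr (- b)))"
    by (simp add: eq)
  then show ?thesis using assms by (intro suminf_ennreal_eq) auto
qed

lemma int_sum_below:
  fixes b :: real and K :: int assumes b: "0 < b"
  shows "int_sum (\<lambda>k. ennreal (2 powr (k * b)) * indicator {..K} k)
    = ennreal (2 powr (K * b) / (1 - 2 powr (- b)))"
proof -
  have bij: "bij_betw (\<lambda>n::nat. K - int n) UNIV {..K}"
    by (rule bij_betw_byWitness[where f' = "\<lambda>k. nat (K - k)"]) auto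
  have "int_sum (\<lambda>k. ennreal (2 powr (k * b)) * indicator {..K} k)
      = (\<integral>\<^sup>+k. ennreal (2 powr (k * b)) \<partial>count_space {..K})"
    by (subst nn_integral_count_space_indicator[of "{..K}"]) auto
  also have "\<dots> = (\<integral>\<^sup>+n. ennreal (2 powr (real_of_int (K - int n) * b)) \<partial>count_space UNIV)"
    by (rule nn_integral_bij_count_space[OF bij, symmetric])
  also have "\<dots> = (\<Sum>n. ennreal (2 powr (K * b) * 2 powr (- (real n * b))))"
    by (simp add: nn_integral_count_space_nat left_diff_distrib powr_add[symmetric])
  also have "\<dots> = ennreal (2 powr (K * b) / (1 - 2 powr (- b)))"
    using b by (intro geometric_ennreal_suminf) auto
  finally show ?thesis .
qed

lemma int_sum_above:
  fixes b :: real and K :: int assumes b: "0 < b"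
  shows "int_sum (\<lambda>k. ennreal (2 powr (- (k * b))) * indicator {K..} k)
    = ennreal (2 powr (- (K * b)) / (1 - 2 powr (- b)))"
proof -
  have bij: "bij_betw (\<lambda>n::nat. K + int n) UNIV {K..}"
    by (rule bij_betw_byWitness[where f' = "\<lambda>k. nat (k - K)"]) auto
  have "int_sum (\<lambda>k. ennreal (2 powr (- (k * b))) * indicator {K..} k)
      = (\<integral>\<^sup>+k. ennreal (2 powr (- (k * b))) \<partial>count_space {K..})"
    by (subst nn_integral_count_space_indicator[of "{K..}"]) auto
  also have "\<dots> = (\<integral>\<^sup>+n. ennreal (2 powr (- (real_of_int (K + int n) * b))) \<partial>count_space UNIV)"
    by (rule nn_integral_bij_count_space[OF bij, symmetric])
  also have "\<dots> = (\<Sum>n. ennreal (2 powr (- (K * b)) * 2 powr (- (real n * b))))"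
    by (simp add: nn_integral_count_space_nat distrib_right powr_add[symmetric])
  also have "\<dots> = ennreal (2 powr (- (K * b)) / (1 - 2 powr (- b)))"
    using b by (intro geometric_ennreal_suminf) auto
  finally show ?thesis .
qed

lemma dyadic_bracket:
  fixes y :: real assumes "0 < y"
  obtains K :: int where "2 powr K < y" "y \<le> 2 powr (K + 1)"
proof -
  define K where "K = \<lceil>log 2 y\<rceil> - 1"
  have 1: "real_of_int K < log 2 y" "log 2 y \<le> real_of_int (K + 1)"
    unfolding K_def by linarith+
  have "2 powr K < 2 powr (log 2 y)" "2 powr (log 2 y) \<le> 2 powr (real_of_int (K + 1))"
    using 1 by (auto intro: powr_mono)
  then show ?thesis using assms by (intro that[of K]) auto
qed

text \<open>The largest level below \<open>y\<close> already gives a term of the right size, and it is not smaller than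
  the given level \<open>k\<close>. For infinite \<open>y\<close> the terms are unbounded.\<close>

lemma ennpowr_le_tail_int_sum:
  fixes y :: ennreal and b :: real
  assumes b: "0 < b" and k: "ennreal (2 powr k) < y"
  shows "ennpowr y b \<le> int_sum (\<lambda>l. ennreal (2 powr ((l + 1) * b)) *
      indicator {l::int. ennreal (2 powr l) < y} l * indicator {k..} l)"
    (is "_ \<le> int_sum ?a")
proof (cases y)
  case (real r)
  then have "0 < r" using k by (auto intro: le_less_trans[of 0 "2 powr k"] simp: ennreal_less_iff)
  then obtain K :: int where K: "2 powr K < r" "r \<le> 2 powr (K + 1)"
    using dyadic_bracket[of r] by auto
  have "2 powr k < r" using k real by (simp add: ennreal_less_iff)
  also have "r \<le> 2 powr (real_of_int (K + 1))" using K by simp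
  finally have "k \<le> K" by (subst (asm) powr_less_cancel_iff) auto
  have "ennpowr y b \<le> ennreal ((2 powr (K + 1)) powr b)"
    using real K b by (auto intro!: ennreal_leI powr_mono2)
  also have "\<dots> = ?a K"
    using K real \<open>k \<le> K\<close> by (auto simp: powr_powr ennreal_less_iff)
  also have "\<dots> \<le> int_sum ?a" by (rule int_sum_upper)
  finally show ?thesis .
next
  case top
  have "ennreal B \<le> int_sum ?a" if "0 < B" for B
  proof -
    define K where "K = max k \<lceil>log 2 B / b\<rceil>"
    have "log 2 B / b \<le> K + 1" "k \<le> K" unfolding K_def by linarith+
    then have "log 2 B \<le> (K + 1) * b" using b by (simp add: field_simps)
    then have "2 powr (log 2 B) \<le> 2 powr ((K + 1) * b)" by (intro powr_mono) auto
    then have "ennreal B \<le> ?a K" using that top \<open>k \<le> K\<close> by (auto intro!: ennreal_leI)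
    also have "\<dots> \<le> int_sum ?a" by (rule int_sum_upper)
    finally show ?thesis .
  qed
  then have "int_sum ?a = top"
    by (cases "int_sum ?a") (force simp: dest: spec[of _ "enn2real (int_sum ?a) + 1"])+
  then show ?thesis by simp
qed

lemma ennpowr_le_int_sum:
  fixes y :: ennreal and b :: real assumes b: "0 < b"
  shows "ennpowr y b
    \<le> int_sum (\<lambda>k. ennreal (2 powr ((k + 1) * b)) * indicator {k::int. ennreal (2 powr k) < y} k)"
proof (cases "y = 0")
  case False
  have "\<exists>k::int. ennreal (2 powr k) < y"
  proof (cases y)
    case (real r)
    then show ?thesis using False dyadic_bracket[of r] by (auto simp: ennreal_less_iff)
  qed auto
  then obtain k :: int where "ennreal (2 powr k) < y" ..
  then have "ennpowr y b \<le> int_sum (\<lambda>l. ennreal (2 powr ((l + 1) * b)) *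
      indicator {l::int. ennreal (2 powr l) < y} l * indicator {k..} l)"
    by (rule ennpowr_le_tail_int_sum[OF b])
  also have "\<dots> \<le> int_sum (\<lambda>k. ennreal (2 powr ((k + 1) * b)) * indicator {k::int. ennreal (2 powr k) < y} k)"
    by (intro int_sum_mono) (auto split: split_indicator)
  finally show ?thesis .
qed simp

lemma int_sum_le_ennpowr:
  fixes y :: ennreal and b :: real assumes b: "0 < b"
  shows "int_sum (\<lambda>k. ennreal (2 powr (k * b)) * indicator {k::int. ennreal (2 powr k) \<le> y} k)
    \<le> ennreal (2 powr b / (1 - 2 powr (- b))) * ennpowr y b"
    (is "int_sum ?a \<le> _")
proof (cases y)
  case (real r)
  have l: "0 < 1 - (2::real) powr (- b)" using b by (simp add: powr_less_one)
  show ?thesis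
  proof (cases "r = 0")
    case True
    then show ?thesis using real by (simp add: indicator_def ennreal_eq_0_iff not_le)
  next
    case False
    then obtain K :: int where K: "2 powr K < r" "r \<le> 2 powr (K + 1)"
      using real dyadic_bracket[of r] by auto
    have le: "k \<le> K + 1" if "ennreal (2 powr k) \<le> y" for k :: int
    proof -
      have "2 powr k \<le> r" using that real by simp
      also have "r \<le> 2 powr (real_of_int (K + 1))" using K by simp
      finally show ?thesis by (subst (asm) powr_le_cancel_iff) auto
    qed
    have "int_sum ?a \<le> int_sum (\<lambda>k. ennreal (2 powr (k * b)) * indicator {..K + 1} k)"
      using le by (intro int_sum_mono mult_left_mono) (auto split: split_indicator)
    also have "\<dots> = ennreal (2 powr ((K + 1) * b) / (1 - 2 powr (- b)))"
      using int_sum_below[OF b, of "K + 1"] by simp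
    also have "\<dots> = ennreal (2 powr b / (1 - 2 powr (- b)) * (2 powr K) powr b)"
      by (simp add: powr_powr powr_add[symmetric] algebra_simps)
    also have "\<dots> \<le> ennreal (2 powr b / (1 - 2 powr (- b)) * r powr b)"
      using K b l by (intro ennreal_leI mult_left_mono powr_mono2) auto
    also have "\<dots> = ennreal (2 powr b / (1 - 2 powr (- b))) * ennpowr y b"
      using real l by (simp add: ennreal_mult[symmetric])
    finally show ?thesis .
  qed
next
  case top
  have "0 < 1 - (2::real) powr (- b)" using b by (simp add: powr_less_one)
  then have "0 < 2 powr b / (1 - 2 powr (- b))" by simp
  then show ?thesis using top b by (simp add: ennreal_mult_top)
qed

text \<open>If \<open>S\<close> denotes the sum on the right, every single term of it is at most \<open>S\<close>, which makes
  \<open>u l\<close> decay like \<open>2 powr (- l d)\<close>; the sum of the \<open>u l\<close> is then geometric. This does the work of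
  Hoelder's inequality, but for exponents below one as well.\<close>

lemma ennpowr_tail_sum_le:
  fixes a d :: real
  assumes a: "0 < a" and d: "0 < d"
  shows "ennpowr (int_sum (\<lambda>l. u l * indicator {k..} l)) a
    \<le> ennreal ((1 / (1 - 2 powr (- d))) powr a) *
      int_sum (\<lambda>l. ennreal (2 powr ((l - k) * d * a)) * ennpowr (u l) a * indicator {k..} l)"
    (is "_ \<le> _ * ?S")
proof -
  have l: "0 < 1 - (2::real) powr (- d)" using d by (simp add: powr_less_one)
  have u: "u l * indicator {k..} l
      \<le> ennpowr ?S (1 / a) * ennreal (2 powr (k * d)) * (ennreal (2 powr (- (l * d))) * indicator {k..} l)" for l
  proof (cases "k \<le> l")
    case True
    have "ennreal (2 powr ((l - k) * d * a)) * ennpowr (u l) a \<le> ?S"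
      using int_sum_upper[of "\<lambda>l. ennreal (2 powr ((l - k) * d * a)) * ennpowr (u l) a * indicator {k..} l" l]
        True by simp
    then have "ennpowr (ennreal (2 powr ((l - k) * d * a)) * ennpowr (u l) a) (1 / a) \<le> ennpowr ?S (1 / a)"
      using a by (intro ennpowr_mono) auto
    then have 1: "ennreal (2 powr ((l - k) * d)) * u l \<le> ennpowr ?S (1 / a)"
      using a by (subst (asm) ennpowr_mult) (auto simp: ennpowr_ennpowr powr_powr)
    have "u l = ennreal (2 powr ((k - l) * d)) * (ennreal (2 powr ((l - k) * d)) * u l)"
      by (simp add: mult.assoc[symmetric] ennreal_mult[symmetric] powr_add[symmetric] left_diff_distrib)
    also have "\<dots> \<le> ennreal (2 powr ((k - l) * d)) * ennpowr ?S (1 / a)"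
      using 1 by (intro mult_left_mono) auto
    also have "ennreal (2 powr ((k - l) * d)) = ennreal (2 powr (k * d)) * ennreal (2 powr (- (l * d)))"
      by (simp add: ennreal_mult[symmetric] powr_add[symmetric] left_diff_distrib)
    finally show ?thesis using True by (simp add: mult_ac)
  qed simp
  have "int_sum (\<lambda>l. u l * indicator {k..} l)
      \<le> int_sum (\<lambda>l. ennpowr ?S (1 / a) * ennreal (2 powr (k * d)) * (ennreal (2 powr (- (l * d))) * indicator {k..} l))"
    by (intro int_sum_mono u)
  also have "\<dots> = ennpowr ?S (1 / a) * (ennreal (2 powr (k * d)) * ennreal (2 powr (- (k * d)) / (1 - 2 powr (- d))))"
    by (subst int_sum_cmult, subst int_sum_above[OF d]) (simp add: mult.assoc)
  also have "\<dots> = ennreal (1 / (1 - 2 powr (- d))) * ennpowr ?S (1 / a)"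
    using l by (simp add: ennreal_mult[symmetric] powr_add[symmetric] mult.commute)
  finally have "ennpowr (int_sum (\<lambda>l. u l * indicator {k..} l)) a
      \<le> ennpowr (ennreal (1 / (1 - 2 powr (- d))) * ennpowr ?S (1 / a)) a"
    using a by (intro ennpowr_mono) auto
  also have "\<dots> = ennreal ((1 / (1 - 2 powr (- d))) powr a) * ?S"
    using a l by (subst ennpowr_mult) (auto simp: ennpowr_ennpowr)
  finally show ?thesis .
qed

section \<open>The Lorentz quasi-norm as a dyadic sum\<close>

text \<open>The \<open>p1\<close>-th power of the Lorentz quasi-norm, up to constants, as a sum over the measures of the
  level sets at powers of two. In this form monotone limits, sums of functions and tail estimates
  need no rearrangements, and integrals over pairs of a point and a level become double sums.\<close>

definition dyadic_lorentz :: "'a measure \<Rightarrow> real \<Rightarrow> real \<Rightarrow> ('a \<Rightarrow> ennreal) \<Rightarrow> ennreal" where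
  "dyadic_lorentz M p p1 h = int_sum (\<lambda>k. ennreal (2 powr (k * p1)) *
     ennpowr (emeasure M {x \<in> space M. ennreal (2 powr k) < h x}) (p1 / p))"

lemma nn_integral_powr_initial_segment:
  fixes a :: real
  assumes a: "0 < a"
  shows "(\<integral>\<^sup>+t\<in>{0<..}. ennreal (t powr (a - 1)) * indicator {t. ennreal t < d} t \<partial>lborel)
    = ennreal (1 / a) * ennpowr d a" (is "?I d = _")
proof -
  have fin: "?I (ennreal r) = ennreal (1 / a) * ennpowr (ennreal r) a" if r: "0 \<le> r" for r
  proof -
    have "((\<lambda>t. t powr (a - 1)) has_integral (r powr (a - 1 + 1) / (a - 1 + 1))) {0..r}"
      using r a by (intro has_integral_powr_from_0) auto
    then have hi: "((\<lambda>t. t powr (a - 1)) has_integral (r powr a / a)) {0..r}" by simp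
    have "?I (ennreal r) = (\<integral>\<^sup>+t. ennreal (t powr (a - 1)) * indicator {0..r} t \<partial>lborel)"
    proof (rule nn_integral_cong_AE)
      have "AE t in lborel. t \<noteq> 0 \<and> t \<noteq> r"
        using AE_lborel_singleton[of 0] AE_lborel_singleton[of r] by eventually_elim auto
      then show "AE t in lborel. ennreal (t powr (a - 1)) * indicator {t. ennreal t < ennreal r} t * indicator {0<..} t
          = ennreal (t powr (a - 1)) * indicator {0..r} t"
        by eventually_elim (auto split: split_indicator simp: ennreal_less_iff)
    qed
    also have "\<dots> = ennreal (r powr a / a)"
      using hi by (intro nn_integral_has_integral_lebesgue') auto
    finally show ?thesis using a r by (simp add: ennreal_mult[symmetric])
  qed
  show ?thesis
  proof (cases d)
    case (real r)
    then show ?thesis using fin by simp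
  next
    case top
    have "ennreal B \<le> ?I d" if B: "0 < B" for B
    proof -
      have "ennreal B = ?I (ennreal ((B * a) powr (1 / a)))"
        using a B by (subst fin) (auto simp: powr_powr ennreal_mult[symmetric])
      also have "\<dots> \<le> ?I d"
        using top by (intro nn_integral_mono) (auto split: split_indicator)
      finally show ?thesis .
    qed
    then have "?I d = top"
      by (cases "?I d") (force dest: spec[of _ "enn2real (?I d) + 1"])+
    then show ?thesis using top a by (simp add: ennreal_mult_top)
  qed
qed

lemma lorentz_norm_eq:
  assumes "0 < p1"
  shows "lorentz_norm M p p1 f = ennpowr (\<integral>\<^sup>+t\<in>{0<..}.
    ennreal (t powr (p1 / p - 1)) * ennpowr (rearrangement M f t) p1 \<partial>lborel) (1 / p1)"
proof -
  have "ennpowr (ennreal (t powr (1 / p)) * y) p1 / ennreal t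
      = ennreal (t powr (p1 / p - 1)) * ennpowr y p1" if t: "0 < t" for t y
  proof -
    have "ennpowr (ennreal (t powr (1 / p)) * y) p1 / ennreal t
      = ennpowr y p1 * (ennreal (t powr (p1 / p)) / ennreal t)"
      using t by (subst ennpowr_mult) (auto simp: powr_powr ennreal_times_divide mult.commute)
    also have "ennreal (t powr (p1 / p)) / ennreal t = ennreal (t powr (p1 / p - 1))"
      using t by (simp add: divide_ennreal powr_diff)
    finally show ?thesis by (simp add: mult.commute)
  qed
  then show ?thesis unfolding lorentz_norm_def
    by (intro arg_cong2[where f = ennpowr] nn_integral_cong refl) (auto split: split_indicator)
qed

text \<open>In a quasi-metric space the kernel \<open>1 / (Umin M \<rho> x y * \<rho> x y powr (s q))\<close> need not be measurable
  in \<open>y\<close>. The integral of such a function is a supremum over measurable minorants, which is all that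
  the one-sided estimates below rely on.\<close>

lemma nn_integral_le_if_measurable_minorants:
  assumes "\<And>u. u \<in> borel_measurable N \<Longrightarrow> (\<And>x. u x \<le> f x) \<Longrightarrow> (\<integral>\<^sup>+x. u x \<partial>N) \<le> c"
  shows "(\<integral>\<^sup>+x. f x \<partial>N) \<le> c"
  unfolding nn_integral_def
proof (rule SUP_least)
  fix g assume "g \<in> {g. simple_function N g \<and> g \<le> f}"
  then show "integral\<^sup>S N g \<le> c"
    using assms[of g] by (auto simp: nn_integral_eq_simple_integral[symmetric] le_fun_def
        intro: borel_measurable_simple_function)
qed

lemma nn_integral_cmult_le:
  assumes "0 < c"
  shows "(\<integral>\<^sup>+x. ennreal c * f x \<partial>N) \<le> ennreal c * (\<integral>\<^sup>+x. f x \<partial>N)"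
proof (rule nn_integral_le_if_measurable_minorants)
  fix u assume [measurable]: "u \<in> borel_measurable N" and u: "\<And>x. u x \<le> ennreal c * f x"
  have c: "ennreal (1 / c) * (ennreal c * y) = y" "ennreal c * (ennreal (1 / c) * y) = y" for y
    using assms by (auto simp: mult.assoc[symmetric] ennreal_mult[symmetric])
  have "ennreal (1 / c) * u x \<le> f x" for x
    using mult_left_mono[OF u[of x], of "ennreal (1 / c)"] by (simp add: c)
  then have "(\<integral>\<^sup>+x. ennreal (1 / c) * u x \<partial>N) \<le> (\<integral>\<^sup>+x. f x \<partial>N)"
    by (intro nn_integral_mono)
  then have "ennreal c * (ennreal (1 / c) * (\<integral>\<^sup>+x. u x \<partial>N)) \<le> ennreal c * (\<integral>\<^sup>+x. f x \<partial>N)"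
    by (intro mult_left_mono) (auto simp: nn_integral_cmult)
  then show "(\<integral>\<^sup>+x. u x \<partial>N) \<le> ennreal c * (\<integral>\<^sup>+x. f x \<partial>N)" by (simp add: c)
qed

lemma ereal_less_abs_iff:
  assumes "0 \<le> r" shows "ereal r < \<bar>y\<bar> \<longleftrightarrow> ennreal r < e2ennreal \<bar>y\<bar>"
  using assms by (simp add: less_ennreal.rep_eq enn2ereal_e2ennreal)

lemma dyadic_level_less_rearrangement:
  assumes "ennreal (2 powr k) < rearrangement M f t"
  shows "ennreal t < emeasure M {x \<in> space M. ennreal (2 powr k) < e2ennreal \<bar>f x\<bar>}"
proof (rule ccontr)
  have eq: "{x \<in> space M. ereal (2 powr k) < \<bar>f x\<bar>} = {x \<in> space M. ennreal (2 powr k) < e2ennreal \<bar>f x\<bar>}"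
    by (simp add: ereal_less_abs_iff)
  assume "\<not> ?thesis"
  then have "rearrangement M f t \<le> ennreal (2 powr k)"
    unfolding rearrangement_def by (intro INF_lower) (auto simp: eq not_less)
  then show False using assms by auto
qed

lemma rearrangement_ge_dyadic_level:
  assumes "ennreal t < emeasure M {x \<in> space M. ennreal (2 powr k) < e2ennreal \<bar>f x\<bar>}"
    and [measurable]: "f \<in> borel_measurable M"
  shows "ennreal (2 powr k) \<le> rearrangement M f t"
  unfolding rearrangement_def
proof (rule INF_greatest)
  have eq: "{x \<in> space M. ereal (2 powr k) < \<bar>f x\<bar>} = {x \<in> space M. ennreal (2 powr k) < e2ennreal \<bar>f x\<bar>}"
    by (simp add: ereal_less_abs_iff)
  fix s assume "s \<in> {s::real. 0 < s \<and> emeasure M {x \<in> space M. ereal s < \<bar>f x\<bar>} \<le> ennreal t}"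
  then have s: "0 < s" "emeasure M {x \<in> space M. ereal s < \<bar>f x\<bar>} \<le> ennreal t" by auto
  show "ennreal (2 powr k) \<le> ennreal s"
  proof (rule ccontr)
    assume "\<not> ?thesis"
    then have "s \<le> 2 powr k" using s by (simp add: not_le ennreal_less_iff)
    then have "emeasure M {x \<in> space M. ereal (2 powr k) < \<bar>f x\<bar>} \<le> emeasure M {x \<in> space M. ereal s < \<bar>f x\<bar>}"
      by (intro emeasure_mono) (auto intro: le_less_trans[of "ereal s" "ereal (2 powr k)"])
    then show False using s assms(1) unfolding eq by auto
  qed
qed

text \<open>The integral over \<open>t\<close> is cut at the measures of the dyadic level sets, which are the places
  where the rearrangement crosses the powers of two: the rearrangement at \<open>t\<close> exceeds \<open>2 powr k\<close>
  essentially when \<open>t\<close> is below the measure of the level set. The converse inequality uses the same cut.\<close>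

lemma lorentz_norm_le_dyadic:
  assumes p: "0 < p" "0 < p1"
  shows "lorentz_norm M p p1 f
    \<le> ennpowr (ennreal (2 powr p1 * p / p1) * dyadic_lorentz M p p1 (\<lambda>x. e2ennreal \<bar>f x\<bar>)) (1 / p1)"
proof -
  define d where "d k = emeasure M {x \<in> space M. ennreal (2 powr k) < e2ennreal \<bar>f x\<bar>}" for k :: int
  let ?a = "p1 / p"
  have a: "0 < ?a" using p by simp
  have "(\<integral>\<^sup>+t\<in>{0<..}. ennreal (t powr (?a - 1)) * ennpowr (rearrangement M f t) p1 \<partial>lborel)
    \<le> (\<integral>\<^sup>+t. int_sum (\<lambda>k. ennreal (2 powr ((k + 1) * p1)) *
        (ennreal (t powr (?a - 1)) * indicator {t. ennreal t < d k} t * indicator {0<..} t)) \<partial>lborel)"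
  proof (rule nn_integral_mono, goal_cases)
    case (1 t)
    have "ennpowr (rearrangement M f t) p1
      \<le> int_sum (\<lambda>k. ennreal (2 powr ((k + 1) * p1)) * indicator {k::int. ennreal (2 powr k) < rearrangement M f t} k)"
      by (rule ennpowr_le_int_sum[OF p(2)])
    also have "\<dots> \<le> int_sum (\<lambda>k. ennreal (2 powr ((k + 1) * p1)) * indicator {t. ennreal t < d k} t)"
      using dyadic_level_less_rearrangement[of _ M f t]
      by (intro int_sum_mono mult_left_mono) (auto split: split_indicator simp: d_def)
    finally have "ennreal (t powr (?a - 1)) * indicator {0<..} t * ennpowr (rearrangement M f t) p1
      \<le> ennreal (t powr (?a - 1)) * indicator {0<..} t * int_sum (\<lambda>k. ennreal (2 powr ((k + 1) * p1)) * indicator {t. ennreal t < d k} t)"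
      by (rule mult_left_mono) simp
    then show ?case by (simp add: int_sum_cmult[symmetric] mult_ac)
  qed
  also have "\<dots> = int_sum (\<lambda>k. ennreal (2 powr ((k + 1) * p1)) *
      (\<integral>\<^sup>+t\<in>{0<..}. ennreal (t powr (?a - 1)) * indicator {t. ennreal t < d k} t \<partial>lborel))"
    by (subst nn_integral_count_space_nn_integral) (auto simp: nn_integral_cmult)
  also have "\<dots> = int_sum (\<lambda>k. ennreal (2 powr p1 * p / p1) * (ennreal (2 powr (k * p1)) * ennpowr (d k) ?a))"
    unfolding nn_integral_powr_initial_segment[OF a]
  proof (intro arg_cong[where f = int_sum] ext)
    fix k :: int
    have "ennreal (2 powr ((k + 1) * p1)) * ennreal (1 / ?a) = ennreal (2 powr p1 * p / p1) * ennreal (2 powr (k * p1))"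
      using p by (simp add: ennreal_mult[symmetric] distrib_right powr_add)
    then show "ennreal (2 powr ((k + 1) * p1)) * (ennreal (1 / ?a) * ennpowr (d k) ?a)
      = ennreal (2 powr p1 * p / p1) * (ennreal (2 powr (k * p1)) * ennpowr (d k) ?a)"
      by (simp only: mult.assoc[symmetric])
  qed
  finally show ?thesis unfolding lorentz_norm_eq[OF p(2)] dyadic_lorentz_def d_def int_sum_cmult
    using p by (intro ennpowr_mono) auto
qed

lemma dyadic_le_lorentz_norm:
  assumes p: "0 < p" "0 < p1" and f: "f \<in> borel_measurable M"
  shows "dyadic_lorentz M p p1 (\<lambda>x. e2ennreal \<bar>f x\<bar>)
    \<le> ennreal (p1 / p * (2 powr p1 / (1 - 2 powr (- p1)))) * ennpowr (lorentz_norm M p p1 f) p1"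
proof -
  define d where "d k = emeasure M {x \<in> space M. ennreal (2 powr k) < e2ennreal \<bar>f x\<bar>}" for k :: int
  let ?a = "p1 / p" and ?C = "2 powr p1 / (1 - 2 powr (- p1))"
  have a: "0 < ?a" using p by simp
  have C: "0 < ?C" using p by (simp add: powr_less_one)
  let ?J = "int_sum (\<lambda>k. ennreal (2 powr (k * p1)) *
      (\<integral>\<^sup>+t\<in>{0<..}. ennreal (t powr (?a - 1)) * indicator {t. ennreal t < d k} t \<partial>lborel))"
  have "dyadic_lorentz M p p1 (\<lambda>x. e2ennreal \<bar>f x\<bar>)
    = int_sum (\<lambda>k. ennreal ?a * (ennreal (2 powr (k * p1)) * (ennreal (1 / ?a) * ennpowr (d k) ?a)))"
  proof -
    have "ennreal ?a * (u * (ennreal (1 / ?a) * v)) = u * v" for u v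
    proof -
      have "ennreal ?a * (u * (ennreal (1 / ?a) * v)) = (ennreal ?a * ennreal (1 / ?a)) * (u * v)"
        by (simp only: mult_ac)
      also have "ennreal ?a * ennreal (1 / ?a) = 1" using p by (simp add: ennreal_mult[symmetric])
      finally show ?thesis by simp
    qed
    then show ?thesis unfolding dyadic_lorentz_def d_def by simp
  qed
  also have "\<dots> = ennreal ?a * ?J"
    unfolding nn_integral_powr_initial_segment[OF a] int_sum_cmult ..
  finally have dy: "dyadic_lorentz M p p1 (\<lambda>x. e2ennreal \<bar>f x\<bar>) = ennreal ?a * ?J" .
  have "?J
    = (\<integral>\<^sup>+t. int_sum (\<lambda>k. ennreal (2 powr (k * p1)) *
        (ennreal (t powr (?a - 1)) * indicator {t. ennreal t < d k} t * indicator {0<..} t)) \<partial>lborel)"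
    by (subst nn_integral_count_space_nn_integral) (auto simp: nn_integral_cmult)
  also have "\<dots> \<le> (\<integral>\<^sup>+t\<in>{0<..}. ennreal ?C * (ennreal (t powr (?a - 1)) * ennpowr (rearrangement M f t) p1) \<partial>lborel)"
  proof (rule nn_integral_mono, goal_cases)
    case (1 t)
    have "int_sum (\<lambda>k. ennreal (2 powr (k * p1)) * indicator {t. ennreal t < d k} t)
      \<le> int_sum (\<lambda>k. ennreal (2 powr (k * p1)) * indicator {k::int. ennreal (2 powr k) \<le> rearrangement M f t} k)"
      using rearrangement_ge_dyadic_level[of t M _ f] f
      by (intro int_sum_mono mult_left_mono) (auto split: split_indicator simp: d_def)
    also have "\<dots> \<le> ennreal ?C * ennpowr (rearrangement M f t) p1"
      by (rule int_sum_le_ennpowr[OF p(2)])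
    finally have "ennreal (t powr (?a - 1)) * indicator {0<..} t * int_sum (\<lambda>k. ennreal (2 powr (k * p1)) * indicator {t. ennreal t < d k} t)
      \<le> ennreal (t powr (?a - 1)) * indicator {0<..} t * (ennreal ?C * ennpowr (rearrangement M f t) p1)"
      by (rule mult_left_mono) simp
    then show ?case by (simp add: int_sum_cmult[symmetric] mult_ac)
  qed
  also have "\<dots> \<le> ennreal ?C * (\<integral>\<^sup>+t\<in>{0<..}. ennreal (t powr (?a - 1)) * ennpowr (rearrangement M f t) p1 \<partial>lborel)"
    using nn_integral_cmult_le[OF C, of lborel "\<lambda>t. ennreal (t powr (?a - 1)) * ennpowr (rearrangement M f t) p1 * indicator {0<..} t"]
    by (simp add: mult_ac)
  also have "\<dots> = ennreal ?C * ennpowr (lorentz_norm M p p1 f) p1"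
    unfolding lorentz_norm_eq[OF p(2)] using p by (simp add: ennpowr_ennpowr)
  finally have "ennreal ?a * ?J \<le> ennreal ?a * (ennreal ?C * ennpowr (lorentz_norm M p p1 f) p1)"
    by (rule mult_left_mono) simp
  also have "\<dots> = ennreal (?a * ?C) * ennpowr (lorentz_norm M p p1 f) p1"
    using a C by (subst ennreal_mult) (auto simp: mult.assoc)
  finally show ?thesis unfolding dy .
qed

section \<open>Properties of the dyadic Lorentz functional\<close>

lemma dyadic_lorentz_mono:
  assumes "0 < p" "0 < p1" "h' \<in> borel_measurable M" "\<And>x. x \<in> space M \<Longrightarrow> h x \<le> h' x"
  shows "dyadic_lorentz M p p1 h \<le> dyadic_lorentz M p p1 h'"
  unfolding dyadic_lorentz_def using assms
  by (intro int_sum_mono mult_left_mono ennpowr_mono emeasure_mono) (auto intro: less_le_trans)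

lemma dyadic_lorentz_shift:
  "dyadic_lorentz M p p1 (\<lambda>x. ennreal (2 powr real_of_int m) * h x)
    = ennreal (2 powr (m * p1)) * dyadic_lorentz M p p1 h"
proof -
  define d where "d k = emeasure M {x \<in> space M. ennreal (2 powr k) < h x}" for k :: int
  have less: "ennreal (2 powr real_of_int (k + m)) < ennreal (2 powr real_of_int m) * y \<longleftrightarrow> ennreal (2 powr k) < y"
    for k :: int and y
  proof -
    have "ennreal (2 powr real_of_int (k + m)) = ennreal (2 powr real_of_int m) * ennreal (2 powr k)"
      by (simp add: ennreal_mult[symmetric] powr_add[symmetric] add.commute)
    then show ?thesis by (simp add: not_le[symmetric] ennreal_mult_le_mult_iff)
  qed
  have "dyadic_lorentz M p p1 (\<lambda>x. ennreal (2 powr real_of_int m) * h x)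
    = int_sum (\<lambda>k. ennreal (2 powr (real_of_int (k + m) * p1)) * ennpowr (d k) (p1 / p))"
    unfolding dyadic_lorentz_def d_def
    by (subst int_sum_shift[of _ m, symmetric]) (simp only: less)
  also have "\<dots> = int_sum (\<lambda>k. ennreal (2 powr (m * p1)) * (ennreal (2 powr (k * p1)) * ennpowr (d k) (p1 / p)))"
    by (intro arg_cong[where f = int_sum] ext)
      (simp add: mult.assoc[symmetric] ennreal_mult[symmetric] powr_add[symmetric] distrib_right add.commute)
  finally show ?thesis unfolding dyadic_lorentz_def d_def int_sum_cmult .
qed

text \<open>The functional scales exactly under powers of two only; rounding \<open>c\<close> up to one costs the factor \<open>2\<close>.\<close>

lemma dyadic_lorentz_scale:
  assumes p: "0 < p" "0 < p1" and c: "0 < c" and [measurable]: "h \<in> borel_measurable M"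
  shows "dyadic_lorentz M p p1 (\<lambda>x. ennreal c * h x)
    \<le> ennreal ((2 * c) powr p1) * dyadic_lorentz M p p1 h"
proof -
  obtain K :: int where K: "2 powr K < c" "c \<le> 2 powr (K + 1)"
    using dyadic_bracket[OF c] by auto
  have "dyadic_lorentz M p p1 (\<lambda>x. ennreal c * h x)
    \<le> dyadic_lorentz M p p1 (\<lambda>x. ennreal (2 powr real_of_int (K + 1)) * h x)"
    using p K by (intro dyadic_lorentz_mono mult_right_mono ennreal_leI) auto
  also have "\<dots> = ennreal ((2 powr (K + 1)) powr p1) * dyadic_lorentz M p p1 h"
    unfolding dyadic_lorentz_shift by (simp add: powr_powr)
  also have "\<dots> \<le> ennreal ((2 * c) powr p1) * dyadic_lorentz M p p1 h"
    using p K by (intro mult_right_mono ennreal_leI powr_mono2) (auto simp: powr_add)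
  finally show ?thesis .
qed

lemma dyadic_lorentz_max:
  assumes p: "0 < p" "0 < p1" and [measurable]: "h \<in> borel_measurable M" "h' \<in> borel_measurable M"
  shows "dyadic_lorentz M p p1 (\<lambda>x. max (h x) (h' x))
    \<le> ennreal (2 powr (p1 / p)) * (dyadic_lorentz M p p1 h + dyadic_lorentz M p p1 h')"
proof -
  define d where "d h k = emeasure M {x \<in> space M. ennreal (2 powr k) < h x}" for h :: "_ \<Rightarrow> ennreal" and k :: int
  have a: "0 < p1 / p" using p by simp
  have "ennpowr (d (\<lambda>x. max (h x) (h' x)) k) (p1 / p)
    \<le> ennreal (2 powr (p1 / p)) * (ennpowr (d h k) (p1 / p) + ennpowr (d h' k) (p1 / p))" for k
  proof -
    have "d (\<lambda>x. max (h x) (h' x)) k \<le> emeasure M ({x \<in> space M. ennreal (2 powr k) < h x} \<union> {x \<in> space M. ennreal (2 powr k) < h' x})"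
      unfolding d_def by (intro emeasure_mono) (auto simp: less_max_iff_disj)
    also have "\<dots> \<le> d h k + d h' k" unfolding d_def by (intro emeasure_subadditive) auto
    finally show ?thesis using a by (meson ennpowr_add_le ennpowr_mono order_trans)
  qed
  then have "dyadic_lorentz M p p1 (\<lambda>x. max (h x) (h' x)) \<le> int_sum (\<lambda>k. ennreal (2 powr (k * p1)) *
      (ennreal (2 powr (p1 / p)) * (ennpowr (d h k) (p1 / p) + ennpowr (d h' k) (p1 / p))))"
    unfolding dyadic_lorentz_def d_def[symmetric] by (intro int_sum_mono mult_left_mono) auto
  also have "\<dots> = int_sum (\<lambda>k. ennreal (2 powr (p1 / p)) *
      (ennreal (2 powr (k * p1)) * ennpowr (d h k) (p1 / p) + ennreal (2 powr (k * p1)) * ennpowr (d h' k) (p1 / p)))"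
    by (intro arg_cong[where f = int_sum] ext) (simp add: algebra_simps)
  finally show ?thesis
    unfolding dyadic_lorentz_def d_def by (simp add: int_sum_cmult nn_integral_add)
qed

lemma dyadic_lorentz_SUP_le:
  assumes p: "0 < p" "0 < p1" and [measurable]: "\<And>n. h n \<in> borel_measurable M"
    and inc: "\<And>x. x \<in> space M \<Longrightarrow> incseq (\<lambda>n. h n x)" and A: "\<And>n::nat. dyadic_lorentz M p p1 (h n) \<le> A"
  shows "dyadic_lorentz M p p1 (\<lambda>x. SUP n. h n x) \<le> A"
proof -
  let ?E = "\<lambda>n k. {x \<in> space M. ennreal (2 powr real_of_int k) < h n x}"
  let ?d = "\<lambda>n k. ennpowr (emeasure M (?E n k)) (p1 / p)"
  have a: "0 < p1 / p" using p by simp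
  have incE: "incseq (\<lambda>n. ?E n k)" for k
    using inc unfolding incseq_def by (force intro: less_le_trans)
  have "ennpowr (emeasure M {x \<in> space M. ennreal (2 powr real_of_int k) < (SUP n. h n x)}) (p1 / p) = (SUP n. ?d n k)" for k :: int
  proof -
    have "{x \<in> space M. ennreal (2 powr real_of_int k) < (SUP n. h n x)} = (\<Union>n. ?E n k)"
      by (auto simp: less_SUP_iff)
    also have "emeasure M \<dots> = (SUP n. emeasure M (?E n k))"
      using incE by (intro SUP_emeasure_incseq[symmetric]) auto
    finally show ?thesis using ennpowr_SUP[OF a] by simp
  qed
  then have "dyadic_lorentz M p p1 (\<lambda>x. SUP n. h n x)
    = int_sum (\<lambda>k. SUP n. ennreal (2 powr (real_of_int k * p1)) * ?d n k)"
    unfolding dyadic_lorentz_def by (simp add: SUP_mult_left_ennreal)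
  also have "\<dots> = (SUP n. int_sum (\<lambda>k. ennreal (2 powr (real_of_int k * p1)) * ?d n k))"
    using incE a by (intro nn_integral_monotone_convergence_SUP)
      (auto simp: incseq_def le_fun_def intro!: mult_left_mono ennpowr_mono emeasure_mono)
  also have "\<dots> \<le> A" using A unfolding dyadic_lorentz_def by (intro SUP_least) auto
  finally show ?thesis .
qed

lemma dyadic_lorentz_indicator:
  assumes p: "0 < p" "0 < p1" and "A \<in> sets M"
  shows "dyadic_lorentz M p p1 (\<lambda>x. c * indicator A x)
    \<le> ennreal (2 powr p1 / (1 - 2 powr (- p1))) * ennpowr c p1 * ennpowr (emeasure M A) (p1 / p)"
proof -
  have "dyadic_lorentz M p p1 (\<lambda>x. c * indicator A x)
    \<le> int_sum (\<lambda>k. ennpowr (emeasure M A) (p1 / p) *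
        (ennreal (2 powr (k * p1)) * indicator {k::int. ennreal (2 powr k) \<le> c} k))"
    unfolding dyadic_lorentz_def
  proof (rule int_sum_mono)
    fix k :: int
    have "emeasure M {x \<in> space M. ennreal (2 powr k) < c * indicator A x}
      \<le> emeasure M A * indicator {k::int. ennreal (2 powr k) \<le> c} k"
    proof (cases "ennreal (2 powr k) \<le> c")
      case True
      then show ?thesis using assms by (auto intro!: emeasure_mono split: split_indicator_asm)
    next
      case False
      then have "{x \<in> space M. ennreal (2 powr k) < c * indicator A x} = {}"
        by (auto split: split_indicator_asm)
      then show ?thesis by (simp only: emeasure_empty zero_le)
    qed
    then have "ennpowr (emeasure M {x \<in> space M. ennreal (2 powr k) < c * indicator A x}) (p1 / p)
      \<le> ennpowr (emeasure M A * indicator {k::int. ennreal (2 powr k) \<le> c} k) (p1 / p)"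
      using p by (intro ennpowr_mono) auto
    also have "\<dots> = ennpowr (emeasure M A) (p1 / p) * indicator {k::int. ennreal (2 powr k) \<le> c} k"
      by (simp split: split_indicator)
    finally show "ennreal (2 powr (real_of_int k * p1)) * ennpowr (emeasure M {x \<in> space M. ennreal (2 powr real_of_int k) < c * indicator A x}) (p1 / p)
       \<le> ennpowr (emeasure M A) (p1 / p) * (ennreal (2 powr (real_of_int k * p1)) * indicator {k. ennreal (2 powr real_of_int k) \<le> c} k)"
      by (subst mult.left_commute) (rule mult_left_mono, simp_all)
  qed
  also have "\<dots> \<le> ennpowr (emeasure M A) (p1 / p) * (ennreal (2 powr p1 / (1 - 2 powr (- p1))) * ennpowr c p1)"
    unfolding int_sum_cmult using p by (intro mult_left_mono int_sum_le_ennpowr) auto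
  finally show ?thesis by (simp add: mult_ac)
qed

text \<open>Pointwise, \<open>h powr q\<close> is at most a geometric sum of indicator functions of the level sets of \<open>h\<close>,
  so the layer-cake formula reduces to exchanging an integral with a countable sum.\<close>

lemma nn_integral_above_level_le:
  fixes k :: int and q :: real
  assumes q: "0 < q" and [measurable]: "h \<in> borel_measurable M"
  shows "(\<integral>\<^sup>+x. ennpowr (h x) q * indicator {x. ennreal (2 powr k) < h x} x \<partial>M)
    \<le> ennreal (2 powr q) * int_sum (\<lambda>l. ennreal (2 powr (l * q)) *
        emeasure M {x \<in> space M. ennreal (2 powr l) < h x} * indicator {k::int..} l)"
proof -
  have "(\<integral>\<^sup>+x. ennpowr (h x) q * indicator {x. ennreal (2 powr k) < h x} x \<partial>M)
    \<le> (\<integral>\<^sup>+x. int_sum (\<lambda>l. ennreal (2 powr q) * ennreal (2 powr (l * q)) * indicator {k::int..} l *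
        indicator {x \<in> space M. ennreal (2 powr l) < h x} x) \<partial>M)"
  proof (rule nn_integral_mono)
    fix x assume x: "x \<in> space M"
    show "ennpowr (h x) q * indicator {x. ennreal (2 powr k) < h x} x \<le> int_sum (\<lambda>l. ennreal (2 powr q) * ennreal (2 powr (l * q)) * indicator {k::int..} l *
        indicator {x \<in> space M. ennreal (2 powr l) < h x} x)"
    proof (cases "ennreal (2 powr k) < h x")
      case True
      have "ennpowr (h x) q \<le> int_sum (\<lambda>l. ennreal (2 powr ((l + 1) * q)) *
          indicator {l::int. ennreal (2 powr l) < h x} l * indicator {k::int..} l)"
        by (rule ennpowr_le_tail_int_sum[OF q True])
      also have "\<dots> = int_sum (\<lambda>l. ennreal (2 powr q) * ennreal (2 powr (l * q)) * indicator {k::int..} l *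
        indicator {x \<in> space M. ennreal (2 powr l) < h x} x)"
        using x by (intro arg_cong[where f = int_sum] ext)
          (auto split: split_indicator simp: ennreal_mult[symmetric] powr_add[symmetric] distrib_right add.commute)
      finally show ?thesis using True by simp
    qed simp
  qed
  also have "\<dots> = int_sum (\<lambda>l. ennreal (2 powr q) * ennreal (2 powr (l * q)) * indicator {k::int..} l *
        emeasure M {x \<in> space M. ennreal (2 powr l) < h x})"
    by (subst nn_integral_count_space_nn_integral) (auto simp: nn_integral_cmult_indicator)
  also have "\<dots> = int_sum (\<lambda>l. ennreal (2 powr q) * (ennreal (2 powr (l * q)) *
        emeasure M {x \<in> space M. ennreal (2 powr l) < h x} * indicator {k::int..} l))"
    by (simp only: mult_ac)
  finally show ?thesis unfolding int_sum_cmult .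
qed

text \<open>On sets of finite measure the Lorentz quasi-norm controls the mean of the \<open>q\<close>-th power for
  every \<open>q < p\<close>: it forces \<open>|{h > 2^l}| \<le> 2^(- l p) t^p |A|\<close>, which is summable against
  \<open>2^(l q)\<close> above the level \<open>t\<close>.\<close>

lemma nn_integral_powr_le_dyadic_lorentz:
  fixes V t :: real
  assumes q: "0 < q" "q < p" and p1: "0 < p1" and t: "0 < t" and V: "0 \<le> V"
    and [measurable]: "h \<in> borel_measurable M" "A \<in> sets M" and A: "emeasure M A = ennreal V"
    and D: "dyadic_lorentz M p p1 (\<lambda>x. h x * indicator A x) \<le> ennreal ((t * V powr (1 / p)) powr p1)"
  shows "(\<integral>\<^sup>+x\<in>A. ennpowr (h x) q \<partial>M)
    \<le> ennreal ((2 powr q + 2 powr q / (1 - 2 powr (q - p))) * t powr q * V)"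
proof -
  let ?g = "\<lambda>x. h x * indicator A x"
  define d where "d l = emeasure M {x \<in> space M. ennreal (2 powr l) < ?g x}" for l :: int
  have p: "0 < p" using q by simp
  have a: "0 < p / p1" using p p1 by simp
  have l: "0 < 1 - (2::real) powr (q - p)" using q by (simp add: powr_less_one)
  obtain K :: int where K: "2 powr K < t" "t \<le> 2 powr (K + 1)" using dyadic_bracket[OF t] by auto
  define k where "k = K + 1"
  have k: "t \<le> 2 powr k" "2 powr k < 2 * t" using K by (auto simp: k_def powr_add)
  have d: "ennreal (2 powr (l * q)) * d l \<le> ennreal (t powr p * V) * ennreal (2 powr (- (l * (p - q))))" for l
  proof -
    have "ennreal (2 powr (l * p1)) * ennpowr (d l) (p1 / p) \<le> dyadic_lorentz M p p1 ?g"
      unfolding dyadic_lorentz_def d_def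
      by (rule int_sum_upper[of "\<lambda>l. ennreal (2 powr (real_of_int l * p1)) * ennpowr (emeasure M {x \<in> space M. ennreal (2 powr real_of_int l) < ?g x}) (p1 / p)"])
    also note D
    finally have "ennpowr (ennreal (2 powr (l * p1)) * ennpowr (d l) (p1 / p)) (p / p1)
      \<le> ennpowr (ennreal ((t * V powr (1 / p)) powr p1)) (p / p1)"
      by (rule ennpowr_mono[OF _ a])
    then have "ennreal (2 powr (l * p)) * d l \<le> ennreal (t powr p * V)"
      using p p1 t V by (subst (asm) ennpowr_mult) (auto simp: ennpowr_ennpowr powr_powr powr_mult)
    then have "ennreal (2 powr (- (l * (p - q)))) * (ennreal (2 powr (l * p)) * d l)
      \<le> ennreal (2 powr (- (l * (p - q)))) * ennreal (t powr p * V)"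
      by (rule mult_left_mono) simp
    also have "ennreal (2 powr (- (l * (p - q)))) * (ennreal (2 powr (l * p)) * d l) = ennreal (2 powr (l * q)) * d l"
      by (simp add: mult.assoc[symmetric] ennreal_mult[symmetric] powr_add[symmetric] algebra_simps)
    finally show ?thesis by (simp add: mult.commute)
  qed
  have "(\<integral>\<^sup>+x\<in>A. ennpowr (h x) q \<partial>M) \<le> (\<integral>\<^sup>+x. ennreal (2 powr (k * q)) * indicator A x +
      ennpowr (?g x) q * indicator {x. ennreal (2 powr k) < ?g x} x \<partial>M)"
  proof (rule nn_integral_mono)
    fix x
    have "ennpowr (h x) q \<le> ennpowr (ennreal (2 powr k)) q" if "\<not> ennreal (2 powr k) < h x"
      using that q by (intro ennpowr_mono) auto
    then show "ennpowr (h x) q * indicator A x \<le> ennreal (2 powr (k * q)) * indicator A x +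
      ennpowr (?g x) q * indicator {x. ennreal (2 powr k) < ?g x} x"
      by (auto split: split_indicator simp: powr_powr)
  qed
  also have "\<dots> = ennreal (2 powr (k * q)) * ennreal V + (\<integral>\<^sup>+x. ennpowr (?g x) q * indicator {x. ennreal (2 powr k) < ?g x} x \<partial>M)"
    by (subst nn_integral_add) (auto simp: nn_integral_cmult_indicator A)
  also have "\<dots> \<le> ennreal (2 powr (k * q)) * ennreal V + ennreal (2 powr q) * int_sum (\<lambda>l. ennreal (2 powr (l * q)) * d l * indicator {k::int..} l)"
    unfolding d_def using q by (intro add_left_mono nn_integral_above_level_le) auto
  also have "int_sum (\<lambda>l. ennreal (2 powr (l * q)) * d l * indicator {k::int..} l)
    \<le> int_sum (\<lambda>l. ennreal (t powr p * V) * (ennreal (2 powr (- (l * (p - q)))) * indicator {k::int..} l))"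
    using d by (intro int_sum_mono) (auto split: split_indicator)
  also have "\<dots> = ennreal (t powr p * V) * ennreal (2 powr (- (k * (p - q))) / (1 - 2 powr (- (p - q))))"
    unfolding int_sum_cmult using q by (subst int_sum_above) auto
  also have "ennreal (2 powr (k * q)) * ennreal V + ennreal (2 powr q) * \<dots>
    = ennreal (2 powr (k * q) * V + 2 powr q * (t powr p * V * (2 powr (- (k * (p - q))) / (1 - 2 powr (q - p)))))"
    using V l by (simp add: ennreal_mult[symmetric] ennreal_plus[symmetric] del: ennreal_plus)
  also have "\<dots> \<le> ennreal ((2 powr q + 2 powr q / (1 - 2 powr (q - p))) * t powr q * V)"
  proof (rule ennreal_leI)
    have 1: "2 powr (k * q) \<le> 2 powr q * t powr q"
    proof -
      have "2 powr (k * q) = (2 powr k) powr q" by (simp add: powr_powr)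
      also have "\<dots> \<le> (2 * t) powr q" using k q by (intro powr_mono2) auto
      finally show ?thesis using t by (simp add: powr_mult)
    qed
    have 2: "t powr p * 2 powr (- (k * (p - q))) \<le> t powr q"
    proof -
      have "t powr p = t powr q * t powr (p - q)" by (simp add: powr_add[symmetric])
      also have "\<dots> \<le> t powr q * (2 powr k) powr (p - q)"
        using k t q by (intro mult_left_mono powr_mono2) auto
      finally have "t powr p * 2 powr (- (k * (p - q))) \<le> t powr q * (2 powr k) powr (p - q) * 2 powr (- (k * (p - q)))"
        by (rule mult_right_mono) simp
      also have "\<dots> = t powr q" by (simp add: powr_powr mult.assoc powr_add[symmetric])
      finally show ?thesis .
    qed
    have "2 powr (k * q) * V + 2 powr q * (t powr p * V * (2 powr (- (k * (p - q))) / (1 - 2 powr (q - p))))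
      = 2 powr (k * q) * V + (2 powr q * V / (1 - 2 powr (q - p))) * (t powr p * 2 powr (- (k * (p - q))))"
      by simp
    also have "\<dots> \<le> 2 powr q * t powr q * V + (2 powr q * V / (1 - 2 powr (q - p))) * t powr q"
      using 1 2 V l by (intro add_mono mult_right_mono mult_left_mono) auto
    also have "\<dots> = (2 powr q + 2 powr q / (1 - 2 powr (q - p))) * t powr q * V"
      by (simp add: algebra_simps)
    finally show "2 powr (k * q) * V + 2 powr q * (t powr p * V * (2 powr (- (k * (p - q))) / (1 - 2 powr (q - p))))
      \<le> (2 powr q + 2 powr q / (1 - 2 powr (q - p))) * t powr q * V" .
  qed
  finally show ?thesis by (simp add: mult_left_mono add_left_mono)
qed

text \<open>The discrete form of Marcinkiewicz interpolation between \<open>L\<^sup>q\<close> and \<open>L\<^sup>\<infinity>\<close>. The hypothesis is the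
  weak type bound that splitting \<open>h\<close> at the level \<open>2 powr k\<close> produces. The \<open>p1 / p\<close>-th power is moved into
  the tail sum at the price of weights \<open>2 powr ((l - k) \<delta>)\<close>; after exchanging the two sums, the inner
  one is geometric because \<open>\<delta>\<close> uses up only half of the gap between \<open>q\<close> and \<open>p\<close>.\<close>

lemma dyadic_lorentz_interpolation:
  fixes q p p1 A :: real
  assumes q: "0 < q" "q < p" and p1: "0 < p1" and A: "0 < A"
    and weak: "\<And>k::int. emeasure M {x \<in> space M. ennreal (2 powr k) < u x}
      \<le> ennreal (A * 2 powr (- (k * q))) *
        int_sum (\<lambda>l::int. ennreal (2 powr (l * q)) * emeasure M {x \<in> space M. ennreal (2 powr l) < h x} * indicator {k::int..} l)"
  defines "\<delta> \<equiv> (p - q) / 2" and "\<epsilon> \<equiv> (p - q) / 2 * (p1 / p)"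
  shows "dyadic_lorentz M p p1 u
    \<le> ennreal ((A / (1 - 2 powr (- \<delta>))) powr (p1 / p) / (1 - 2 powr (- \<epsilon>))) * dyadic_lorentz M p p1 h"
proof -
  let ?a = "p1 / p"
  define d where "d l = emeasure M {x \<in> space M. ennreal (2 powr l) < h x}" for l :: int
  have p: "0 < p" using q by simp
  have a: "0 < ?a" and \<delta>: "0 < \<delta>" and \<epsilon>: "0 < \<epsilon>" using p p1 q by (auto simp: \<delta>_def \<epsilon>_def)
  have l: "0 < 1 - (2::real) powr (- \<delta>)" "0 < 1 - (2::real) powr (- \<epsilon>)" using \<delta> \<epsilon> by (auto simp: powr_less_one)
  define B where "B = (A / (1 - 2 powr (- \<delta>))) powr ?a"
  have B: "0 < B" using A l \<delta> by (simp add: B_def)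
  have e: "p1 - q * ?a - \<delta> * ?a = \<epsilon>" "\<delta> * ?a + q * ?a + \<epsilon> = p1"
    using p by (auto simp: \<delta>_def \<epsilon>_def field_simps)
  have term_le: "ennreal (2 powr (k * p1)) * ennpowr (emeasure M {x \<in> space M. ennreal (2 powr k) < u x}) ?a
    \<le> int_sum (\<lambda>l. ennreal B * (ennreal (2 powr (l * (\<delta> * ?a + q * ?a))) * ennpowr (d l) ?a) *
        (ennreal (2 powr (k * \<epsilon>)) * indicator {..l} k))" (is "_ \<le> int_sum ?b") for k
  proof -
    let ?P = "ennreal (2 powr (k * p1))" and ?A = "ennreal ((A * 2 powr (- (k * q))) powr ?a)"
      and ?D = "ennreal ((1 / (1 - 2 powr (- \<delta>))) powr ?a)"
    let ?w = "\<lambda>l::int. ennreal (2 powr ((l - k) * \<delta> * ?a))"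
      and ?y = "\<lambda>l. ennpowr (ennreal (2 powr (l * q)) * d l) ?a"
    have "ennpowr (emeasure M {x \<in> space M. ennreal (2 powr k) < u x}) ?a
      \<le> ennpowr (ennreal (A * 2 powr (- (k * q))) * int_sum (\<lambda>l. ennreal (2 powr (l * q)) * d l * indicator {k::int..} l)) ?a"
      using weak[of k] a unfolding d_def by (intro ennpowr_mono) simp_all
    also have "\<dots> = ?A * ennpowr (int_sum (\<lambda>l. ennreal (2 powr (l * q)) * d l * indicator {k::int..} l)) ?a"
      using A by (intro ennpowr_mult) auto
    also have "\<dots> \<le> ?A * (?D *
      int_sum (\<lambda>l. ?w l * ?y l * indicator {k::int..} l))"
      by (intro mult_left_mono ennpowr_tail_sum_le a \<delta>) auto
    finally have "?P * ennpowr (emeasure M {x \<in> space M. ennreal (2 powr k) < u x}) ?a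
      \<le> ?P * (?A * (?D *
      int_sum (\<lambda>l. ?w l * ?y l * indicator {k::int..} l)))"
      by (rule mult_left_mono) simp
    also have "\<dots> = int_sum (\<lambda>l. ?P * (?A * (?D *
      (?w l * ?y l * indicator {k::int..} l))))"
      by (simp only: int_sum_cmult)
    also have "\<dots> = int_sum ?b"
    proof (intro arg_cong[where f = int_sum] ext)
      fix l :: int
      have 1: "?y l = ennreal (2 powr (l * (q * ?a))) * ennpowr (d l) ?a"
        by (subst ennpowr_mult) (auto simp: powr_powr mult.assoc)
      have 2: "(A * 2 powr (- (k * q))) powr ?a * (1 / (1 - 2 powr (- \<delta>))) powr ?a = B * 2 powr (- (k * (q * ?a)))"
        using A l by (simp add: B_def powr_mult powr_divide powr_powr mult.assoc)
      have "2 powr (k * p1) * ((A * 2 powr (- (k * q))) powr ?a * ((1 / (1 - 2 powr (- \<delta>))) powr ?a *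
          (2 powr ((l - k) * \<delta> * ?a) * 2 powr (l * (q * ?a)))))
        = (A * 2 powr (- (k * q))) powr ?a * (1 / (1 - 2 powr (- \<delta>))) powr ?a * (2 powr (k * p1) * 2 powr ((l - k) * \<delta> * ?a) * 2 powr (l * (q * ?a)))"
        by (simp only: mult_ac)
      also have "\<dots> = B * 2 powr (- (k * (q * ?a)) + k * p1 + (l - k) * \<delta> * ?a + l * (q * ?a))"
        unfolding 2 by (simp only: powr_add mult_ac)
      also have "- (k * (q * ?a)) + k * p1 + (l - k) * \<delta> * ?a + l * (q * ?a)
          = k * (p1 - q * ?a - \<delta> * ?a) + l * (\<delta> * ?a + q * ?a)"
        by (simp add: algebra_simps)
      finally have 3: "2 powr (k * p1) * ((A * 2 powr (- (k * q))) powr ?a * ((1 / (1 - 2 powr (- \<delta>))) powr ?a *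
          (2 powr ((l - k) * \<delta> * ?a) * 2 powr (l * (q * ?a))))) = B * 2 powr (l * (\<delta> * ?a + q * ?a)) * 2 powr (k * \<epsilon>)"
        unfolding e by (simp only: powr_add mult_ac)
      have 4: "?P * (?A * (?D *
          (?w l * ennreal (2 powr (l * (q * ?a)))))) =
          ennreal B * ennreal (2 powr (l * (\<delta> * ?a + q * ?a))) * ennreal (2 powr (k * \<epsilon>))"
        using arg_cong[OF 3, of ennreal] B by (simp only: ennreal_mult powr_ge_zero mult_nonneg_nonneg less_imp_le)
      have 5: "indicator {k::int..} l = (indicator {..l} k :: ennreal)" by (simp split: split_indicator)
      have "?P * (?A * (?D *
        (?w l * ?y l * indicator {k::int..} l)))
        = (?P * (?A * (?D *
          (?w l * ennreal (2 powr (l * (q * ?a))))))) * (ennpowr (d l) ?a * indicator {..l} k)"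
        unfolding 1 5 by (simp only: mult_ac)
      also have "\<dots> = ?b l" unfolding 4 by (simp only: mult_ac)
      finally show "?P * (?A * (?D *
        (?w l * ?y l * indicator {k::int..} l))) = ?b l" .
    qed
    finally show ?thesis .
  qed
  have "dyadic_lorentz M p p1 u \<le> int_sum (\<lambda>k. int_sum (\<lambda>l. ennreal B * (ennreal (2 powr (l * (\<delta> * ?a + q * ?a))) * ennpowr (d l) ?a) *
        (ennreal (2 powr (k * \<epsilon>)) * indicator {..l} k)))"
    unfolding dyadic_lorentz_def by (intro int_sum_mono term_le)
  also have "\<dots> = int_sum (\<lambda>l. int_sum (\<lambda>k. ennreal B * (ennreal (2 powr (l * (\<delta> * ?a + q * ?a))) * ennpowr (d l) ?a) *
        (ennreal (2 powr (k * \<epsilon>)) * indicator {..l} k)))"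
    by (rule int_sum_swap)
  also have "\<dots> = int_sum (\<lambda>l. ennreal (B / (1 - 2 powr (- \<epsilon>))) * (ennreal (2 powr (l * p1)) * ennpowr (d l) ?a))"
  proof (intro arg_cong[where f = int_sum] ext)
    fix l :: int
    have "B * 2 powr (l * (\<delta> * ?a + q * ?a)) * (2 powr (l * \<epsilon>) / (1 - 2 powr (- \<epsilon>)))
      = B / (1 - 2 powr (- \<epsilon>)) * 2 powr (l * (\<delta> * ?a + q * ?a) + l * \<epsilon>)"
      by (simp add: powr_add)
    also have "l * (\<delta> * ?a + q * ?a) + l * \<epsilon> = l * p1" using e(2) by (metis distrib_left)
    finally have 1: "B * 2 powr (l * (\<delta> * ?a + q * ?a)) * (2 powr (l * \<epsilon>) / (1 - 2 powr (- \<epsilon>))) = B / (1 - 2 powr (- \<epsilon>)) * 2 powr (l * p1)" .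
    have 2: "ennreal B * ennreal (2 powr (l * (\<delta> * ?a + q * ?a))) * ennreal (2 powr (l * \<epsilon>) / (1 - 2 powr (- \<epsilon>)))
      = ennreal (B / (1 - 2 powr (- \<epsilon>))) * ennreal (2 powr (l * p1))"
      using arg_cong[OF 1, of ennreal] B l by (simp only: ennreal_mult powr_ge_zero mult_nonneg_nonneg divide_nonneg_nonneg less_imp_le)
    have "int_sum (\<lambda>k. ennreal B * (ennreal (2 powr (l * (\<delta> * ?a + q * ?a))) * ennpowr (d l) ?a) *
        (ennreal (2 powr (k * \<epsilon>)) * indicator {..l} k))
      = ennreal B * (ennreal (2 powr (l * (\<delta> * ?a + q * ?a))) * ennpowr (d l) ?a) * ennreal (2 powr (l * \<epsilon>) / (1 - 2 powr (- \<epsilon>)))"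
      unfolding int_sum_cmult int_sum_below[OF \<epsilon>] ..
    also have "\<dots> = (ennreal B * ennreal (2 powr (l * (\<delta> * ?a + q * ?a))) * ennreal (2 powr (l * \<epsilon>) / (1 - 2 powr (- \<epsilon>)))) * ennpowr (d l) ?a"
      by (simp only: mult_ac)
    finally show "int_sum (\<lambda>k. ennreal B * (ennreal (2 powr (l * (\<delta> * ?a + q * ?a))) * ennpowr (d l) ?a) *
        (ennreal (2 powr (k * \<epsilon>)) * indicator {..l} k)) = ennreal (B / (1 - 2 powr (- \<epsilon>))) * (ennreal (2 powr (l * p1)) * ennpowr (d l) ?a)"
      unfolding 2 by (simp only: mult_ac)
  qed
  also have "\<dots> = ennreal (B / (1 - 2 powr (- \<epsilon>))) * dyadic_lorentz M p p1 h"
    unfolding int_sum_cmult dyadic_lorentz_def d_def ..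
  finally show ?thesis unfolding B_def .
qed

section \<open>Geometry of spaces of homogeneous type\<close>

text \<open>The constants of the quasi-metric and of the doubling condition are parameters, so that the
  constants in the estimates are terms in them and visibly independent of functions, points and scales.\<close>

locale doubling_space =
  fixes M :: "'a measure" and \<rho> :: "'a \<Rightarrow> 'a \<Rightarrow> real" and K L :: real
  assumes nonempty: "space M \<noteq> {}"
    and nonneg: "x \<in> space M \<Longrightarrow> y \<in> space M \<Longrightarrow> 0 \<le> \<rho> x y"
    and zero_iff: "x \<in> space M \<Longrightarrow> y \<in> space M \<Longrightarrow> \<rho> x y = 0 \<longleftrightarrow> x = y"
    and sym: "x \<in> space M \<Longrightarrow> y \<in> space M \<Longrightarrow> \<rho> x y = \<rho> y x"
    and K: "1 \<le> K"
    and triangle: "x \<in> space M \<Longrightarrow> y \<in> space M \<Longrightarrow> z \<in> space M \<Longrightarrow> \<rho> x z \<le> K * (\<rho> x y + \<rho> y z)"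
    and ball_sets: "x \<in> space M \<Longrightarrow> 0 < r \<Longrightarrow> qball M \<rho> x r \<in> sets M"
    and L: "1 \<le> L"
    and doubling: "x \<in> space M \<Longrightarrow> 0 < r \<Longrightarrow>
      0 < emeasure M (qball M \<rho> x (2 * r)) \<and>
      emeasure M (qball M \<rho> x (2 * r)) \<le> ennreal L * emeasure M (qball M \<rho> x r) \<and>
      ennreal L * emeasure M (qball M \<rho> x r) < \<infinity>"

lemma homogeneous_type_imp_doubling_space:
  assumes "homogeneous_type M \<rho>"
  obtains K L where "doubling_space M \<rho> K L"
proof -
  obtain K where K: "1 \<le> K" "\<And>x y z. x\<in>space M \<Longrightarrow> y\<in>space M \<Longrightarrow> z\<in>space M \<Longrightarrow> \<rho> x z \<le> K * (\<rho> x y + \<rho> y z)"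
  proof -
    have "\<exists>K0\<ge>1. \<forall>x\<in>space M. \<forall>y\<in>space M. \<forall>z\<in>space M. \<rho> x z \<le> K0 * (\<rho> x y + \<rho> y z)"
      using assms by (simp add: homogeneous_type_def quasi_metric_on_def)
    then obtain K where "1 \<le> K" "\<forall>x\<in>space M. \<forall>y\<in>space M. \<forall>z\<in>space M. \<rho> x z \<le> K * (\<rho> x y + \<rho> y z)"
      by (elim exE conjE)
    then show ?thesis by (intro that[of K]) simp_all
  qed
  obtain L :: real where L: "1 \<le> L" "\<And>x r. x\<in>space M \<Longrightarrow> 0 < r \<Longrightarrow> 
        0 < emeasure M (qball M \<rho> x (2 * r)) \<and>
        emeasure M (qball M \<rho> x (2 * r)) \<le> ennreal L * emeasure M (qball M \<rho> x r) \<and>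
        ennreal L * emeasure M (qball M \<rho> x r) < \<infinity>"
    using assms unfolding homogeneous_type_def by blast
  have Q: "space M \<noteq> {}" "\<forall>x\<in>space M. \<forall>y\<in>space M. 0 \<le> \<rho> x y"
      "\<forall>x\<in>space M. \<forall>y\<in>space M. \<rho> x y = 0 \<longleftrightarrow> x = y" "\<forall>x\<in>space M. \<forall>y\<in>space M. \<rho> x y = \<rho> y x"
      "\<forall>x\<in>space M. \<forall>r>0. qball M \<rho> x r \<in> sets M"
    using assms unfolding homogeneous_type_def quasi_metric_on_def by - (elim conjE, assumption)+
  have "doubling_space M \<rho> K L"
  proof (unfold_locales, goal_cases)
    case 1 show ?case by (rule Q(1))
  next case (2 x y) then show ?case using Q(2) by simp
  next case (3 x y) then show ?case using Q(3) by simp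
  next case (4 x y) then show ?case using Q(4) by blast
  next case 5 show ?case by (rule K(1))
  next case (6 x y z) then show ?case by (rule K(2))
  next case (7 x r) then show ?case using Q(5) by blast
  next case 8 show ?case by (rule L(1))
  next case (9 x r) then show ?case by (rule L(2))
  qed
  then show ?thesis by (rule that)
qed

context doubling_space
begin

abbreviation B :: "'a \<Rightarrow> real \<Rightarrow> 'a set" where "B \<equiv> qball M \<rho>"
abbreviation V :: "'a \<Rightarrow> real \<Rightarrow> real" where "V x r \<equiv> measure M (qball M \<rho> x r)"

lemma ball_measurable [measurable]: "x \<in> space M \<Longrightarrow> B x r \<in> sets M"
proof (cases "0 < r")
  case False
  assume "x \<in> space M"
  then have "B x r = {}" using False nonneg[of x] by (force simp: qball_def)
  then show ?thesis by simp
qed (rule ball_sets)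

lemma emeasure_ball_less_top: "x \<in> space M \<Longrightarrow> emeasure M (B x r) < \<infinity>"
proof -
  assume x: "x \<in> space M"
  have "emeasure M (B x r) \<le> emeasure M (B x (max r 1))"
    using x by (intro emeasure_mono ball_measurable) (auto simp: qball_def)
  also have "\<dots> < \<infinity>"
  proof -
    have "ennreal 1 * emeasure M (B x (max r 1)) \<le> ennreal L * emeasure M (B x (max r 1))"
      using L by (intro mult_right_mono ennreal_leI) auto
    also have "\<dots> < \<infinity>" using doubling[OF x, of "max r 1"] by (simp add: less_max_iff_disj)
    finally show ?thesis by simp
  qed
  finally show ?thesis .
qed

lemma emeasure_ball: "x \<in> space M \<Longrightarrow> emeasure M (B x r) = ennreal (V x r)"
  using emeasure_ball_less_top[of x r] by (intro emeasure_eq_ennreal_measure) auto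

lemma V_pos: "x \<in> space M \<Longrightarrow> 0 < r \<Longrightarrow> 0 < V x r"
  using doubling[of x "r / 2"] by (simp add: emeasure_ball)

lemma V_mono_subset: "x \<in> space M \<Longrightarrow> y \<in> space M \<Longrightarrow> B x r \<subseteq> B y t \<Longrightarrow> V x r \<le> V y t"
  using emeasure_mono[of "B x r" "B y t" M] by (simp add: emeasure_ball)

lemma V_mono: "x \<in> space M \<Longrightarrow> r \<le> t \<Longrightarrow> V x r \<le> V x t"
  by (rule V_mono_subset) (auto simp: qball_def)

lemma ball_subset_ball:
  assumes "x \<in> space M" "y \<in> space M" "K * (\<rho> y x + r) \<le> t"
  shows "B x r \<subseteq> B y t"
proof
  fix z assume z: "z \<in> B x r"
  then have "\<rho> y z \<le> K * (\<rho> y x + \<rho> x z)" using assms by (intro triangle) (auto simp: qball_def)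
  also have "\<dots> < K * (\<rho> y x + r)" using z K by (auto simp: qball_def)
  finally show "z \<in> B y t" using assms z by (auto simp: qball_def)
qed

lemma V_double_pow: "x \<in> space M \<Longrightarrow> 0 < r \<Longrightarrow> V x (2 ^ n * r) \<le> L ^ n * V x r"
proof (induction n)
  case (Suc n)
  have "ennreal (V x (2 * (2 ^ n * r))) \<le> ennreal (L * V x (2 ^ n * r))"
    using doubling[OF Suc.prems(1), of "2 ^ n * r"] Suc.prems L by (simp add: emeasure_ball ennreal_mult)
  then have "V x (2 ^ Suc n * r) \<le> L * V x (2 ^ n * r)"
    using L by (subst (asm) ennreal_le_iff) (auto simp: mult.assoc)
  also have "\<dots> \<le> L * (L ^ n * V x r)" using Suc L by (intro mult_left_mono) auto
  finally show ?case by simp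
qed simp

text \<open>The ratio of the measures of two balls when the radius of the larger one is \<open>c\<close> times that of
  the smaller one and the larger ball reaches the centre of the smaller one. The factor \<open>2 * K\<close> comes
  from moving the centre, and the exponent counts the doublings that reach the enlarged radius.\<close>

definition vratio :: "real \<Rightarrow> real" where "vratio c = L ^ nat \<lceil>log 2 (2 * K * c)\<rceil>"

lemma vratio_ge_1: "1 \<le> vratio c"
  using L by (simp add: vratio_def one_le_power)

lemma vratio_pos: "0 < vratio c"
  using vratio_ge_1[of c] by simp

lemma V_comparable:
  assumes "x \<in> space M" "y \<in> space M" "1 \<le> c" "0 < r" "\<rho> x y \<le> c * r"
  shows "V x (c * r) \<le> vratio c * V y r"
proof -
  define n where "n = nat \<lceil>log 2 (2 * K * c)\<rceil>"
  have "2 * K * c > 0" using K assms by simp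
  moreover have "log 2 (2 * K * c) \<le> real n" unfolding n_def by linarith
  ultimately have n: "2 * K * c \<le> 2 ^ n" by (simp add: log_le_iff powr_realpow)
  have "K * (\<rho> y x + c * r) \<le> K * (c * r + c * r)"
    using assms K sym by (intro mult_left_mono) auto
  also have "\<dots> = (2 * K * c) * r" by simp
  also have "\<dots> \<le> 2 ^ n * r" using n assms by (intro mult_right_mono) auto
  finally have "V x (c * r) \<le> V y (2 ^ n * r)"
    using assms by (intro V_mono_subset ball_subset_ball) auto
  also have "\<dots> \<le> L ^ n * V y r" using assms by (intro V_double_pow) auto
  finally show ?thesis by (simp add: vratio_def n_def)
qed

text \<open>A separated subset of a ball is bounded in cardinality, since the small balls around its
  points are disjoint and each has a fixed portion of the measure of a large ball; one of maximal
  cardinality is a finite net.\<close>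

lemma finite_net:
  assumes x0: "x0 \<in> space M" and R: "0 < R" and e: "0 < e"
  shows "\<exists>F. finite F \<and> F \<subseteq> space M \<and> (\<forall>x\<in>B x0 R. \<exists>y\<in>F. \<rho> y x < e)"
proof -
  define sep where "sep F \<longleftrightarrow> finite F \<and> F \<subseteq> B x0 R \<and> (\<forall>x\<in>F. \<forall>y\<in>F. x \<noteq> y \<longrightarrow> e \<le> \<rho> x y)" for F
  define r where "r = e / (2 * K)"
  define c where "c = max 1 (K * (R + r) / r)"
  have r: "0 < r" using e K by (simp add: r_def)
  have c: "1 \<le> c" "K * (R + r) \<le> c * r" using r by (auto simp: c_def field_simps max_def)
  have cR: "R \<le> c * r"
  proof -
    have "R \<le> 1 * (R + r)" using r by simp
    also have "\<dots> \<le> K * (R + r)" using K R r by (intro mult_right_mono) auto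
    finally show ?thesis using c by simp
  qed
  have card: "card F \<le> nat \<lfloor>vratio c\<rfloor>" if F: "sep F" for F
  proof -
    have FX: "s \<in> space M" "\<rho> x0 s < R" if "s \<in> F" for s using F that by (auto simp: sep_def qball_def)
    have disj: "disjoint_family_on (\<lambda>s. B s r) F"
      unfolding disjoint_family_on_def
    proof (intro ballI impI equals0I)
      fix s t z assume *: "s \<in> F" "t \<in> F" "s \<noteq> t" "z \<in> B s r \<inter> B t r"
      then have z: "z \<in> space M" "\<rho> s z < r" "\<rho> t z < r" by (auto simp: qball_def)
      have "\<rho> s t \<le> K * (\<rho> s z + \<rho> z t)" using * z FX by (intro triangle) auto
      also have "\<dots> < K * (r + r)" using z K sym[of z t] FX * by simp
      also have "\<dots> = e" using K by (simp add: r_def)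
      finally have "\<rho> s t < e" .
      moreover have "e \<le> \<rho> s t" using * F by (simp add: sep_def)
      ultimately show False by simp
    qed
    have "(\<Sum>s\<in>F. ennreal (V x0 (c * r) / vratio c)) \<le> (\<Sum>s\<in>F. emeasure M (B s r))"
    proof (rule sum_mono)
      fix s assume s: "s \<in> F"
      have "V x0 (c * r) \<le> vratio c * V s r"
        using FX[OF s] x0 r c cR by (intro V_comparable) auto
      then show "ennreal (V x0 (c * r) / vratio c) \<le> emeasure M (B s r)"
        using FX[OF s] vratio_pos[of c] by (auto simp: emeasure_ball divide_simps mult.commute intro!: ennreal_leI)
    qed
    also have "\<dots> = emeasure M (\<Union>s\<in>F. B s r)"
      using FX F by (intro sum_emeasure disj) (auto simp: sep_def)
    also have "\<dots> \<le> emeasure M (B x0 (c * r))"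
    proof (intro emeasure_mono UN_least)
      fix s assume s: "s \<in> F"
      have "K * (\<rho> x0 s + r) \<le> K * (R + r)" using FX[OF s] K by (intro mult_left_mono) auto
      then show "B s r \<subseteq> B x0 (c * r)" using c FX[OF s] x0 by (intro ball_subset_ball) auto
    qed (use x0 in measurable)
    finally have "ennreal (real (card F)) * ennreal (V x0 (c * r) / vratio c) \<le> ennreal (V x0 (c * r))"
      using x0 by (simp add: emeasure_ball ennreal_of_nat_eq_real_of_nat)
    then have "real (card F) * (V x0 (c * r) / vratio c) \<le> V x0 (c * r)"
      using vratio_pos[of c] by (simp add: ennreal_mult[symmetric])
    moreover have "0 < V x0 (c * r)" using c r x0 by (intro V_pos) auto
    ultimately have "real (card F) \<le> vratio c" using vratio_pos[of c] by (simp add: field_simps)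
    then show ?thesis by (simp add: le_nat_floor)
  qed
  have "sep {}" by (simp add: sep_def)
  then have "\<exists>F. sep F \<and> (\<forall>F'. sep F' \<longrightarrow> card F' \<le> card F)"
    by (rule ex_has_greatest_nat[where b = "Suc (nat \<lfloor>vratio c\<rfloor>)"]) (simp add: card less_Suc_eq_le)
  then obtain F where F: "sep F" and max: "\<And>F'. sep F' \<Longrightarrow> card F' \<le> card F" by auto
  have "\<exists>y\<in>F. \<rho> y x < e" if x: "x \<in> B x0 R" for x
  proof (rule ccontr)
    assume "\<not> ?thesis"
    then have far: "\<And>y. y \<in> F \<Longrightarrow> e \<le> \<rho> y x" by (auto simp: not_less)
    have "x \<notin> F" using far[of x] e zero_iff[of x x] x by (auto simp: qball_def)
    moreover have "e \<le> \<rho> x y" if "y \<in> F" for y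
      using far[OF that] sym[of x y] x F that by (auto simp: sep_def qball_def)
    ultimately have "sep (insert x F)" using F x far by (auto simp: sep_def)
    then show False using max[of "insert x F"] \<open>x \<notin> F\<close> F by (auto simp: sep_def)
  qed
  then show ?thesis using F by (intro exI[of _ F]) (auto simp: sep_def qball_def)
qed

lemma countable_net: "\<exists>d::nat \<Rightarrow> 'a. (\<forall>k. d k \<in> space M) \<and> (\<forall>x\<in>space M. \<forall>e>0. \<exists>k. \<rho> (d k) x < e)"
proof -
  obtain x0 where x0: "x0 \<in> space M" using nonempty by auto
  have "\<forall>n::nat. \<exists>F. finite F \<and> F \<subseteq> space M \<and> (\<forall>x\<in>B x0 (real n + 1). \<exists>y\<in>F. \<rho> y x < 1 / (real n + 1))"
    by (intro allI finite_net x0) auto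
  then obtain F where F: "\<And>n. finite (F n)" "\<And>n. F n \<subseteq> space M"
      "\<And>n x. x \<in> B x0 (real n + 1) \<Longrightarrow> \<exists>y\<in>F n. \<rho> y x < 1 / (real n + 1)" by metis
  let ?D = "insert x0 (\<Union>n. F n)"
  have "countable ?D" using F(1) by (auto intro: countable_finite)
  then have D: "range (from_nat_into ?D) = ?D" by (intro range_from_nat_into) auto
  show ?thesis
  proof (intro exI[of _ "from_nat_into ?D"] conjI allI ballI impI)
    show "from_nat_into ?D k \<in> space M" for k
    proof -
      have "?D \<subseteq> space M" using F(2) x0 by auto
      then show ?thesis using from_nat_into[of ?D k] by (auto simp del: UN_insert)
    qed
    fix x and e :: real assume x: "x \<in> space M" and e: "0 < e"
    obtain n :: nat where n: "max (\<rho> x0 x) (1 / e) < real n" using reals_Archimedean2 by blast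
    have "x \<in> B x0 (real n + 1)" using n x by (auto simp: qball_def)
    then obtain y where y: "y \<in> F n" "\<rho> y x < 1 / (real n + 1)" using F(3) by blast
    have "1 / (real n + 1) \<le> e" using n e by (auto simp: field_simps)
    moreover obtain k where "from_nat_into ?D k = y" using D y(1) by (metis (no_types, lifting) UN_iff UNIV_I imageE insert_iff)
    ultimately show "\<exists>k. \<rho> (from_nat_into ?D k) x < e" using y by (intro exI[of _ k]) auto
  qed
qed

definition net :: "nat \<Rightarrow> 'a" where
  "net = (SOME d. (\<forall>k. d k \<in> space M) \<and> (\<forall>x\<in>space M. \<forall>e>0. \<exists>k. \<rho> (d k) x < e))"

lemma net_in_space [simp]: "net k \<in> space M"
  and net_dense: "x \<in> space M \<Longrightarrow> 0 < e \<Longrightarrow> \<exists>k. \<rho> (net k) x < e"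
  using someI_ex[OF countable_net] unfolding net_def by auto

text \<open>An open set is the union of the balls of radius \<open>1 / (m + 1)\<close> around points of a countable net
  that it contains, so it belongs to the sigma-algebra although only balls are assumed to.\<close>

lemma qopen_sets:
  assumes "qopen M \<rho> \<Omega>" shows "\<Omega> \<in> sets M"
proof -
  let ?I = "{(k, m). B (net k) (1 / real (Suc m)) \<subseteq> \<Omega>}"
  have "\<Omega> = (\<Union>(k, m)\<in>?I. B (net k) (1 / real (Suc m)))"
  proof (intro antisym subsetI)
    fix x assume x: "x \<in> \<Omega>"
    then have xX: "x \<in> space M" using assms by (auto simp: qopen_def)
    obtain r where r: "0 < r" "B x r \<subseteq> \<Omega>" using assms x by (auto simp: qopen_def)
    obtain m :: nat where m: "2 * K / r < real m" using reals_Archimedean2 by blast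
    let ?e = "1 / real (Suc m)"
    have "2 * K < real m * r" using m r by (simp add: divide_less_eq)
    also have "\<dots> \<le> real (Suc m) * r" using r by (intro mult_right_mono) auto
    finally have e: "2 * K * ?e \<le> r" by (simp add: divide_le_eq mult.commute)
    obtain k where k: "\<rho> (net k) x < ?e" using net_dense[OF xX, of ?e] by auto
    have "K * (\<rho> x (net k) + ?e) \<le> K * (?e + ?e)"
      using k sym[of x "net k"] xX K by (intro mult_left_mono add_right_mono) auto
    also have "\<dots> = 2 * K * ?e" by (simp only: mult_2[symmetric] mult_ac)
    also have "\<dots> \<le> r" by (rule e)
    finally have "B (net k) ?e \<subseteq> B x r" using xX by (intro ball_subset_ball) auto
    then show "x \<in> (\<Union>(k, m)\<in>?I. B (net k) (1 / real (Suc m)))"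
      using r k xX by (auto simp: qball_def)
  qed auto
  also have "\<dots> \<in> sets M" by (intro sets.countable_UN') (auto simp: net_in_space)
  finally show ?thesis .
qed

section \<open>Averages over dyadic balls\<close>

text \<open>The averages are taken over balls whose centre is a point of a countable net, the first one within
  \<open>2 ^ j\<close> of \<open>x\<close>. Such a centre takes countably many values on measurable sets, so averages are
  measurable and integrals can be exchanged. Balls centred at \<open>x\<close> itself would require joint
  measurability of \<open>\<rho>\<close>.\<close>

definition idx :: "nat \<Rightarrow> 'a \<Rightarrow> nat" where
  "idx j x = (LEAST k. \<rho> (net k) x < 2 ^ j)"

definition center :: "nat \<Rightarrow> 'a \<Rightarrow> 'a" where
  "center j x = net (idx j x)"

definition avg :: "nat \<Rightarrow> ('a \<Rightarrow> ennreal) \<Rightarrow> 'a \<Rightarrow> ennreal" where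
  "avg j h x = ennreal (1 / V (center j x) (3 * K * 2 ^ j)) * (\<integral>\<^sup>+y\<in>B (center j x) (3 * K * 2 ^ j). h y \<partial>M)"

lemma center_in_space [simp]: "center j x \<in> space M"
  by (simp add: center_def)

lemma center_dist: "x \<in> space M \<Longrightarrow> \<rho> (center j x) x < 2 ^ j"
  unfolding center_def idx_def
  by (rule LeastI_ex[of "\<lambda>k. \<rho> (net k) x < 2 ^ j"]) (rule net_dense, simp_all)

lemma measurable_idx [measurable]: "idx j \<in> measurable M (count_space UNIV)"
proof (subst measurable_count_space_eq2_countable, safe)
  fix k
  have "idx j -` {k} \<inter> space M = B (net k) (2 ^ j) - (\<Union>i\<in>{..<k}. B (net i) (2 ^ j))" (is "_ = ?E")
  proof (intro antisym subsetI)
    fix x assume x: "x \<in> idx j -` {k} \<inter> space M"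
    then have "\<rho> (net k) x < 2 ^ j" using center_dist[of x j] by (auto simp: center_def)
    moreover have "\<not> \<rho> (net i) x < 2 ^ j" if "i < k" for i
      using not_less_Least[of i "\<lambda>k. \<rho> (net k) x < 2 ^ j"] that x by (auto simp: idx_def)
    ultimately show "x \<in> ?E" using x by (auto simp: qball_def)
  next
    fix x assume x: "x \<in> ?E"
    then have "idx j x = k" unfolding idx_def
      by (intro Least_equality) (auto simp: qball_def not_less[symmetric])
    then show "x \<in> idx j -` {k} \<inter> space M" using x by (auto simp: qball_def)
  qed
  then show "idx j -` {k} \<inter> space M \<in> sets M" by (simp add: sets.finite_UN)
qed auto

lemma measurable_avg [measurable]: "avg j h \<in> borel_measurable M"
proof -
  have "(\<lambda>x. (\<lambda>k. ennreal (1 / V (net k) (3 * K * 2 ^ j)) * (\<integral>\<^sup>+y\<in>B (net k) (3 * K * 2 ^ j). h y \<partial>M)) (idx j x)) \<in> borel_measurable M"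
    by (rule measurable_compose[OF measurable_idx]) simp
  then show ?thesis by (simp add: avg_def[abs_def] center_def)
qed

lemma avg_mono: "(\<And>y. y \<in> space M \<Longrightarrow> h y \<le> h' y) \<Longrightarrow> avg j h x \<le> avg j h' x"
  unfolding avg_def by (intro mult_left_mono nn_integral_mono mult_right_mono) auto

lemma avg_add:
  assumes [measurable]: "h \<in> borel_measurable M" "h' \<in> borel_measurable M"
  shows "avg j (\<lambda>y. h y + h' y) x = avg j h x + avg j h' x"
  unfolding avg_def by (simp add: distrib_right nn_integral_add distrib_left)

lemma avg_const: "avg j (\<lambda>_. c) x = c"
proof -
  have "0 < V (center j x) (3 * K * 2 ^ j)" using K by (intro V_pos) auto
  then show ?thesis
    unfolding avg_def by (simp add: nn_integral_cmult_indicator emeasure_ball mult.left_commute[of _ c] ennreal_mult[symmetric])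
qed

text \<open>After exchanging the integrals, \<open>h y\<close> is weighted by the sum of the measures of those cells
  \<open>idx j x = k\<close> whose ball contains \<open>y\<close>, each divided by the measure of the ball. These cells are disjoint
  and lie in one ball around \<open>y\<close> of comparable measure, so the sum is bounded.\<close>

lemma nn_integral_avg_le:
  assumes [measurable]: "h \<in> borel_measurable M"
  shows "(\<integral>\<^sup>+x. avg j h x \<partial>M) \<le> ennreal (vratio (2 * K)) * (\<integral>\<^sup>+x. h x \<partial>M)"
proof -
  define r where "r = 3 * K * 2 ^ j"
  have r: "0 < r" using K by (simp add: r_def)
  define E where "E k = idx j -` {k} \<inter> space M" for k
  have E[measurable]: "E k \<in> sets M" for k unfolding E_def by measurable
  let ?v = "\<lambda>k. ennreal (1 / V (net k) r)" and ?I = "\<lambda>k. \<integral>\<^sup>+y\<in>B (net k) r. h y \<partial>M"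
  let ?m = "\<lambda>k y. indicator (B (net k) r) y * ?v k * emeasure M (E k)"
  have "(\<integral>\<^sup>+x. avg j h x \<partial>M)
    \<le> (\<integral>\<^sup>+x. (\<integral>\<^sup>+k. ?v k * ?I k * indicator (E k) x \<partial>count_space UNIV) \<partial>M)"
    (is "_ \<le> (\<integral>\<^sup>+x. (\<integral>\<^sup>+k. ?f k x \<partial>_) \<partial>M)")
  proof (rule nn_integral_mono)
    fix x assume x: "x \<in> space M"
    then have "avg j h x = ?f (idx j x) x"
      by (simp add: avg_def center_def r_def E_def)
    also have "\<dots> \<le> (\<integral>\<^sup>+k. ?f k x \<partial>count_space UNIV)"
      by (rule nn_integral_ge_point) simp
    finally show "avg j h x \<le> (\<integral>\<^sup>+k. ?f k x \<partial>count_space UNIV)" .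
  qed
  also have "\<dots> = (\<integral>\<^sup>+k. ?v k * ?I k * emeasure M (E k) \<partial>count_space UNIV)"
    by (subst nn_integral_count_space_nn_integral) (auto simp: nn_integral_cmult_indicator)
  also have "\<dots> = (\<integral>\<^sup>+k. (\<integral>\<^sup>+y. h y * ?m k y \<partial>M) \<partial>count_space UNIV)"
  proof (rule nn_integral_cong)
    fix k :: nat
    have "(\<integral>\<^sup>+y. h y * ?m k y \<partial>M)
      = (\<integral>\<^sup>+y. (?v k * emeasure M (E k)) * (h y * indicator (B (net k) r) y) \<partial>M)"
      by (simp only: mult_ac)
    also have "\<dots> = (?v k * emeasure M (E k)) * ?I k"
      by (rule nn_integral_cmult) measurable
    finally show "?v k * ?I k * emeasure M (E k)
      = (\<integral>\<^sup>+y. h y * ?m k y \<partial>M)"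
      by (simp only: mult_ac)
  qed
  also have "\<dots> = (\<integral>\<^sup>+y. (\<integral>\<^sup>+k. h y * ?m k y \<partial>count_space UNIV) \<partial>M)"
    by (subst nn_integral_count_space_nn_integral) auto
  also have "\<dots> \<le> (\<integral>\<^sup>+y. ennreal (vratio (2 * K)) * h y \<partial>M)"
  proof (rule nn_integral_mono)
    fix y assume y: "y \<in> space M"
    define R where "R = 2 * K * r"
    have R: "0 < R" using K r by (simp add: R_def)
    have VR: "0 < V y R" using y R by (rule V_pos)
    have "(\<integral>\<^sup>+k. ?m k y \<partial>count_space UNIV)
      \<le> (\<integral>\<^sup>+k. ennreal (vratio (2 * K) / V y R) * emeasure M (E k \<inter> B y R) \<partial>count_space UNIV)"
    proof (rule nn_integral_mono)
      fix k :: nat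
      show "?m k y
        \<le> ennreal (vratio (2 * K) / V y R) * emeasure M (E k \<inter> B y R)"
      proof (cases "y \<in> B (net k) r")
        case True
        then have d: "\<rho> y (net k) < r" "\<rho> (net k) y < r" using y sym[of y "net k"] by (auto simp: qball_def)
        have "1 * r \<le> 2 * K * r" using K r by (intro mult_right_mono) auto
        then have "\<rho> y (net k) \<le> 2 * K * r" using d by linarith
        then have "V y R \<le> vratio (2 * K) * V (net k) r"
          unfolding R_def using y K r by (intro V_comparable) auto
        moreover have "0 < V (net k) r" using r by (intro V_pos) auto
        ultimately have 1: "1 / V (net k) r \<le> vratio (2 * K) / V y R" using VR by (simp add: field_simps)
        have "E k \<subseteq> B y R"
        proof
          fix x assume x: "x \<in> E k"
          then have xX: "x \<in> space M" and "\<rho> (net k) x < 2 ^ j"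
            using center_dist[of x j] by (auto simp: E_def center_def)
          moreover have "2 ^ j \<le> r" unfolding r_def using K by simp
          ultimately have "\<rho> y (net k) + \<rho> (net k) x < 2 * r" using d by simp
          then have "K * (\<rho> y (net k) + \<rho> (net k) x) < K * (2 * r)" using K by simp
          then have "\<rho> y x < R" using triangle[of y "net k" x] y xX by (simp add: R_def)
          then show "x \<in> B y R" using xX by (simp add: qball_def)
        qed
        then have "E k \<inter> B y R = E k" by auto
        then show ?thesis using 1 True by (auto intro!: mult_right_mono ennreal_leI)
      qed simp
    qed
    also have "\<dots> = ennreal (vratio (2 * K) / V y R) * (\<Sum>k. emeasure M (E k \<inter> B y R))"
      by (simp add: nn_integral_cmult nn_integral_count_space_nat)
    also have "(\<Sum>k. emeasure M (E k \<inter> B y R)) = emeasure M (\<Union>k. E k \<inter> B y R)"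
      using y by (intro suminf_emeasure) (auto simp: disjoint_family_on_def E_def)
    also have "\<dots> \<le> ennreal (V y R)"
      using y by (subst emeasure_ball[symmetric]) (auto intro!: emeasure_mono)
    also have "ennreal (vratio (2 * K) / V y R) * ennreal (V y R) = ennreal (vratio (2 * K))"
      using VR vratio_pos[of "2 * K"] by (simp add: ennreal_mult[symmetric])
    finally have *: "(\<integral>\<^sup>+k. ?m k y \<partial>count_space UNIV) \<le> ennreal (vratio (2 * K))"
      by (simp add: mult_left_mono)
    have "(\<integral>\<^sup>+k. h y * ?m k y \<partial>count_space UNIV)
      = h y * (\<integral>\<^sup>+k. ?m k y \<partial>count_space UNIV)"
      by (rule nn_integral_cmult) simp
    also have "\<dots> \<le> h y * ennreal (vratio (2 * K))" using * by (rule mult_left_mono) simp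
    finally show "(\<integral>\<^sup>+k. h y * ?m k y \<partial>count_space UNIV) \<le> ennreal (vratio (2 * K)) * h y"
      by (simp add: mult.commute)
  qed
  finally show ?thesis by (simp add: nn_integral_cmult)
qed

text \<open>The radius \<open>3 * K * 2 ^ j\<close> of the averaging balls is chosen for this: the net point within
  \<open>2 ^ j\<close> of \<open>x\<close> then has every \<open>y\<close> with \<open>\<rho> x y < 2 ^ Suc j\<close> in its ball, and all balls involved are
  comparable.\<close>

lemma Umin_ge:
  assumes "x \<in> space M" "y \<in> space M" "2 ^ j \<le> \<rho> x y" "\<rho> x y < 2 ^ Suc j"
  shows "y \<in> B (center j x) (3 * K * 2 ^ j)"
    and "ennreal (V (center j x) (3 * K * 2 ^ j) / vratio (3 * K)) \<le> Umin M \<rho> x y"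
proof -
  let ?z = "center j x"
  have zx: "\<rho> ?z x < 2 ^ j" using assms by (intro center_dist)
  have "\<rho> ?z y \<le> K * (\<rho> ?z x + \<rho> x y)" using assms by (intro triangle) auto
  also have "\<dots> < K * (2 ^ j + 2 ^ Suc j)" using assms zx K by simp
  also have "\<dots> = 3 * K * 2 ^ j" by simp
  finally have zy: "\<rho> ?z y < 3 * K * 2 ^ j" .
  then show "y \<in> B ?z (3 * K * 2 ^ j)" using assms by (simp add: qball_def)
  have K3: "1 * 2 ^ j \<le> 3 * K * 2 ^ j" using K by (intro mult_right_mono) auto
  then have "\<rho> ?z x \<le> 3 * K * 2 ^ j" "\<rho> ?z y \<le> 3 * K * 2 ^ j" using zx zy by linarith+
  then have "V ?z (3 * K * 2 ^ j) \<le> vratio (3 * K) * V x (2 ^ j)" "V ?z (3 * K * 2 ^ j) \<le> vratio (3 * K) * V y (2 ^ j)"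
    using assms K by (intro V_comparable; simp)+
  moreover have "V x (2 ^ j) \<le> V x (\<rho> x y)" "V y (2 ^ j) \<le> V y (\<rho> x y)"
    using assms by (intro V_mono; simp)+
  ultimately have "V ?z (3 * K * 2 ^ j) / vratio (3 * K) \<le> V x (\<rho> x y)" "V ?z (3 * K * 2 ^ j) / vratio (3 * K) \<le> V y (\<rho> x y)"
    using vratio_pos[of "3 * K"] by (auto simp: divide_le_eq mult.commute intro: order_trans mult_left_mono)
  then show "ennreal (V ?z (3 * K * 2 ^ j) / vratio (3 * K)) \<le> Umin M \<rho> x y"
    unfolding Umin_def using assms by (auto simp: emeasure_ball intro!: ennreal_leI)
qed

end

lemma divide_le_mult_inverse_ennreal:
  assumes "0 < c" "ennreal c \<le> d" shows "(y::ennreal) / d \<le> ennreal (1 / c) * y"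
proof -
  have "y * (ennreal (1 / c) * ennreal c) \<le> y * (ennreal (1 / c) * d)"
    using assms by (intro mult_left_mono) auto
  moreover have "ennreal (1 / c) * ennreal c = 1" using assms by (simp add: ennreal_mult[symmetric])
  moreover have "0 < d" using assms by (auto intro: less_le_trans[of 0 "ennreal c"])
  ultimately show ?thesis by (intro divide_le_posI_ennreal) (auto simp: mult_ac)
qed

context doubling_space
begin

text \<open>A probability average over all scales \<open>2^j \<ge> 1\<close>. The truncated kernel with exponent \<open>a\<close>
  sums to the order \<open>1 / a\<close>, and the factor \<open>1 - 2 powr (- a)\<close> compensates this.\<close>

definition smear :: "real \<Rightarrow> ('a \<Rightarrow> ennreal) \<Rightarrow> 'a \<Rightarrow> ennreal" where
  "smear a h x = (\<Sum>j. ennreal ((1 - 2 powr (- a)) * 2 powr (- (real j * a))) * avg j h x)"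

lemma measurable_smear [measurable]: "smear a h \<in> borel_measurable M"
  unfolding smear_def[abs_def] by measurable

lemma smear_mono: "(\<And>y. y \<in> space M \<Longrightarrow> h y \<le> h' y) \<Longrightarrow> smear a h x \<le> smear a h' x"
  unfolding smear_def by (intro suminf_le mult_left_mono avg_mono) auto

lemma smear_add:
  assumes [measurable]: "h \<in> borel_measurable M" "h' \<in> borel_measurable M"
  shows "smear a (\<lambda>y. h y + h' y) x = smear a h x + smear a h' x"
  unfolding smear_def by (simp add: avg_add distrib_left suminf_add)

lemma suminf_smear_weights:
  assumes "0 < a"
  shows "(\<Sum>j. ennreal ((1 - 2 powr (- a)) * 2 powr (- (real j * a)))) = 1"
proof -
  have "(2::real) powr (- a) < 1" using assms by (simp add: powr_less_one)
  then show ?thesis using assms by (subst geometric_ennreal_suminf) auto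
qed

lemma smear_le_bound:
  assumes "0 < a" "\<And>j. avg j h x \<le> b"
  shows "smear a h x \<le> b"
proof -
  have "smear a h x \<le> (\<Sum>j. ennreal ((1 - 2 powr (- a)) * 2 powr (- (real j * a))) * b)"
    unfolding smear_def using assms by (intro suminf_le mult_left_mono) auto
  then show ?thesis by (simp add: suminf_smear_weights assms)
qed

lemma smear_const: "0 < a \<Longrightarrow> smear a (\<lambda>_. c) x = c"
  unfolding smear_def by (simp add: avg_const suminf_smear_weights)

lemma nn_integral_smear_le:
  assumes a: "0 < a" and [measurable]: "h \<in> borel_measurable M"
  shows "(\<integral>\<^sup>+x. smear a h x \<partial>M) \<le> ennreal (vratio (2 * K)) * (\<integral>\<^sup>+x. h x \<partial>M)"
proof -
  have "(\<integral>\<^sup>+x. smear a h x \<partial>M) = (\<Sum>j. ennreal ((1 - 2 powr (- a)) * 2 powr (- (real j * a))) * (\<integral>\<^sup>+x. avg j h x \<partial>M))"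
    unfolding smear_def by (simp add: nn_integral_suminf nn_integral_cmult)
  also have "\<dots> \<le> (\<Sum>j. ennreal ((1 - 2 powr (- a)) * 2 powr (- (real j * a))) * (ennreal (vratio (2 * K)) * (\<integral>\<^sup>+x. h x \<partial>M)))"
    by (intro suminf_le mult_left_mono nn_integral_avg_le) auto
  also have "\<dots> = ennreal (vratio (2 * K)) * (\<integral>\<^sup>+x. h x \<partial>M)"
    by (simp add: suminf_smear_weights a)
  finally show ?thesis .
qed

text \<open>Each \<open>y\<close> with \<open>\<rho> x y \<ge> 1\<close> lies on exactly one dyadic scale, and there the kernel is at most the kernel
  of the average on that scale times \<open>2 powr (- j a)\<close>.\<close>

lemma nn_integral_far_le_smear:
  assumes a: "0 < a" and x: "x \<in> space M" and [measurable]: "h \<in> borel_measurable M"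
  shows "(\<integral>\<^sup>+y. h y / (Umin M \<rho> x y * ennreal (\<rho> x y powr a)) * indicator {y. 1 \<le> \<rho> x y} y \<partial>M)
    \<le> ennreal (vratio (3 * K) / (1 - 2 powr (- a))) * smear a h x"
proof -
  define r :: "nat \<Rightarrow> real" where "r j = 3 * K * 2 ^ j" for j
  define w where "w j = vratio (3 * K) * 2 powr (- (real j * a))" for j :: nat
  have l: "0 < 1 - (2::real) powr (- a)" using a by (simp add: powr_less_one)
  let ?f = "\<lambda>j y. ennreal (w j) * (ennreal (1 / V (center j x) (r j)) * (h y * indicator (B (center j x) (r j)) y))"
  have "(\<integral>\<^sup>+y. h y / (Umin M \<rho> x y * ennreal (\<rho> x y powr a)) * indicator {y. 1 \<le> \<rho> x y} y \<partial>M)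
    \<le> (\<integral>\<^sup>+y. (\<Sum>j. ?f j y) \<partial>M)"
  proof (rule nn_integral_mono)
    fix y assume y: "y \<in> space M"
    show "h y / (Umin M \<rho> x y * ennreal (\<rho> x y powr a)) * indicator {y. 1 \<le> \<rho> x y} y \<le> (\<Sum>j. ?f j y)"
    proof (cases "1 \<le> \<rho> x y")
      case True
      define j where "j = nat \<lfloor>log 2 (\<rho> x y)\<rfloor>"
      have "0 \<le> log 2 (\<rho> x y)" using True by simp
      then have "real j \<le> log 2 (\<rho> x y)" "log 2 (\<rho> x y) < real (Suc j)" unfolding j_def by linarith+
      then have j: "2 ^ j \<le> \<rho> x y" "\<rho> x y < 2 ^ Suc j"
        using True by (simp_all add: le_log_iff log_less_iff powr_realpow del: of_nat_Suc power_Suc)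
      note U = Umin_ge[OF x y j, folded r_def]
      let ?c = "V (center j x) (r j) / vratio (3 * K) * 2 powr (real j * a)"
      have V: "0 < V (center j x) (r j)" using K by (intro V_pos) (auto simp: r_def)
      have c: "0 < ?c" using V vratio_pos by simp
      have "2 powr (real j * a) = (2 ^ j) powr a" by (simp add: powr_powr[symmetric] powr_realpow)
      also have "\<dots> \<le> \<rho> x y powr a" using j a by (intro powr_mono2) auto
      finally have "ennreal (V (center j x) (r j) / vratio (3 * K)) * ennreal (2 powr (real j * a)) \<le> Umin M \<rho> x y * ennreal (\<rho> x y powr a)"
        using U(2) by (intro mult_mono ennreal_leI) auto
      then have "ennreal ?c \<le> Umin M \<rho> x y * ennreal (\<rho> x y powr a)"
        using V vratio_pos[of "3 * K"] by (subst ennreal_mult) auto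
      then have "h y / (Umin M \<rho> x y * ennreal (\<rho> x y powr a)) \<le> ennreal (1 / ?c) * h y"
        by (rule divide_le_mult_inverse_ennreal[OF c])
      also have "1 / ?c = w j * (1 / V (center j x) (r j))"
        by (simp add: w_def powr_minus divide_simps)
      also have "ennreal (w j * (1 / V (center j x) (r j))) * h y = ?f j y"
        using U(1) V vratio_pos[of "3 * K"] by (subst ennreal_mult) (auto simp: w_def mult.assoc)
      also have "?f j y \<le> (\<Sum>j. ?f j y)"
        using nn_integral_ge_point[of j UNIV "\<lambda>j. ?f j y"] by (simp add: nn_integral_count_space_nat)
      finally show ?thesis using True by simp
    qed simp
  qed
  also have "\<dots> = (\<Sum>j. ennreal (w j) * avg j h x)"
    by (simp add: nn_integral_suminf nn_integral_cmult avg_def r_def)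
  also have "\<dots> = (\<Sum>j. ennreal (vratio (3 * K) / (1 - 2 powr (- a))) * (ennreal ((1 - 2 powr (- a)) * 2 powr (- (real j * a))) * avg j h x))"
  proof (intro arg_cong[where f = suminf] ext)
    fix j :: nat
    have "w j = vratio (3 * K) / (1 - 2 powr (- a)) * ((1 - 2 powr (- a)) * 2 powr (- (real j * a)))"
      using l a by (simp add: w_def)
    then have "ennreal (w j) = ennreal (vratio (3 * K) / (1 - 2 powr (- a))) * ennreal ((1 - 2 powr (- a)) * 2 powr (- (real j * a)))"
      using l vratio_pos[of "3 * K"] by (simp only: ennreal_mult powr_ge_zero mult_nonneg_nonneg divide_nonneg_nonneg less_imp_le)
    then show "ennreal (w j) * avg j h x = ennreal (vratio (3 * K) / (1 - 2 powr (- a))) * (ennreal ((1 - 2 powr (- a)) * 2 powr (- (real j * a))) * avg j h x)"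
      by (simp only: mult.assoc)
  qed
  finally show ?thesis unfolding smear_def by simp
qed

text \<open>Weak type estimate by the usual splitting: the part of \<open>g powr q\<close> below the level is harmless
  because the operator is an average, the rest is handled in \<open>L\<^sup>1\<close>.\<close>

lemma smear_weak_type:
  fixes k :: int and q :: real
  assumes a: "0 < a" and q: "0 < q" and [measurable]: "g \<in> borel_measurable M"
  shows "emeasure M {x \<in> space M. ennreal (2 * 2 powr (k * q)) < smear a (\<lambda>y. ennpowr (g y) q) x}
    \<le> ennreal (vratio (2 * K) * 2 powr q * 2 powr (- (k * q))) *
      int_sum (\<lambda>l::int. ennreal (2 powr (l * q)) * emeasure M {x \<in> space M. ennreal (2 powr l) < g x} * indicator {k::int..} l)"
    (is "_ \<le> _ * ?S")
proof -
  let ?h = "\<lambda>x. ennpowr (g x) q * indicator {x. ennreal (2 powr k) < g x} x"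
  let ?b = "2 powr (k * q)"
  have le: "smear a (\<lambda>y. ennpowr (g y) q) x \<le> ennreal ?b + smear a ?h x" for x
  proof -
    have "smear a (\<lambda>y. ennpowr (g y) q) x \<le> smear a (\<lambda>y. ennreal ?b + ?h y) x"
    proof (rule smear_mono)
      fix y
      have "ennpowr (g y) q \<le> ennpowr (ennreal (2 powr k)) q" if "\<not> ennreal (2 powr k) < g y"
        using that q by (intro ennpowr_mono) auto
      then show "ennpowr (g y) q \<le> ennreal ?b + ?h y"
        by (auto split: split_indicator simp: powr_powr)
    qed
    also have "\<dots> = smear a (\<lambda>_. ennreal ?b) x + smear a ?h x"
      by (rule smear_add) auto
    finally show ?thesis by (simp add: smear_const a)
  qed
  have "emeasure M {x \<in> space M. ennreal (2 * ?b) < smear a (\<lambda>y. ennpowr (g y) q) x}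
    \<le> emeasure M {x \<in> space M. 1 \<le> ennreal (1 / ?b) * smear a ?h x}"
  proof (intro emeasure_mono subsetI)
    fix x assume "x \<in> {x \<in> space M. ennreal (2 * ?b) < smear a (\<lambda>y. ennpowr (g y) q) x}"
    then have x: "x \<in> space M" and "ennreal (2 * ?b) < ennreal ?b + smear a ?h x"
      using le[of x] by (auto intro: less_le_trans)
    then have "ennreal ?b + ennreal ?b < ennreal ?b + smear a ?h x"
      by (simp add: ennreal_plus[symmetric] del: ennreal_plus)
    then have "\<not> smear a ?h x \<le> ennreal ?b"
      using add_left_mono[of "smear a ?h x" "ennreal ?b" "ennreal ?b"] by (auto dest: leD)
    then have "ennreal ?b \<le> smear a ?h x" by simp
    then have "ennreal (1 / ?b) * ennreal ?b \<le> ennreal (1 / ?b) * smear a ?h x" by (rule mult_left_mono) simp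
    then show "x \<in> {x \<in> space M. 1 \<le> ennreal (1 / ?b) * smear a ?h x}"
      using x by (simp add: ennreal_mult[symmetric])
  qed measurable
  also have "\<dots> \<le> ennreal (1 / ?b) * (\<integral>\<^sup>+x. smear a ?h x * indicator (space M) x \<partial>M)"
    by (rule nn_integral_Markov_inequality) auto
  also have "(\<integral>\<^sup>+x. smear a ?h x * indicator (space M) x \<partial>M) = (\<integral>\<^sup>+x. smear a ?h x \<partial>M)"
    by (intro nn_integral_cong) auto
  also have "ennreal (1 / ?b) * \<dots> \<le> ennreal (1 / ?b) * (ennreal (vratio (2 * K)) * (\<integral>\<^sup>+x. ?h x \<partial>M))"
    by (intro mult_left_mono nn_integral_smear_le a) auto
  also have "\<dots> \<le> ennreal (1 / ?b) * (ennreal (vratio (2 * K)) * (ennreal (2 powr q) * ?S))"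
    by (intro mult_left_mono nn_integral_above_level_le q) auto
  also have "\<dots> = ennreal (vratio (2 * K) * 2 powr q * 2 powr (- (k * q))) * ?S"
  proof -
    have "vratio (2 * K) * 2 powr q * 2 powr (- (k * q)) = 1 / ?b * (vratio (2 * K) * 2 powr q)"
      by (simp add: powr_minus divide_inverse)
    then have "ennreal (vratio (2 * K) * 2 powr q * 2 powr (- (k * q))) = ennreal (1 / ?b) * (ennreal (vratio (2 * K)) * ennreal (2 powr q))"
      using vratio_pos[of "2 * K"] by (simp only: ennreal_mult powr_ge_zero mult_nonneg_nonneg divide_nonneg_nonneg zero_le_one less_imp_le)
    then show ?thesis by (simp only: mult.assoc)
  qed
  finally show ?thesis .
qed

text \<open>Bounds on \<open>L\<^sup>1\<close> and \<open>L\<^sup>\<infinity>\<close>, both uniform in \<open>a\<close>, interpolate to every Lorentz space with \<open>q < p\<close>; the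
  inner power \<open>q\<close> rescales \<open>L\<^sup>1\<close> to \<open>L\<^sup>q\<close>. The uniformity comes from the total weight one of the scales.\<close>

lemma smear_dyadic_lorentz:
  assumes q: "0 < q" "q < p" and p1: "0 < p1"
  shows "\<exists>C>0. \<forall>a>0. \<forall>g\<in>borel_measurable M.
    dyadic_lorentz M p p1 (\<lambda>x. ennpowr (smear a (\<lambda>y. ennpowr (g y) q) x) (1 / q)) \<le> ennreal C * dyadic_lorentz M p p1 g"
proof -
  define A where "A = vratio (2 * K) * 2 powr q"
  have A: "0 < A" using vratio_pos by (simp add: A_def)
  define C1 where "C1 = (A / (1 - 2 powr (- ((p - q) / 2)))) powr (p1 / p) / (1 - 2 powr (- ((p - q) / 2 * (p1 / p))))"
  have p: "0 < p" using q by simp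
  have "0 < (p - q) / 2 * (p1 / p)" using q p1 p by simp
  then have "2 powr (- ((p - q) / 2 * (p1 / p))) < (1::real)" by (subst powr_less_one) auto
  moreover have "2 powr (- ((p - q) / 2)) < (1::real)" using q by (subst powr_less_one) auto
  moreover have "0 < (A / (1 - 2 powr (- ((p - q) / 2)))) powr (p1 / p)"
    using calculation(2) A q by (subst powr_gt_zero) simp
  ultimately have C1: "0 < C1" unfolding C1_def by (intro divide_pos_pos) (simp_all only: diff_gt_0_iff_gt)
  define C where "C = (2 * 2 powr (1 / q)) powr p1 * C1"
  show ?thesis
  proof (intro exI[of _ C] conjI allI impI ballI)
    show "0 < C" using C1 by (simp add: C_def)
    fix a :: real and g :: "'a \<Rightarrow> ennreal" assume a: "0 < a" and [measurable]: "g \<in> borel_measurable M"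
    let ?Tg = "smear a (\<lambda>y. ennpowr (g y) q)"
    let ?u = "\<lambda>x. ennpowr (ennreal (1 / 2) * ?Tg x) (1 / q)"
    have "dyadic_lorentz M p p1 ?u \<le> ennreal C1 * dyadic_lorentz M p p1 g"
      unfolding C1_def
    proof (rule dyadic_lorentz_interpolation[OF q p1 A])
      fix k :: int
      have "ennreal (2 powr k) < ?u x \<longleftrightarrow> ennreal (2 * 2 powr (k * q)) < ?Tg x" for x
      proof -
        have "ennreal (2 powr k) < ?u x \<longleftrightarrow> ennpowr (ennreal (2 powr k)) q < ennpowr (?u x) q"
          using q by (simp only: ennpowr_less_iff)
        also have "\<dots> \<longleftrightarrow> ennreal (2 powr (k * q)) < ennreal (1 / 2) * ?Tg x"
          using q by (simp add: ennpowr_ennpowr powr_powr)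
        also have "ennreal (2 powr (k * q)) = ennreal (1 / 2) * ennreal (2 * 2 powr (k * q))"
          by (subst ennreal_mult[symmetric]) auto
        also have "ennreal (1 / 2) * ennreal (2 * 2 powr (k * q)) < ennreal (1 / 2) * ?Tg x \<longleftrightarrow> ennreal (2 * 2 powr (k * q)) < ?Tg x"
          by (simp add: not_le[symmetric] ennreal_mult_le_mult_iff)
        finally show ?thesis .
      qed
      then show "emeasure M {x \<in> space M. ennreal (2 powr k) < ?u x} \<le> ennreal (A * 2 powr (- (k * q))) *
        int_sum (\<lambda>l::int. ennreal (2 powr (l * q)) * emeasure M {x \<in> space M. ennreal (2 powr l) < g x} * indicator {k::int..} l)"
        unfolding A_def using smear_weak_type[OF a q(1), of g k] by simp
    qed
    moreover have "dyadic_lorentz M p p1 (\<lambda>x. ennpowr (?Tg x) (1 / q)) = dyadic_lorentz M p p1 (\<lambda>x. ennreal (2 powr (1 / q)) * ?u x)"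
    proof -
      have "ennpowr y (1 / q) = ennreal (2 powr (1 / q)) * ennpowr (ennreal (1 / 2) * y) (1 / q)" for y
      proof -
        have "ennreal 2 * ennreal (1 / 2) = 1" by (subst ennreal_mult[symmetric]) auto
        then have eq: "ennreal 2 * (ennreal (1 / 2) * y) = y" by (simp only: mult.assoc[symmetric] mult_1)
        have "ennpowr (ennreal 2 * (ennreal (1 / 2) * y)) (1 / q) = ennreal (2 powr (1 / q)) * ennpowr (ennreal (1 / 2) * y) (1 / q)"
          by (rule ennpowr_mult) simp
        then show ?thesis by (simp only: eq)
      qed
      then show ?thesis by (intro arg_cong[where f = "dyadic_lorentz M p p1"] ext)
    qed
    moreover have "dyadic_lorentz M p p1 (\<lambda>x. ennreal (2 powr (1 / q)) * ?u x) \<le> ennreal ((2 * 2 powr (1 / q)) powr p1) * dyadic_lorentz M p p1 ?u"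
      using p p1 by (intro dyadic_lorentz_scale) auto
    ultimately show "dyadic_lorentz M p p1 (\<lambda>x. ennpowr (?Tg x) (1 / q)) \<le> ennreal C * dyadic_lorentz M p p1 g"
      using C1 mult_left_mono[of "dyadic_lorentz M p p1 ?u" "ennreal C1 * dyadic_lorentz M p p1 g" "ennreal ((2 * 2 powr (1 / q)) powr p1)"]
      by (simp add: C_def ennreal_mult mult.assoc)
  qed
qed

end

section \<open>Generalized Lorentz--Morrey spaces\<close>

locale lorentz_morrey = doubling_space M \<rho> K L
  for M :: "'a measure" and \<rho> and K L +
  fixes p p1 q :: real and \<phi> :: "'a \<Rightarrow> real \<Rightarrow> real" and Cd Cn :: real
  assumes q: "0 < q" "q < p" and p1: "0 < p1"
    and \<phi>_pos: "x \<in> space M \<Longrightarrow> 0 < r \<Longrightarrow> 0 < \<phi> x r"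
    and Cd: "1 \<le> Cd" and Cn: "1 \<le> Cn"
    and \<phi>_decreasing: "x \<in> space M \<Longrightarrow> 0 < r \<Longrightarrow> r \<le> s \<Longrightarrow> \<phi> x s \<le> Cd * \<phi> x r"
    and \<phi>_near: "x \<in> space M \<Longrightarrow> y \<in> space M \<Longrightarrow> 0 < r \<Longrightarrow> \<rho> x y \<le> r \<Longrightarrow> \<phi> x r \<le> Cn * \<phi> y r"
begin

abbreviation DL :: "('a \<Rightarrow> ennreal) \<Rightarrow> ennreal" where "DL \<equiv> dyadic_lorentz M p p1"
abbreviation LM :: "('a \<Rightarrow> ereal) \<Rightarrow> ennreal" where "LM \<equiv> LM_norm M \<rho> p p1 \<phi>"
abbreviation LM_on :: "'a set \<Rightarrow> ('a \<Rightarrow> ereal) \<Rightarrow> ennreal" where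
  "LM_on \<equiv> LM_norm_on M \<rho> p p1 \<phi>"
abbreviation Sob :: "'a set \<Rightarrow> real \<Rightarrow> ('a \<Rightarrow> real) \<Rightarrow> ennreal" where
  "Sob \<Omega> s f \<equiv> LM_sobolev_norm M \<rho> p p1 \<phi> \<Omega> s q f"

lemma p: "0 < p" using q by simp

definition weight :: "'a \<Rightarrow> real \<Rightarrow> real" where
  "weight x r = \<phi> x r * V x r powr (1 / p)"

lemma weight_pos: "x \<in> space M \<Longrightarrow> 0 < r \<Longrightarrow> 0 < weight x r"
  using \<phi>_pos[of x r] V_pos[of x r] by (simp add: weight_def)

text \<open>Membership with quasi-norm at most about \<open>N\<close>, phrased for a finite bound \<open>N\<close> and through the dyadic
  functional. As a predicate it avoids division by the weight and infinite values.\<close>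

definition morrey :: "('a \<Rightarrow> ennreal) \<Rightarrow> real \<Rightarrow> bool" where
  "morrey h N \<longleftrightarrow> (\<forall>x\<in>space M. \<forall>r>0.
     DL (\<lambda>y. h y * indicator (B x r) y) \<le> ennreal ((N * weight x r) powr p1))"

lemma morreyD:
  "morrey h N \<Longrightarrow> x \<in> space M \<Longrightarrow> 0 < r \<Longrightarrow>
    DL (\<lambda>y. h y * indicator (B x r) y) \<le> ennreal ((N * weight x r) powr p1)"
  by (simp add: morrey_def)

lemma morreyI:
  assumes "0 < C" "0 < N" "\<And>x r. x \<in> space M \<Longrightarrow> 0 < r \<Longrightarrow>
    DL (\<lambda>y. h y * indicator (B x r) y) \<le> ennreal C * ennreal ((N * weight x r) powr p1)"
  shows "morrey h (C powr (1 / p1) * N)"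
  unfolding morrey_def
proof (intro ballI allI impI)
  fix x and r :: real assume xr: "x \<in> space M" "0 < r"
  have "(C powr (1 / p1) * N * weight x r) powr p1 = C * (N * weight x r) powr p1"
    using assms p1 weight_pos[OF xr] by (simp add: powr_mult powr_powr)
  then show "DL (\<lambda>y. h y * indicator (B x r) y) \<le> ennreal ((C powr (1 / p1) * N * weight x r) powr p1)"
    using assms(1,2) assms(3)[OF xr] by (simp add: ennreal_mult)
qed

lemma morrey_mono:
  assumes "morrey h' N" "h' \<in> borel_measurable M" "\<And>x. x \<in> space M \<Longrightarrow> h x \<le> h' x"
  shows "morrey h N"
  unfolding morrey_def
proof (intro ballI allI impI)
  fix x and r :: real assume xr: "x \<in> space M" "0 < r"
  have "DL (\<lambda>y. h y * indicator (B x r) y) \<le> DL (\<lambda>y. h' y * indicator (B x r) y)"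
    using p p1 xr assms by (intro dyadic_lorentz_mono mult_right_mono) (auto intro: borel_measurable_times_ennreal)
  also have "\<dots> \<le> ennreal ((N * weight x r) powr p1)" by (rule morreyD[OF assms(1) xr])
  finally show "DL (\<lambda>y. h y * indicator (B x r) y) \<le> ennreal ((N * weight x r) powr p1)" .
qed

lemma morrey_weaken: "morrey h N \<Longrightarrow> 0 \<le> N \<Longrightarrow> N \<le> N' \<Longrightarrow> morrey h N'"
  unfolding morrey_def using weight_pos p1
  by (meson ennreal_leI order_trans powr_mono2 mult_right_mono mult_nonneg_nonneg less_imp_le)

lemma morrey_scale:
  assumes "morrey h N" "0 < c" "0 < N" and [measurable]: "h \<in> borel_measurable M"
  shows "morrey (\<lambda>x. ennreal c * h x) (2 * c * N)"
  unfolding morrey_def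
proof (intro ballI allI impI)
  fix x and r :: real assume xr: "x \<in> space M" "0 < r"
  have "DL (\<lambda>y. ennreal c * h y * indicator (B x r) y)
    = DL (\<lambda>y. ennreal c * (h y * indicator (B x r) y))" by (simp only: mult.assoc)
  also have "\<dots> \<le> ennreal ((2 * c) powr p1) * DL (\<lambda>y. h y * indicator (B x r) y)"
    using p p1 assms xr by (intro dyadic_lorentz_scale) auto
  also have "\<dots> \<le> ennreal ((2 * c) powr p1) * ennreal ((N * weight x r) powr p1)"
    by (intro mult_left_mono morreyD[OF assms(1) xr]) auto
  also have "\<dots> = ennreal ((2 * c * N * weight x r) powr p1)"
    using assms weight_pos[OF xr] by (simp add: ennreal_mult[symmetric] powr_mult mult.assoc)
  finally show "DL (\<lambda>y. ennreal c * h y * indicator (B x r) y) \<le> ennreal ((2 * c * N * weight x r) powr p1)" .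
qed

lemma morrey_max:
  assumes "morrey h N" "morrey h' N" "0 < N" and [measurable]: "h \<in> borel_measurable M" "h' \<in> borel_measurable M"
  shows "morrey (\<lambda>x. max (h x) (h' x)) ((2 powr (p1 / p) * 2) powr (1 / p1) * N)"
proof (rule morreyI)
  fix x and r :: real assume xr: "x \<in> space M" "0 < r"
  let ?Z = "ennreal ((N * weight x r) powr p1)"
  have "(\<lambda>y. max (h y) (h' y) * indicator (B x r) y) = (\<lambda>y. max (h y * indicator (B x r) y) (h' y * indicator (B x r) y))"
    by (auto split: split_indicator)
  then have "DL (\<lambda>y. max (h y) (h' y) * indicator (B x r) y)
    \<le> ennreal (2 powr (p1 / p)) * (DL (\<lambda>y. h y * indicator (B x r) y) + DL (\<lambda>y. h' y * indicator (B x r) y))"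
    using p p1 xr by (simp add: dyadic_lorentz_max)
  also have "\<dots> \<le> ennreal (2 powr (p1 / p)) * (?Z + ?Z)"
    by (intro mult_left_mono add_mono morreyD assms xr) auto
  also have "\<dots> = ennreal (2 powr (p1 / p) * 2) * ?Z"
    by (simp add: ennreal_mult[symmetric] ennreal_plus[symmetric] del: ennreal_plus)
  finally show "DL (\<lambda>y. max (h y) (h' y) * indicator (B x r) y) \<le> ennreal (2 powr (p1 / p) * 2) * ?Z" .
qed (use assms in auto)

lemma morrey_SUP:
  assumes [measurable]: "\<And>n. h n \<in> borel_measurable M"
    and "\<And>x. x \<in> space M \<Longrightarrow> incseq (\<lambda>n. h n x)" and "\<And>n::nat. morrey (h n) N"
  shows "morrey (\<lambda>x. SUP n. h n x) N"
  unfolding morrey_def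
proof (intro ballI allI impI)
  fix x and r :: real assume xr: "x \<in> space M" "0 < r"
  have "DL (\<lambda>y. (SUP n. h n y * indicator (B x r) y)) \<le> ennreal ((N * weight x r) powr p1)"
    using assms p p1 xr by (intro dyadic_lorentz_SUP_le morreyD[OF assms(3) xr])
      (auto simp: incseq_def intro!: mult_right_mono)
  also have "(\<lambda>y. (SUP n. h n y * indicator (B x r) y)) = (\<lambda>y. (SUP n. h n y) * indicator (B x r) y)"
    by (auto split: split_indicator)
  finally show "DL (\<lambda>y. (SUP n. h n y) * indicator (B x r) y) \<le> ennreal ((N * weight x r) powr p1)" .
qed

definition C_avg :: real where "C_avg = 2 powr q + 2 powr q / (1 - 2 powr (q - p))"

lemma C_avg_pos: "0 < C_avg"
proof -
  have "2 powr (q - p) < (1::real)" using q by (subst powr_less_one) auto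
  then show ?thesis by (simp add: C_avg_def add_pos_pos)
qed

text \<open>The Lorentz bound on a ball controls the mean of \<open>h powr q\<close> there, and in the Morrey normalisation
  the powers of the measure of the ball cancel.\<close>

lemma morrey_ball_integral:
  assumes "morrey h N" "0 < N" "h \<in> borel_measurable M" "x \<in> space M" "0 < r"
  shows "(\<integral>\<^sup>+y\<in>B x r. ennpowr (h y) q \<partial>M) \<le> ennreal (C_avg * (N * \<phi> x r) powr q * V x r)"
  unfolding C_avg_def
proof (rule nn_integral_powr_le_dyadic_lorentz)
  show "DL (\<lambda>y. h y * indicator (B x r) y) \<le> ennreal ((N * \<phi> x r * V x r powr (1 / p)) powr p1)"
    using morreyD[OF assms(1,4,5)] by (simp add: weight_def mult.assoc)
qed (use assms q p1 \<phi>_pos emeasure_ball in auto)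

text \<open>An averaging ball with centre within \<open>2 ^ j\<close> of a point of \<open>B x0 r\<close> and radius \<open>3 * K * 2 ^ j\<close> can
  leave \<open>B x0 (\<Lambda> * r)\<close> only if \<open>2 ^ j \<ge> r\<close>; this fixes \<open>\<Lambda>\<close>. For such \<open>j\<close> the Morrey condition bounds the
  average by \<open>\<phi>\<close> at a nearby centre and a larger radius, and nearness and almost monotonicity of
  \<open>\<phi>\<close> lead back to \<open>\<phi> x0 r\<close>.\<close>

lemma avg_far_part_le:
  assumes g: "morrey g N" "0 < N" "g \<in> borel_measurable M"
    and x0: "x0 \<in> space M" "0 < r" and x: "x \<in> B x0 r"
  defines "\<Lambda> \<equiv> K * (1 + K * (3 * K + 1))"
  shows "avg j (\<lambda>y. ennpowr (g y) q * indicator (- B x0 (\<Lambda> * r)) y) x \<le> ennreal (C_avg * (Cn\<^sup>2 * Cd * (N * \<phi> x0 r)) powr q)"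
proof -
  let ?c = "center j x" and ?R = "3 * K * 2 ^ j"
  have xX: "x \<in> space M" and x0x: "\<rho> x0 x < r" using x by (auto simp: qball_def)
  have cx: "\<rho> ?c x < 2 ^ j" using center_dist[OF xX] .
  show ?thesis
  proof (cases "B ?c ?R \<subseteq> B x0 (\<Lambda> * r)")
    case True
    then have "(\<lambda>y. ennpowr (g y) q * indicator (- B x0 (\<Lambda> * r)) y * indicator (B ?c ?R) y) = (\<lambda>_. 0)"
      by (auto simp: fun_eq_iff split: split_indicator)
    then show ?thesis by (simp add: avg_def)
  next
    case False
    then obtain y where y: "y \<in> space M" "\<rho> ?c y < ?R" "\<Lambda> * r \<le> \<rho> x0 y"
    proof -
      obtain z where "z \<in> B ?c ?R" "z \<notin> B x0 (\<Lambda> * r)" using False by blast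
      then show ?thesis by (intro that[of z]) (auto simp: qball_def)
    qed
    have "\<rho> x y \<le> K * (\<rho> x ?c + \<rho> ?c y)" using xX y by (intro triangle) auto
    also have "\<dots> \<le> K * (2 ^ j + ?R)" using cx y K sym[of x ?c] xX by (intro mult_left_mono add_mono) auto
    finally have xy: "\<rho> x y \<le> K * (3 * K + 1) * 2 ^ j" by (simp add: algebra_simps)
    have "\<Lambda> * r \<le> K * (\<rho> x0 x + \<rho> x y)" using y(3) triangle[OF x0(1) xX y(1)] by simp
    also have "\<dots> \<le> K * (r + K * (3 * K + 1) * 2 ^ j)" using x0x xy K by (intro mult_left_mono add_mono) auto
    finally have "K * (r + K * (3 * K + 1) * r) \<le> K * (r + K * (3 * K + 1) * 2 ^ j)"
      by (simp add: \<Lambda>_def algebra_simps)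
    then have "K * (3 * K + 1) * r \<le> K * (3 * K + 1) * 2 ^ j" using K by simp
    moreover have "0 < K * (3 * K + 1)" using K by (simp add: add_pos_pos)
    ultimately have rj: "r \<le> 2 ^ j" using mult_le_cancel_left_pos by blast
    have "1 * 2 ^ j \<le> ?R" using K by (intro mult_right_mono) auto
    then have R: "2 ^ j \<le> ?R" by simp
    have R0: "0 < ?R" using K by simp
    have "\<rho> ?c x \<le> ?R" "\<rho> x x0 \<le> ?R" "r \<le> ?R" using cx R x0x rj sym[of x x0] xX x0 by linarith+
    note near = this
    have "\<phi> ?c ?R \<le> Cn * \<phi> x ?R" using near xX R0 by (intro \<phi>_near) auto
    also have "\<phi> x ?R \<le> Cn * \<phi> x0 ?R" using near xX x0 R0 by (intro \<phi>_near) auto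
    also have "\<phi> x0 ?R \<le> Cd * \<phi> x0 r" using x0 near by (intro \<phi>_decreasing) auto
    finally have "\<phi> ?c ?R \<le> Cn\<^sup>2 * Cd * \<phi> x0 r" using Cn by (simp add: power2_eq_square mult.assoc mult_left_mono)
    from mult_left_mono[OF this, of N]
    have \<phi>: "N * \<phi> ?c ?R \<le> Cn\<^sup>2 * Cd * (N * \<phi> x0 r)" using g(2) by (simp add: mult_ac)
    have V: "0 < V ?c ?R" using R0 by (intro V_pos) auto
    have "avg j (\<lambda>y. ennpowr (g y) q * indicator (- B x0 (\<Lambda> * r)) y) x \<le> avg j (\<lambda>y. ennpowr (g y) q) x"
      by (intro avg_mono) (auto split: split_indicator)
    also have "\<dots> \<le> ennreal (1 / V ?c ?R) * ennreal (C_avg * (N * \<phi> ?c ?R) powr q * V ?c ?R)"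
      unfolding avg_def using g R0 by (intro mult_left_mono morrey_ball_integral) auto
    also have "\<dots> = ennreal (C_avg * (N * \<phi> ?c ?R) powr q)"
      using V C_avg_pos by (simp add: ennreal_mult[symmetric])
    also have "\<dots> \<le> ennreal (C_avg * (Cn\<^sup>2 * Cd * (N * \<phi> x0 r)) powr q)"
      using \<phi> C_avg_pos q g \<phi>_pos[of ?c ?R] R0 by (intro ennreal_leI mult_left_mono powr_mono2) auto
    finally show ?thesis .
  qed
qed

lemma weight_dilate:
  assumes "x \<in> space M" "0 < r" "1 \<le> c"
  shows "weight x (c * r) \<le> Cd * vratio c powr (1 / p) * weight x r"
proof -
  have "1 * r \<le> c * r" using assms by (intro mult_right_mono) auto
  then have 1: "\<phi> x (c * r) \<le> Cd * \<phi> x r" using assms by (intro \<phi>_decreasing) auto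
  have "\<rho> x x = 0" using zero_iff assms by blast
  then have "V x (c * r) \<le> vratio c * V x r" using assms by (intro V_comparable) auto
  then have "V x (c * r) powr (1 / p) \<le> (vratio c * V x r) powr (1 / p)"
    using p by (intro powr_mono2) auto
  also have "\<dots> = vratio c powr (1 / p) * V x r powr (1 / p)"
    using vratio_pos[of c] by (simp add: powr_mult)
  finally have "weight x (c * r) \<le> (Cd * \<phi> x r) * (vratio c powr (1 / p) * V x r powr (1 / p))"
    unfolding weight_def using 1 assms Cd \<phi>_pos[of x r] by (intro mult_mono) auto
  then show ?thesis by (simp add: weight_def mult_ac)
qed

text \<open>On a ball \<open>B x0 r\<close> the function splits into its part on \<open>B x0 (\<Lambda> * r)\<close>, to which the Lorentz bound
  applies, and its far part, which contributes at most a constant of the size \<open>N * \<phi> x0 r\<close>; the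
  indicator function of a ball has Lorentz quasi-norm comparable with \<open>V x0 r powr (1 / p)\<close>.\<close>

lemma smear_morrey:
  shows "\<exists>C>0. \<forall>a>0. \<forall>g\<in>borel_measurable M. \<forall>N>0. morrey g N \<longrightarrow>
    morrey (\<lambda>x. ennpowr (smear a (\<lambda>y. ennpowr (g y) q) x) (1 / q)) (C * N)"
proof -
  obtain C0 where C0: "0 < C0" "\<And>a g. 0 < a \<Longrightarrow> g \<in> borel_measurable M \<Longrightarrow>
    DL (\<lambda>x. ennpowr (smear a (\<lambda>y. ennpowr (g y) q) x) (1 / q)) \<le> ennreal C0 * DL g"
    using smear_dyadic_lorentz[OF q p1] by metis
  define \<Lambda> where "\<Lambda> = K * (1 + K * (3 * K + 1))"
  have "1 * 1 \<le> K * (1 + K * (3 * K + 1))" using K by (intro mult_mono) auto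
  then have \<Lambda>: "1 \<le> \<Lambda>" by (simp add: \<Lambda>_def)
  define C1 where "C1 = C0 * (Cd * vratio \<Lambda> powr (1 / p)) powr p1"
  define E where "E = C_avg powr (1 / q) * (Cn\<^sup>2 * Cd)"
  define C2 where "C2 = 2 powr p1 / (1 - 2 powr (- p1)) * E powr p1"
  define C3 where "C3 = (2 * 2 powr (1 / q)) powr p1 * (2 powr (p1 / p) * (C1 + C2))"
  have l: "0 < 1 - (2::real) powr (- p1)" using p1 by (simp add: powr_less_one)
  have C1: "0 < C1" using C0 Cd vratio_pos[of \<Lambda>] by (simp add: C1_def)
  have E: "0 < E" using C_avg_pos Cn Cd by (simp add: E_def)
  have C2: "0 < C2" using E l by (simp add: C2_def)
  have C3: "0 < C3" using C1 C2 by (simp add: C3_def add_pos_pos)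
  show ?thesis
  proof (intro exI[of _ "C3 powr (1 / p1)"] conjI allI impI ballI)
    show "0 < C3 powr (1 / p1)" using C3 by simp
    fix a :: real and g :: "'a \<Rightarrow> ennreal" and N :: real
    assume a: "0 < a" and g[measurable]: "g \<in> borel_measurable M" and N: "0 < N" and mg: "morrey g N"
    let ?T = "\<lambda>h x. ennpowr (smear a h x) (1 / q)"
    show "morrey (?T (\<lambda>y. ennpowr (g y) q)) (C3 powr (1 / p1) * N)"
    proof (rule morreyI[OF C3 N])
      fix x0 and r :: real assume xr: "x0 \<in> space M" "0 < r"
      note [measurable] = ball_measurable[OF xr(1)]
      let ?B = "B x0 r" and ?B' = "B x0 (\<Lambda> * r)"
      let ?Z = "ennreal ((N * weight x0 r) powr p1)"
      let ?g1 = "\<lambda>y. g y * indicator ?B' y"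
      let ?u1 = "?T (\<lambda>y. ennpowr (?g1 y) q)"
      let ?b = "C_avg * (Cn\<^sup>2 * Cd * (N * \<phi> x0 r)) powr q"
      let ?u2 = "\<lambda>x. ennreal (?b powr (1 / q)) * indicator ?B x"
      have \<phi>0: "0 < \<phi> x0 r" using xr by (intro \<phi>_pos)
      have b: "0 < ?b" using C_avg_pos Cn Cd N \<phi>0 by simp
      have split: "?T (\<lambda>y. ennpowr (g y) q) x * indicator ?B x \<le> ennreal (2 powr (1 / q)) * max (?u1 x) (?u2 x)" for x
      proof (cases "x \<in> ?B")
        case True
        let ?h = "\<lambda>y. ennpowr (g y) q * indicator (- ?B') y"
        have "smear a (\<lambda>y. ennpowr (g y) q) x = smear a (\<lambda>y. ennpowr (?g1 y) q + ?h y) x"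
          by (intro arg_cong[where f = "\<lambda>h. smear a h x"]) (auto split: split_indicator)
        also have "\<dots> = smear a (\<lambda>y. ennpowr (?g1 y) q) x + smear a ?h x"
          by (rule smear_add) auto
        also have "smear a ?h x \<le> ennreal ?b"
          unfolding \<Lambda>_def by (rule smear_le_bound[OF a]) (rule avg_far_part_le[OF mg N g xr True])
        also have "smear a (\<lambda>y. ennpowr (?g1 y) q) x + ennreal ?b
          \<le> max (smear a (\<lambda>y. ennpowr (?g1 y) q) x) (ennreal ?b) + max (smear a (\<lambda>y. ennpowr (?g1 y) q) x) (ennreal ?b)"
          by (intro add_mono) auto
        finally have "smear a (\<lambda>y. ennpowr (g y) q) x \<le> ennreal 2 * max (smear a (\<lambda>y. ennpowr (?g1 y) q) x) (ennreal ?b)"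
          by (simp add: mult_2 add_left_mono)
        then have "?T (\<lambda>y. ennpowr (g y) q) x \<le> ennpowr (ennreal 2 * max (smear a (\<lambda>y. ennpowr (?g1 y) q) x) (ennreal ?b)) (1 / q)"
          using q by (intro ennpowr_mono) auto
        also have "\<dots> = ennreal (2 powr (1 / q)) * max (?u1 x) (ennreal (?b powr (1 / q)))"
          using q b by (subst ennpowr_mult) (auto simp: ennpowr_max)
        finally show ?thesis using True by simp
      qed simp
      have d1: "DL ?u1 \<le> ennreal C1 * ?Z"
      proof -
        have \<Lambda>r: "0 < \<Lambda> * r" using \<Lambda> xr by simp
        have "DL ?u1 \<le> ennreal C0 * DL ?g1"
          using C0(2)[OF a, of ?g1] by simp
        also have "\<dots> \<le> ennreal C0 * ennreal ((N * weight x0 (\<Lambda> * r)) powr p1)"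
          by (intro mult_left_mono morreyD[OF mg xr(1) \<Lambda>r]) auto
        also have "\<dots> \<le> ennreal C0 * ennreal ((N * (Cd * vratio \<Lambda> powr (1 / p) * weight x0 r)) powr p1)"
          using weight_dilate[OF xr \<Lambda>] N p1 weight_pos[OF xr(1) \<Lambda>r]
          by (intro mult_left_mono ennreal_leI powr_mono2) auto
        also have "N * (Cd * vratio \<Lambda> powr (1 / p) * weight x0 r) = (Cd * vratio \<Lambda> powr (1 / p)) * (N * weight x0 r)" by simp
        also have "\<dots> powr p1 = (Cd * vratio \<Lambda> powr (1 / p)) powr p1 * (N * weight x0 r) powr p1"
          by (rule powr_mult)
        also have "ennreal C0 * ennreal \<dots> = ennreal C1 * ?Z"
          using C0 by (simp add: C1_def ennreal_mult[symmetric] mult.assoc)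
        finally show ?thesis .
      qed
      have d2: "DL ?u2 \<le> ennreal C2 * ?Z"
      proof -
        have b_root: "?b powr (1 / q) = E * (N * \<phi> x0 r)"
          using q C_avg_pos Cn Cd N \<phi>0 by (simp add: E_def powr_mult powr_powr)
        have "DL ?u2 \<le> ennreal (2 powr p1 / (1 - 2 powr (- p1))) * ennpowr (ennreal (?b powr (1 / q))) p1 * ennpowr (emeasure M ?B) (p1 / p)"
          using p p1 by (intro dyadic_lorentz_indicator) auto
        also have "\<dots> = ennreal (2 powr p1 / (1 - 2 powr (- p1)) * (?b powr (1 / q)) powr p1 * V x0 r powr (p1 / p))"
          using xr l by (simp add: emeasure_ball ennreal_mult[symmetric])
        also have "2 powr p1 / (1 - 2 powr (- p1)) * (?b powr (1 / q)) powr p1 * V x0 r powr (p1 / p) = C2 * (N * weight x0 r) powr p1"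
          unfolding b_root using E N \<phi>0 by (simp add: C2_def weight_def powr_mult powr_powr)
        also have "ennreal \<dots> = ennreal C2 * ?Z" using C2 by (simp add: ennreal_mult)
        finally show ?thesis .
      qed
      have "DL (\<lambda>x. ?T (\<lambda>y. ennpowr (g y) q) x * indicator ?B x)
        \<le> DL (\<lambda>x. ennreal (2 powr (1 / q)) * max (?u1 x) (?u2 x))"
        using p p1 split by (intro dyadic_lorentz_mono) auto
      also have "\<dots> \<le> ennreal ((2 * 2 powr (1 / q)) powr p1) * DL (\<lambda>x. max (?u1 x) (?u2 x))"
        using p p1 by (intro dyadic_lorentz_scale) auto
      also have "\<dots> \<le> ennreal ((2 * 2 powr (1 / q)) powr p1) * (ennreal (2 powr (p1 / p)) * (DL ?u1 + DL ?u2))"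
        using p p1 by (intro mult_left_mono dyadic_lorentz_max) auto
      also have "\<dots> \<le> ennreal ((2 * 2 powr (1 / q)) powr p1) * (ennreal (2 powr (p1 / p)) * (ennreal C1 * ?Z + ennreal C2 * ?Z))"
        by (intro mult_left_mono add_mono d1 d2) auto
      also have "\<dots> = ennreal C3 * ?Z"
        using C1 C2 by (simp add: C3_def distrib_right[symmetric] ennreal_plus[symmetric] ennreal_mult mult.assoc del: ennreal_plus)
      finally show "DL (\<lambda>x. ?T (\<lambda>y. ennpowr (g y) q) x * indicator ?B x) \<le> ennreal C3 * ?Z" .
    qed
  qed
qed

definition C_from_morrey :: real where
  "C_from_morrey = (2 powr p1 * p / p1) powr (1 / p1)"

definition C_to_morrey :: real where
  "C_to_morrey = (p1 / p * (2 powr p1 / (1 - 2 powr (- p1)))) powr (1 / p1)"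

lemma C_from_morrey_pos: "0 < C_from_morrey"
  using p p1 by (simp add: C_from_morrey_def)

lemma C_to_morrey_pos: "0 < C_to_morrey"
  using p p1 by (simp add: C_to_morrey_def)

lemma LM_norm_le_if_morrey:
  assumes "morrey (\<lambda>x. e2ennreal \<bar>f x\<bar>) N" "0 < N"
  shows "LM f \<le> ennreal (C_from_morrey * N)"
  unfolding LM_norm_def C_from_morrey_def
proof (rule SUP_least, safe)
  fix x and r :: real assume xr: "x \<in> space M" "0 < r"
  let ?c = "2 powr p1 * p / p1"
  have "lorentz_norm M p p1 (\<lambda>y. f y * indicator (B x r) y)
    \<le> ennpowr (ennreal ?c * DL (\<lambda>y. e2ennreal \<bar>f y * indicator (B x r) y\<bar>)) (1 / p1)"
    using p p1 by (rule lorentz_norm_le_dyadic)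
  also have "(\<lambda>y. e2ennreal \<bar>f y * indicator (B x r) y\<bar>) = (\<lambda>y. e2ennreal \<bar>f y\<bar> * indicator (B x r) y)"
    by (auto simp: fun_eq_iff zero_ennreal.abs_eq[symmetric] split: split_indicator)
  also have "ennpowr (ennreal ?c * DL (\<lambda>y. e2ennreal \<bar>f y\<bar> * indicator (B x r) y)) (1 / p1)
    \<le> ennpowr (ennreal ?c * ennreal ((N * weight x r) powr p1)) (1 / p1)"
    using p1 by (intro ennpowr_mono mult_left_mono morreyD[OF assms(1) xr]) auto
  also have "\<dots> = ennreal (?c powr (1 / p1) * N) * ennreal (weight x r)"
    using p p1 assms weight_pos[OF xr] by (subst ennpowr_mult) (auto simp: powr_powr ennreal_mult[symmetric] mult.assoc)
  finally show "lorentz_norm M p p1 (\<lambda>y. f y * indicator (B x r) y) / ennreal (\<phi> x r * V x r powr (1 / p)) \<le> ennreal (?c powr (1 / p1) * N)"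
    using weight_pos[OF xr] by (intro divide_le_posI_ennreal) (auto simp: weight_def mult.commute)
qed

lemma morrey_if_LM_norm_le:
  assumes f: "f \<in> borel_measurable M" and N: "LM f \<le> ennreal N" "0 < N"
  shows "morrey (\<lambda>x. e2ennreal \<bar>f x\<bar>) (C_to_morrey * N)"
  unfolding C_to_morrey_def
proof (rule morreyI)
  have "2 powr (- p1) < (1::real)" using p1 by (simp add: powr_less_one)
  then show C: "0 < p1 / p * (2 powr p1 / (1 - 2 powr (- p1)))" using p p1 by simp
  show "0 < N" by fact
  fix x and r :: real assume xr: "x \<in> space M" "0 < r"
  note [measurable] = ball_measurable[OF xr(1)] f
  have "lorentz_norm M p p1 (\<lambda>y. f y * indicator (B x r) y) / ennreal (weight x r) \<le> LM f"
    unfolding LM_norm_def weight_def using xr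
    by (intro SUP_upper2[of "(x, r)"]) auto
  also note N(1)
  finally have "lorentz_norm M p p1 (\<lambda>y. f y * indicator (B x r) y) / ennreal (weight x r) * ennreal (weight x r) \<le> ennreal N * ennreal (weight x r)"
    by (rule mult_right_mono) simp
  then have le: "lorentz_norm M p p1 (\<lambda>y. f y * indicator (B x r) y) \<le> ennreal (N * weight x r)"
    using weight_pos[OF xr] N by (simp add: ennreal_divide_times ennreal_mult_divide_eq ennreal_mult)
  have "DL (\<lambda>y. e2ennreal \<bar>f y * indicator (B x r) y\<bar>)
    \<le> ennreal (p1 / p * (2 powr p1 / (1 - 2 powr (- p1)))) * ennpowr (lorentz_norm M p p1 (\<lambda>y. f y * indicator (B x r) y)) p1"
    using p p1 by (rule dyadic_le_lorentz_norm) measurable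
  also have "\<dots> \<le> ennreal (p1 / p * (2 powr p1 / (1 - 2 powr (- p1)))) * ennpowr (ennreal (N * weight x r)) p1"
    using p1 le by (intro mult_left_mono ennpowr_mono) auto
  also have "(\<lambda>y. e2ennreal \<bar>f y * indicator (B x r) y\<bar>) = (\<lambda>y. e2ennreal \<bar>f y\<bar> * indicator (B x r) y)"
    by (auto simp: fun_eq_iff zero_ennreal.abs_eq[symmetric] split: split_indicator)
  finally show "DL (\<lambda>y. e2ennreal \<bar>f y\<bar> * indicator (B x r) y) \<le> ennreal (p1 / p * (2 powr p1 / (1 - 2 powr (- p1)))) * ennreal ((N * weight x r) powr p1)"
    using N weight_pos[OF xr] by simp
qed

lemma lorentz_norm_mono:
  assumes "\<And>x. x \<in> space M \<Longrightarrow> \<bar>f x\<bar> \<le> \<bar>g x\<bar>" and [measurable]: "g \<in> borel_measurable M"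
  shows "lorentz_norm M p p1 f \<le> lorentz_norm M p p1 g"
proof -
  have "emeasure M {x \<in> space M. ereal s < \<bar>f x\<bar>} \<le> emeasure M {x \<in> space M. ereal s < \<bar>g x\<bar>}" for s
    using assms(1) by (intro emeasure_mono) (auto intro: less_le_trans)
  then have "rearrangement M f t \<le> rearrangement M g t" for t
    unfolding rearrangement_def by (intro INF_superset_mono) (auto intro: order_trans)
  then show ?thesis unfolding lorentz_norm_eq[OF p1]
    using p1 by (intro ennpowr_mono nn_integral_mono mult_right_mono mult_left_mono) auto
qed

lemma LM_norm_mono:
  assumes "\<And>x. x \<in> space M \<Longrightarrow> \<bar>f x\<bar> \<le> \<bar>g x\<bar>" and [measurable]: "g \<in> borel_measurable M"
  shows "LM f \<le> LM g"
  unfolding LM_norm_def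
proof (rule SUP_subset_mono[OF order_refl], clarify)
  fix x and r :: real assume x: "x \<in> space M"
  have "lorentz_norm M p p1 (\<lambda>y. f y * indicator (B x r) y) \<le> lorentz_norm M p p1 (\<lambda>y. g y * indicator (B x r) y)"
    using assms x by (intro lorentz_norm_mono) (auto split: split_indicator)
  then show "lorentz_norm M p p1 (\<lambda>y. f y * indicator (B x r) y) / ennreal (\<phi> x r * V x r powr (1 / p))
    \<le> lorentz_norm M p p1 (\<lambda>y. g y * indicator (B x r) y) / ennreal (\<phi> x r * V x r powr (1 / p))"
    by (rule divide_right_mono_ennreal)
qed

text \<open>A finite quasi-norm bounds the Lorentz quasi-norm on every ball, which includes the local condition.\<close>

lemma LM_space_iff: "f \<in> LM_space M \<rho> p p1 \<phi> \<longleftrightarrow> f \<in> borel_measurable M \<and> LM f < \<infinity>"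
proof (safe)
  assume f: "f \<in> borel_measurable M" "LM f < \<infinity>"
  have "lorentz_norm M p p1 (\<lambda>y. f y * indicator (B x 1) y) < \<infinity>" if x: "x \<in> space M" for x
  proof -
    have "lorentz_norm M p p1 (\<lambda>y. f y * indicator (B x 1) y) / ennreal (weight x 1) \<le> LM f"
      unfolding LM_norm_def weight_def using x by (intro SUP_upper2[of "(x, 1)"]) auto
    also note f(2)
    finally have fin: "lorentz_norm M p p1 (\<lambda>y. f y * indicator (B x 1) y) / ennreal (weight x 1) < \<infinity>" .
    show ?thesis
    proof (rule ccontr)
      assume "\<not> ?thesis"
      then have "lorentz_norm M p p1 (\<lambda>y. f y * indicator (B x 1) y) = top" by (simp add: not_less top_unique)
      then show False using fin by (simp add: ennreal_top_divide)
    qed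
  qed
  then show "f \<in> LM_space M \<rho> p p1 \<phi>"
    using f by (auto simp: LM_space_def lorentz_loc_def intro!: exI[of _ 1])
qed (auto simp: LM_space_def lorentz_loc_def)

text \<open>By monotonicity, the extension by zero has the smallest quasi-norm among all extensions. If its
  quasi-norm is infinite, no extension lies in the space and both sides are infinite.\<close>

lemma LM_norm_on_eq:
  assumes "\<Omega> \<in> sets M" and meas: "(\<lambda>x. f x * indicator \<Omega> x) \<in> borel_measurable M"
  shows "LM_on \<Omega> f = LM (\<lambda>x. f x * indicator \<Omega> x)"
proof (rule antisym)
  show "LM_on \<Omega> f \<le> LM (\<lambda>x. f x * indicator \<Omega> x)"
  proof (cases "LM (\<lambda>x. f x * indicator \<Omega> x) < \<infinity>")
    case True
    then show ?thesis unfolding LM_norm_on_def using meas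
      by (intro INF_lower) (auto simp: LM_space_iff)
  qed (simp add: not_less top_unique)
  show "LM (\<lambda>x. f x * indicator \<Omega> x) \<le> LM_on \<Omega> f"
    unfolding LM_norm_on_def
    by (intro INF_greatest LM_norm_mono) (auto simp: LM_space_iff split: split_indicator)
qed

end

section \<open>Pointwise bounds for the seminorm\<close>

lemma ennreal_divide_antimono:
  fixes a c d :: ennreal assumes "c \<le> d" shows "a / d \<le> a / c"
proof -
  have "inverse d \<le> inverse c"
    using assms by (simp add: less_eq_ennreal.rep_eq inverse_ennreal.rep_eq ereal_inverse_antimono)
  then show ?thesis by (simp add: divide_ennreal_def mult_left_mono)
qed

lemma nn_integral_split_le:
  assumes [measurable]: "A \<in> sets N"
  shows "(\<integral>\<^sup>+x. f x \<partial>N) \<le> (\<integral>\<^sup>+x\<in>A. f x \<partial>N) + (\<integral>\<^sup>+x\<in>-A. f x \<partial>N)"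
proof (rule nn_integral_le_if_measurable_minorants)
  fix u assume [measurable]: "u \<in> borel_measurable N" and u: "\<And>x. u x \<le> f x"
  have "(\<integral>\<^sup>+x. u x \<partial>N) = (\<integral>\<^sup>+x. u x * indicator A x + u x * indicator (- A) x \<partial>N)"
    by (intro nn_integral_cong) (auto split: split_indicator)
  also have "\<dots> = (\<integral>\<^sup>+x\<in>A. u x \<partial>N) + (\<integral>\<^sup>+x\<in>-A. u x \<partial>N)"
    by (rule nn_integral_add) measurable
  also have "\<dots> \<le> (\<integral>\<^sup>+x\<in>A. f x \<partial>N) + (\<integral>\<^sup>+x\<in>-A. f x \<partial>N)"
    by (intro add_mono nn_integral_mono mult_right_mono u) auto
  finally show "(\<integral>\<^sup>+x. u x \<partial>N) \<le> (\<integral>\<^sup>+x\<in>A. f x \<partial>N) + (\<integral>\<^sup>+x\<in>-A. f x \<partial>N)" .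
qed

lemma abs_diff_powr_le:
  fixes a b q :: real assumes "0 < q"
  shows "\<bar>a - b\<bar> powr q \<le> 2 powr q * (\<bar>a\<bar> powr q + \<bar>b\<bar> powr q)"
proof -
  have "\<bar>a - b\<bar> powr q \<le> (2 * max \<bar>a\<bar> \<bar>b\<bar>) powr q" using assms by (intro powr_mono2) auto
  also have "\<dots> = 2 powr q * max \<bar>a\<bar> \<bar>b\<bar> powr q" by (rule powr_mult)
  also have "\<dots> \<le> 2 powr q * (\<bar>a\<bar> powr q + \<bar>b\<bar> powr q)" by (intro mult_left_mono) (auto simp: max_def)
  finally show ?thesis .
qed

text \<open>The convex function \<open>s \<mapsto> 2 powr (- (s * b))\<close> lies below its chord over the unit interval. It bounds
  \<open>s\<close> times the total mass of the truncated kernel uniformly in \<open>s\<close>.\<close>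

lemma powr_convex_chord:
  fixes s b :: real assumes "0 \<le> s" "s \<le> 1"
  shows "s * (1 - 2 powr (- b)) \<le> 1 - 2 powr (- (s * b))"
proof -
  have "exp ((1 - s) *\<^sub>R 0 + s *\<^sub>R (- (b * ln 2))) \<le> (1 - s) * exp 0 + s * exp (- (b * ln 2))"
    using assms by (intro convex_onD[OF exp_convex]) auto
  then show ?thesis by (simp add: powr_def algebra_simps)
qed

context doubling_space
begin

lemma smear_cmult:
  assumes [measurable]: "h \<in> borel_measurable M"
  shows "smear a (\<lambda>y. c * h y) x = c * smear a h x"
proof -
  have "avg j (\<lambda>y. c * h y) x = c * avg j h x" for j
    unfolding avg_def by (simp add: nn_integral_cmult mult.assoc mult.left_commute[of _ c])
  then show ?thesis unfolding smear_def by (simp add: mult.left_commute[of _ c])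
qed

definition seminorm_integral :: "real \<Rightarrow> 'a set \<Rightarrow> real \<Rightarrow> ('a \<Rightarrow> real) \<Rightarrow> 'a \<Rightarrow> ennreal" where
  "seminorm_integral q \<Omega> s f x = (\<integral>\<^sup>+y\<in>\<Omega>. (if y = x then 0
     else ennreal (\<bar>f x - f y\<bar> powr q) / (Umin M \<rho> x y * ennreal (\<rho> x y powr (s * q)))) \<partial>M)"

lemma gagliardo_eq: "gagliardo M \<rho> \<Omega> s q f x = ennpowr (seminorm_integral q \<Omega> s f x) (1 / q)"
  by (simp add: gagliardo_def seminorm_integral_def)

text \<open>Near the diagonal the exponent \<open>s\<close> may be raised to \<open>s0\<close>, which leaves a factor \<open>s\<close> that
  tends to zero; away from the diagonal the triangle inequality separates \<open>f x\<close> and \<open>f y\<close> and the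
  factor \<open>s\<close> only compensates the total mass \<open>1 / s\<close> of the kernel.\<close>

lemma seminorm_integral_upper:
  assumes q: "0 < q" and s: "0 < s" "s \<le> s0" "s0 < 1" and \<Omega>: "\<Omega> \<subseteq> space M" and x: "x \<in> \<Omega>"
    and F[measurable]: "F \<in> borel_measurable M" and fF: "\<And>y. y \<in> \<Omega> \<Longrightarrow> F y = f y + a"
  shows "ennreal s * seminorm_integral q \<Omega> s f x \<le> ennreal s * seminorm_integral q \<Omega> s0 f x +
    ennreal (2 powr q * vratio (3 * K) / (1 - 2 powr (- q))) *
      (ennpowr (ennreal \<bar>F x\<bar>) q + smear (s * q) (\<lambda>y. ennpowr (ennreal \<bar>F y\<bar>) q) x)"
proof -
  have xX: "x \<in> space M" using x \<Omega> by auto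
  let ?k = "\<lambda>s y. (if y = x then 0 else ennreal (\<bar>f x - f y\<bar> powr q) / (Umin M \<rho> x y * ennreal (\<rho> x y powr (s * q)))) * indicator \<Omega> y"
  let ?h = "\<lambda>y. ennpowr (ennreal \<bar>F x\<bar>) q + ennpowr (ennreal \<bar>F y\<bar>) q"
  let ?S = "smear (s * q) (\<lambda>y. ennpowr (ennreal \<bar>F y\<bar>) q) x"
  have sq: "0 < s * q" using s q by simp
  have l: "0 < 1 - (2::real) powr (- (s * q))" "0 < 1 - (2::real) powr (- q)" using sq q by (auto simp: powr_less_one)
  have far: "(\<integral>\<^sup>+y\<in>-B x 1. ?k s y \<partial>M)
    \<le> ennreal (vratio (3 * K) / (1 - 2 powr (- (s * q)))) * smear (s * q) (\<lambda>y. ennreal (2 powr q) * ?h y) x"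
  proof (rule order_trans[OF nn_integral_mono nn_integral_far_le_smear[OF sq xX]])
    fix y assume y: "y \<in> space M"
    show "?k s y * indicator (- B x 1) y
      \<le> ennreal (2 powr q) * ?h y / (Umin M \<rho> x y * ennreal (\<rho> x y powr (s * q))) * indicator {y. 1 \<le> \<rho> x y} y"
    proof (cases "y \<in> \<Omega> \<and> 1 \<le> \<rho> x y")
      case True
      have "\<bar>f x - f y\<bar> powr q = \<bar>F x - F y\<bar> powr q" using fF[of y] fF[of x] x True by simp
      also have "\<dots> \<le> 2 powr q * (\<bar>F x\<bar> powr q + \<bar>F y\<bar> powr q)" by (rule abs_diff_powr_le[OF q])
      finally have "ennreal (\<bar>f x - f y\<bar> powr q) \<le> ennreal (2 powr q * (\<bar>F x\<bar> powr q + \<bar>F y\<bar> powr q))"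
        by (rule ennreal_leI)
      also have "\<dots> = ennreal (2 powr q) * ?h y"
        by (simp add: ennreal_mult ennreal_plus[symmetric] del: ennreal_plus)
      finally have "ennreal (\<bar>f x - f y\<bar> powr q) / (Umin M \<rho> x y * ennreal (\<rho> x y powr (s * q)))
        \<le> ennreal (2 powr q) * ?h y / (Umin M \<rho> x y * ennreal (\<rho> x y powr (s * q)))"
        by (rule divide_right_mono_ennreal)
      then show ?thesis using True by (auto split: split_indicator)
    next
      case False
      then have "?k s y * indicator (- B x 1) y = 0"
        using y by (auto simp: qball_def split: split_indicator)
      then show ?thesis by (simp only: zero_le)
    qed
  qed measurable
  have near: "(\<integral>\<^sup>+y\<in>B x 1. ?k s y \<partial>M) \<le> seminorm_integral q \<Omega> s0 f x"
    unfolding seminorm_integral_def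
  proof (rule nn_integral_mono)
    fix y assume y: "y \<in> space M"
    show "?k s y * indicator (B x 1) y \<le> ?k s0 y"
    proof (cases "y \<in> \<Omega> \<and> y \<in> B x 1 \<and> y \<noteq> x")
      case True
      then have "0 < \<rho> x y" "\<rho> x y < 1" using nonneg[OF xX y] zero_iff[OF xX y] by (auto simp: qball_def)
      then have "\<rho> x y powr (s0 * q) \<le> \<rho> x y powr (s * q)"
        using s q by (intro powr_mono') auto
      then have "Umin M \<rho> x y * ennreal (\<rho> x y powr (s0 * q)) \<le> Umin M \<rho> x y * ennreal (\<rho> x y powr (s * q))"
        by (intro mult_left_mono ennreal_leI) auto
      then show ?thesis using True by (simp add: ennreal_divide_antimono)
    qed (auto split: split_indicator)
  qed
  have "ennreal s * seminorm_integral q \<Omega> s f x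
    \<le> ennreal s * (seminorm_integral q \<Omega> s0 f x + ennreal (vratio (3 * K) / (1 - 2 powr (- (s * q)))) * smear (s * q) (\<lambda>y. ennreal (2 powr q) * ?h y) x)"
    unfolding seminorm_integral_def[of q \<Omega> s]
    using order_trans[OF nn_integral_split_le[of "B x 1" M "?k s"] add_mono[OF near far]] xX
    by (intro mult_left_mono) auto
  also have "smear (s * q) (\<lambda>y. ennreal (2 powr q) * ?h y) x = ennreal (2 powr q) * (ennpowr (ennreal \<bar>F x\<bar>) q + ?S)"
    by (simp add: smear_cmult smear_add smear_const[OF sq])
  also have "ennreal s * (seminorm_integral q \<Omega> s0 f x + ennreal (vratio (3 * K) / (1 - 2 powr (- (s * q)))) * (ennreal (2 powr q) * (ennpowr (ennreal \<bar>F x\<bar>) q + ?S)))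
    = ennreal s * seminorm_integral q \<Omega> s0 f x + ennreal (s * (vratio (3 * K) / (1 - 2 powr (- (s * q)))) * 2 powr q) * (ennpowr (ennreal \<bar>F x\<bar>) q + ?S)"
  proof -
    let ?v = "vratio (3 * K) / (1 - 2 powr (- (s * q)))"
    have v: "0 \<le> ?v" using l vratio_pos[of "3 * K"] by simp
    have "ennreal (s * ?v * 2 powr q) = ennreal s * (ennreal ?v * ennreal (2 powr q))"
      using s v by (simp only: ennreal_mult mult_nonneg_nonneg less_imp_le powr_ge_zero mult.assoc)
    then show ?thesis by (simp only: distrib_left mult.assoc)
  qed
  also have "\<dots> \<le> ennreal s * seminorm_integral q \<Omega> s0 f x +
    ennreal (2 powr q * vratio (3 * K) / (1 - 2 powr (- q))) * (ennpowr (ennreal \<bar>F x\<bar>) q + ?S)"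
  proof (intro add_left_mono mult_right_mono ennreal_leI)
    have "s * (1 - 2 powr (- q)) \<le> 1 - 2 powr (- (s * q))" using s by (intro powr_convex_chord) auto
    then have "s / (1 - 2 powr (- (s * q))) \<le> 1 / (1 - 2 powr (- q))" using l by (simp add: field_simps)
    then have "(2 powr q * vratio (3 * K)) * (s / (1 - 2 powr (- (s * q)))) \<le> (2 powr q * vratio (3 * K)) * (1 / (1 - 2 powr (- q)))"
      using vratio_pos[of "3 * K"] by (intro mult_left_mono) auto
    then show "s * (vratio (3 * K) / (1 - 2 powr (- (s * q)))) * 2 powr q \<le> 2 powr q * vratio (3 * K) / (1 - 2 powr (- q))"
      by (simp add: mult_ac)
  qed simp
  finally show ?thesis .
qed

subsection \<open>Annuli with substantial mass in \<open>\<Omega>\<close>\<close>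

lemma ball_fmeasurable: "x \<in> space M \<Longrightarrow> B x r \<in> fmeasurable M"
  using emeasure_ball_less_top[of x r] by (intro fmeasurableI) auto

lemma WRD_V:
  assumes "WRD M \<rho>"
  obtains x0 \<theta> C r1 where "x0 \<in> space M" "1 < \<theta>" "1 < C" "0 < r1" "\<And>r. r1 \<le> r \<Longrightarrow> C * V x0 r \<le> V x0 (\<theta> * r)"
proof -
  obtain x0 \<theta> C where *: "x0 \<in> space M" "1 < \<theta>" "1 < C"
    "ennreal C \<le> Liminf at_top (\<lambda>r. emeasure M (B x0 (\<theta> * r)) / emeasure M (B x0 r))"
    using assms unfolding WRD_def by blast
  define C' where "C' = (1 + C) / 2"
  have C': "1 < C'" "C' < C" using * by (auto simp: C'_def)
  then have "ennreal C' < ennreal C" by (simp add: ennreal_less_iff)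
  then have "eventually (\<lambda>r. ennreal C' < emeasure M (B x0 (\<theta> * r)) / emeasure M (B x0 r)) at_top"
    using *(4) unfolding le_Liminf_iff by blast
  then obtain r0 where r0: "\<And>r. r0 \<le> r \<Longrightarrow> ennreal C' < emeasure M (B x0 (\<theta> * r)) / emeasure M (B x0 r)"
    by (auto simp: eventually_at_top_linorder)
  show ?thesis
  proof (rule that[OF *(1,2) C'(1), of "max r0 1"])
    fix r assume r: "max r0 1 \<le> r"
    have V: "0 < V x0 r" using r * by (intro V_pos) auto
    have "ennreal C' < ennreal (V x0 (\<theta> * r) / V x0 r)"
      using r0[of r] r * V by (simp add: emeasure_ball divide_ennreal)
    then have "C' < V x0 (\<theta> * r) / V x0 r" using C' by (simp add: ennreal_less_iff)
    then show "C' * V x0 r \<le> V x0 (\<theta> * r)" using V by (simp add: field_simps)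
  qed simp
qed

lemma WMD_V:
  assumes "WMD M \<rho> \<Omega>" and [measurable]: "\<Omega> \<in> sets M"
  obtains x1 c r2 where "x1 \<in> space M" "0 < c" "0 < r2" "\<And>r. r2 \<le> r \<Longrightarrow> c * V x1 r \<le> measure M (B x1 r \<inter> \<Omega>)"
proof -
  obtain x1 C0 where *: "x1 \<in> space M" "0 < C0" 
    "ennreal C0 \<le> Liminf at_top (\<lambda>r. emeasure M (B x1 r \<inter> \<Omega>) / emeasure M (B x1 r))"
    using assms unfolding WMD_def by blast
  define c where "c = C0 / 2"
  have c: "0 < c" "c < C0" using * by (auto simp: c_def)
  then have "ennreal c < ennreal C0" by (simp add: ennreal_less_iff)
  then have "eventually (\<lambda>r. ennreal c < emeasure M (B x1 r \<inter> \<Omega>) / emeasure M (B x1 r)) at_top"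
    using *(3) unfolding le_Liminf_iff by blast
  then obtain r0 where r0: "\<And>r. r0 \<le> r \<Longrightarrow> ennreal c < emeasure M (B x1 r \<inter> \<Omega>) / emeasure M (B x1 r)"
    by (auto simp: eventually_at_top_linorder)
  show ?thesis
  proof (rule that[OF *(1) c(1), of "max r0 1"])
    fix r assume r: "max r0 1 \<le> r"
    have V: "0 < V x1 r" using r * by (intro V_pos) auto
    have "emeasure M (B x1 r \<inter> \<Omega>) \<le> emeasure M (B x1 r)" using * by (intro emeasure_mono) auto
    also have "\<dots> < \<infinity>" using *(1) by (rule emeasure_ball_less_top)
    finally have "emeasure M (B x1 r \<inter> \<Omega>) = ennreal (measure M (B x1 r \<inter> \<Omega>))"
      by (intro emeasure_eq_ennreal_measure) auto
    then have "ennreal c < ennreal (measure M (B x1 r \<inter> \<Omega>) / V x1 r)"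
      using r0[of r] r * V by (simp add: emeasure_ball divide_ennreal)
    then have "c < measure M (B x1 r \<inter> \<Omega>) / V x1 r" using c by (simp add: ennreal_less_iff)
    then show "c * V x1 r \<le> measure M (B x1 r \<inter> \<Omega>)" using V by (simp add: field_simps)
  qed simp
qed

text \<open>Iterated reverse doubling makes \<open>B x r\<close> a small fraction of \<open>B x (\<Lambda> * r)\<close>, smaller than the fraction
  that the density condition guarantees for \<open>\<Omega>\<close>. Both conditions are given at one centre each and
  are transferred to \<open>x\<close> for large radii, so that only the threshold \<open>r0\<close> depends on \<open>x\<close>.\<close>

lemma annulus_mass:
  assumes "WRD M \<rho>" "WMD M \<rho> \<Omega>" and [measurable]: "\<Omega> \<in> sets M"
  obtains \<Lambda> c where "1 < \<Lambda>" "0 < c"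
    "\<And>x. x \<in> space M \<Longrightarrow> \<exists>r0>0. \<forall>r\<ge>r0. c * V x (\<Lambda> * r) \<le> measure M ((B x (\<Lambda> * r) - B x r) \<inter> \<Omega>)"
proof -
  obtain x0 \<theta> C r1 where WRD: "x0 \<in> space M" "1 < \<theta>" "1 < C" "0 < r1" "\<And>r. r1 \<le> r \<Longrightarrow> C * V x0 r \<le> V x0 (\<theta> * r)"
    using WRD_V[OF assms(1)] by metis
  obtain x1 C0 r2 where WMD: "x1 \<in> space M" "0 < C0" "0 < r2" "\<And>r. r2 \<le> r \<Longrightarrow> C0 * V x1 r \<le> measure M (B x1 r \<inter> \<Omega>)"
    using WMD_V[OF assms(2,3)] by metis
  define c0 where "c0 = C0 / vratio (2 * K)"
  have c0: "0 < c0" using WMD vratio_pos by (simp add: c0_def)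
  obtain k where k: "2 / c0 < C ^ k" using real_arch_pow[OF WRD(3)] by blast
  \<comment> \<open>one factor \<open>2 * K\<close> each for moving the centre from \<open>x\<close> to \<open>x0\<close> and back\<close>
  define \<Lambda> where "\<Lambda> = 4 * K\<^sup>2 * \<theta> ^ k"
  have \<theta>k: "1 \<le> \<theta> ^ k" using WRD by (simp add: one_le_power)
  have K2: "1 \<le> K\<^sup>2" using K by simp
  have "1 * 1 \<le> K\<^sup>2 * \<theta> ^ k" using \<theta>k K2 by (intro mult_mono) auto
  then have \<Lambda>: "1 < \<Lambda>" by (simp add: \<Lambda>_def)
  have pow: "C ^ n * V x0 r \<le> V x0 (\<theta> ^ n * r)" if "r1 \<le> r" for n r
  proof (induction n)
    case (Suc n)
    have "1 * r1 \<le> \<theta> ^ n * r" using that WRD by (intro mult_mono) (auto simp: one_le_power)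
    then have "C * V x0 (\<theta> ^ n * r) \<le> V x0 (\<theta> * (\<theta> ^ n * r))" using WRD(5) by simp
    moreover have "C * (C ^ n * V x0 r) \<le> C * V x0 (\<theta> ^ n * r)" using Suc WRD(3) by simp
    ultimately show ?case by (simp add: mult.assoc)
  qed simp
  show ?thesis
  proof (rule that[OF \<Lambda>, of "c0 / 2"])
    fix x assume x: "x \<in> space M"
    define r0 where "r0 = max (max r1 r2) (max (\<rho> x x1) (\<rho> x x0))"
    have "0 < r0" using WRD(4) by (simp add: r0_def less_max_iff_disj)
    moreover have "c0 / 2 * V x (\<Lambda> * r) \<le> measure M ((B x (\<Lambda> * r) - B x r) \<inter> \<Omega>)" if r: "r0 \<le> r" for r
    proof -
      have r': "r1 \<le> r" "r2 \<le> r" "\<rho> x x1 \<le> r" "\<rho> x x0 \<le> r" "0 < r" using r \<open>0 < r0\<close> by (auto simp: r0_def)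
      \<comment> \<open>mass of \<open>\<Omega>\<close> in the large ball, seen from the centre of the density condition\<close>
      define t where "t = \<Lambda> * r / (2 * K)"
      have t: "\<Lambda> * r = 2 * K * t" using K by (simp add: t_def)
      have "1 * r \<le> 2 * K * \<theta> ^ k * r"
        using K \<theta>k r' mult_mono[of 1 "2 * K" 1 "\<theta> ^ k"] by (intro mult_right_mono) auto
      also have "2 * K * \<theta> ^ k * r = t" using K by (simp add: t_def \<Lambda>_def power2_eq_square)
      finally have rt: "r \<le> t" by simp
      have "K * (\<rho> x x1 + t) \<le> K * (t + t)" using r' rt K by (intro mult_left_mono) auto
      then have sub: "B x1 t \<subseteq> B x (2 * K * t)" using x WMD by (intro ball_subset_ball) auto
      have "1 * t \<le> 2 * K * t" using K rt r' by (intro mult_right_mono) auto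
      then have "\<rho> x x1 \<le> 2 * K * t" using r' rt by linarith
      then have "V x (2 * K * t) \<le> vratio (2 * K) * V x1 t"
        using x WMD K r' rt by (intro V_comparable) auto
      then have "c0 * V x (2 * K * t) \<le> c0 * (vratio (2 * K) * V x1 t)" using c0 by (intro mult_left_mono) auto
      also have "\<dots> = C0 * V x1 t" using vratio_pos[of "2 * K"] by (simp add: c0_def)
      also have "\<dots> \<le> measure M (B x1 t \<inter> \<Omega>)" using WMD(4) r' rt by simp
      also have "\<dots> \<le> measure M (B x (2 * K * t) \<inter> \<Omega>)"
      proof (rule measure_mono_fmeasurable)
        show "B x (2 * K * t) \<inter> \<Omega> \<in> fmeasurable M"
          using x by (intro fmeasurableI2[OF ball_fmeasurable[OF x, of "2 * K * t"]]) auto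
      qed (use sub WMD in auto)
      finally have big: "c0 * V x (\<Lambda> * r) \<le> measure M (B x (\<Lambda> * r) \<inter> \<Omega>)" by (simp add: t)
      \<comment> \<open>the small ball has little mass, by iterating the reverse doubling condition\<close>
      have "B x r \<subseteq> B x0 (2 * K * r)"
        using x WRD r' K sym[of x x0] mult_left_mono[of "\<rho> x0 x + r" "r + r" K] by (intro ball_subset_ball) auto
      then have "V x r \<le> V x0 (2 * K * r)" using x WRD by (intro V_mono_subset) auto
      then have "C ^ k * V x r \<le> C ^ k * V x0 (2 * K * r)" using WRD by (intro mult_left_mono) auto
      also have "\<dots> \<le> V x0 (\<theta> ^ k * (2 * K * r))"
      proof (rule pow)
        have "1 * r \<le> 2 * K * r" using K r' by (intro mult_right_mono) auto
        then show "r1 \<le> 2 * K * r" using r'(1) by linarith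
      qed
      also have "\<theta> ^ k * (2 * K * r) = t" using K by (simp add: t_def \<Lambda>_def power2_eq_square)
      also have "V x0 t \<le> V x (2 * K * t)"
        using x WRD r' rt K mult_left_mono[of "\<rho> x x0 + t" "t + t" K]
        by (intro V_mono_subset ball_subset_ball) auto
      finally have "C ^ k * V x r \<le> V x (\<Lambda> * r)" by (simp add: t)
      moreover have "2 / c0 * V x r \<le> C ^ k * V x r" using k by (intro mult_right_mono) auto
      ultimately have "2 / c0 * V x r \<le> V x (\<Lambda> * r)" by linarith
      from mult_left_mono[OF this, of "c0 / 2"] have small: "V x r \<le> c0 / 2 * V x (\<Lambda> * r)" using c0 by simp
      have fm: "B x r \<in> fmeasurable M" "(B x (\<Lambda> * r) - B x r) \<inter> \<Omega> \<in> fmeasurable M"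
        using x fmeasurableI2[OF ball_fmeasurable[OF x, of "\<Lambda> * r"], of "(B x (\<Lambda> * r) - B x r) \<inter> \<Omega>"]
        by (auto intro: ball_fmeasurable)
      have "measure M (B x (\<Lambda> * r) \<inter> \<Omega>) \<le> measure M ((B x (\<Lambda> * r) - B x r) \<inter> \<Omega> \<union> B x r)"
        using x fm by (intro measure_mono_fmeasurable fmeasurable.Un) auto
      also have "\<dots> \<le> measure M ((B x (\<Lambda> * r) - B x r) \<inter> \<Omega>) + V x r"
        using fm by (intro measure_Un_le) auto
      finally show ?thesis using big small by simp
    qed
    ultimately show "\<exists>r0>0. \<forall>r\<ge>r0. c0 / 2 * V x (\<Lambda> * r) \<le> measure M ((B x (\<Lambda> * r) - B x r) \<inter> \<Omega>)" by blast
  qed (use c0 in auto)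
qed

end

context lorentz_morrey
begin

text \<open>On an annulus so far out that the mean of \<open>|F| powr q\<close> is small against \<open>|F x| powr q\<close>, the values
  \<open>F y\<close> cannot compensate \<open>F x\<close> on average, and the mean of \<open>|F x - F y| powr q\<close> has the order of
  \<open>|F x| powr q\<close>.\<close>

lemma annulus_difference_integral:
  fixes c t N R :: real
  assumes F[measurable]: "F \<in> borel_measurable M" and N: "0 < N" "morrey (\<lambda>y. ennreal \<bar>F y\<bar>) N"
    and x: "x \<in> space M" and [measurable]: "A \<in> sets M" and A: "A \<subseteq> B x R" and R: "0 < R"
    and mass: "c * V x R \<le> measure M A"
    and small: "C_avg * (N * \<phi> x R) powr q \<le> c * t powr q / (2 * 2 powr q)" and t: "t = \<bar>F x\<bar>"
  shows "ennreal (c * t powr q / (2 * 2 powr q) * V x R) \<le> (\<integral>\<^sup>+y. ennreal (\<bar>F x - F y\<bar> powr q) * indicator A y \<partial>M)"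
    (is "ennreal (?\<kappa> * _) \<le> ?I")
proof (cases ?I)
  case (real i)
  have V: "0 < V x R" using x R by (rule V_pos)
  have \<kappa>: "0 \<le> ?\<kappa>" using small C_avg_pos by (metis less_imp_le mult_nonneg_nonneg order_trans powr_ge_zero)
  have \<kappa>V: "0 \<le> ?\<kappa> * V x R" using \<kappa> V by (intro mult_nonneg_nonneg) auto
  have "A \<in> fmeasurable M" using fmeasurableI2[OF ball_fmeasurable[OF x, of R], of A] A by simp
  then have \<mu>A: "emeasure M A = ennreal (measure M A)" by (rule emeasure_eq_measure2)
  have avg: "(\<integral>\<^sup>+y. ennreal (\<bar>F y\<bar> powr q) * indicator A y \<partial>M) \<le> ennreal (?\<kappa> * V x R)"
  proof -
    have "(\<integral>\<^sup>+y. ennreal (\<bar>F y\<bar> powr q) * indicator A y \<partial>M) \<le> (\<integral>\<^sup>+y\<in>B x R. ennpowr (ennreal \<bar>F y\<bar>) q \<partial>M)"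
      using A by (intro nn_integral_mono) (auto split: split_indicator)
    also have "\<dots> \<le> ennreal (C_avg * (N * \<phi> x R) powr q * V x R)"
      using N x R by (intro morrey_ball_integral) auto
    also have "\<dots> \<le> ennreal (?\<kappa> * V x R)" using small V by (intro ennreal_leI mult_right_mono) auto
    finally show ?thesis .
  qed
  have "ennreal (t powr q * measure M A) = (\<integral>\<^sup>+y. ennreal (t powr q) * indicator A y \<partial>M)"
    by (simp add: nn_integral_cmult_indicator \<mu>A ennreal_mult)
  also have "\<dots> \<le> (\<integral>\<^sup>+y. ennreal (2 powr q) * (ennreal (\<bar>F x - F y\<bar> powr q) * indicator A y + ennreal (\<bar>F y\<bar> powr q) * indicator A y) \<partial>M)"
  proof (rule nn_integral_mono)
    fix y
    have "t powr q \<le> 2 powr q * (\<bar>F x - F y\<bar> powr q + \<bar>F y\<bar> powr q)"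
      using abs_diff_powr_le[OF q(1), of "F x - F y" "- F y"] t by simp
    then have "ennreal (t powr q) \<le> ennreal (2 powr q) * (ennreal (\<bar>F x - F y\<bar> powr q) + ennreal (\<bar>F y\<bar> powr q))"
      by (simp add: ennreal_mult[symmetric] ennreal_plus[symmetric] ennreal_leI del: ennreal_plus)
    then show "ennreal (t powr q) * indicator A y \<le> ennreal (2 powr q) * (ennreal (\<bar>F x - F y\<bar> powr q) * indicator A y + ennreal (\<bar>F y\<bar> powr q) * indicator A y)"
      by (auto split: split_indicator)
  qed
  also have "\<dots> = ennreal (2 powr q) * (?I + (\<integral>\<^sup>+y. ennreal (\<bar>F y\<bar> powr q) * indicator A y \<partial>M))"
    by (simp add: nn_integral_cmult nn_integral_add)
  also have "\<dots> \<le> ennreal (2 powr q) * (ennreal i + ennreal (?\<kappa> * V x R))"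
    using real avg by (intro mult_left_mono add_mono) auto
  also have "\<dots> = ennreal (2 powr q * (i + ?\<kappa> * V x R))"
  proof -
    from real(1) \<kappa>V show ?thesis by (simp only: ennreal_mult ennreal_plus add_nonneg_nonneg powr_ge_zero)
  qed
  finally have "t powr q * measure M A \<le> 2 powr q * (i + ?\<kappa> * V x R)"
  proof (subst (asm) ennreal_le_iff)
    from real(1) \<kappa>V show "0 \<le> 2 powr q * (i + ?\<kappa> * V x R)"
      by (simp only: mult_nonneg_nonneg add_nonneg_nonneg powr_ge_zero)
  qed
  moreover have "t powr q * (c * V x R) \<le> t powr q * measure M A" using mass by (intro mult_left_mono) auto
  moreover have "t powr q * (c * V x R) = 2 powr q * (2 * (?\<kappa> * V x R))" by simp
  ultimately have "2 powr q * (2 * (?\<kappa> * V x R)) \<le> 2 powr q * (i + ?\<kappa> * V x R)" by linarith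
  then have "2 * (?\<kappa> * V x R) \<le> i + ?\<kappa> * V x R" by (subst (asm) mult_le_cancel_left_pos) auto
  then have "?\<kappa> * V x R \<le> i" by linarith
  then show ?thesis unfolding real(2) by (rule ennreal_leI)
qed simp

text \<open>Summing the contributions of the annuli gives a geometric series of ratio
  \<open>\<Lambda> powr (- s q)\<close>, whose sum is at least of the order \<open>1 / s\<close>.\<close>

lemma seminorm_integral_lower:
  fixes c r \<Lambda> N s a :: real and f F :: "'a \<Rightarrow> real"
  assumes F[measurable]: "F \<in> borel_measurable M" and N: "0 < N" "morrey (\<lambda>y. ennreal \<bar>F y\<bar>) N"
    and [measurable]: "\<Omega> \<in> sets M" and x: "x \<in> \<Omega>" and fF: "\<And>y. y \<in> \<Omega> \<Longrightarrow> F y = f y + a"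
    and \<Lambda>: "1 < \<Lambda>" and r: "0 < r" and s: "0 < s" and c: "0 < c"
    and mass: "\<And>R. r \<le> R \<Longrightarrow> c * V x (\<Lambda> * R) \<le> measure M ((B x (\<Lambda> * R) - B x R) \<inter> \<Omega>)"
    and small: "\<And>R. r \<le> R \<Longrightarrow> C_avg * (N * \<phi> x R) powr q \<le> c * \<bar>F x\<bar> powr q / (2 * 2 powr q)"
  shows "ennreal ((\<Lambda> * r) powr (- (s * q)) * (c * \<bar>F x\<bar> powr q / (2 * 2 powr q)) / (q * ln \<Lambda>))
    \<le> ennreal s * seminorm_integral q \<Omega> s f x"
proof -
  have xX: "x \<in> space M" using x sets.sets_into_space[OF \<open>\<Omega> \<in> sets M\<close>] by auto
  define \<kappa> where "\<kappa> = c * \<bar>F x\<bar> powr q / (2 * 2 powr q)"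
  have \<kappa>: "0 \<le> \<kappa>" using c by (simp add: \<kappa>_def)
  define Q where "Q i = \<Lambda> ^ i * r" for i :: nat
  have Q: "r \<le> Q i" "0 < Q i" for i
  proof -
    have "1 * r \<le> \<Lambda> ^ i * r" using \<Lambda> r by (intro mult_right_mono) (auto simp: one_le_power)
    then show "r \<le> Q i" by (simp add: Q_def)
    then show "0 < Q i" using r by simp
  qed
  have Q\<Lambda>: "Q i \<le> \<Lambda> * Q i" for i
    using mult_right_mono[of 1 \<Lambda> "Q i"] \<Lambda> Q(2)[of i] by simp
  define A where "A i = (B x (\<Lambda> * Q i) - B x (Q i)) \<inter> \<Omega>" for i
  have A[measurable]: "A i \<in> sets M" for i unfolding A_def using xX by measurable
  define w where "w i = 1 / (V x (\<Lambda> * Q i) * (\<Lambda> * Q i) powr (s * q))" for i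
  have V: "0 < V x (\<Lambda> * Q i)" for i using xX Q \<Lambda> by (intro V_pos) auto
  have w: "0 \<le> w i" for i using V[of i] by (simp add: w_def)
  let ?e = "\<lambda>y. ennreal (\<bar>F x - F y\<bar> powr q)"
  let ?k = "\<lambda>y. (if y = x then 0 else ennreal (\<bar>f x - f y\<bar> powr q) / (Umin M \<rho> x y * ennreal (\<rho> x y powr (s * q)))) * indicator \<Omega> y"
  have pointwise: "(\<Sum>i<n. ennreal (w i) * (?e y * indicator (A i) y)) \<le> ?k y" if y: "y \<in> space M" for n y
  proof (cases "\<exists>j<n. y \<in> A j")
    case False
    then have "(\<Sum>i<n. ennreal (w i) * (?e y * indicator (A i) y)) = 0" by (intro sum.neutral) auto
    then show ?thesis by (simp only: zero_le)
  next
    case True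
    then obtain j where j: "j < n" "y \<in> A j" by blast
    have jy: "Q j \<le> \<rho> x y" "\<rho> x y < \<Lambda> * Q j" "y \<in> \<Omega>" using j y by (auto simp: A_def qball_def)
    have other: "y \<notin> A i" if "i \<noteq> j" for i
    proof
      assume "y \<in> A i"
      then have iy: "Q i \<le> \<rho> x y" "\<rho> x y < \<Lambda> * Q i" using y by (auto simp: A_def qball_def)
      have mono: "\<Lambda> * Q k \<le> Q l" if "k < l" for k l
      proof -
        have "\<Lambda> ^ Suc k \<le> \<Lambda> ^ l" using \<Lambda> that by (intro power_increasing) auto
        then show ?thesis using r by (simp add: Q_def mult.assoc[symmetric])
      qed
      show False using mono[of i j] mono[of j i] iy jy that by (cases i j rule: linorder_cases) auto
    qed
    have "(\<Sum>i<n. ennreal (w i) * (?e y * indicator (A i) y)) = (\<Sum>i\<in>{j}. ennreal (w i) * (?e y * indicator (A i) y))"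
      using j other by (intro sum.mono_neutral_right) auto
    also have "\<dots> = ennreal (w j) * ?e y" using j by simp
    also have "\<dots> = ?e y / ennreal (V x (\<Lambda> * Q j) * (\<Lambda> * Q j) powr (s * q))"
      using V[of j] Q(2)[of j] \<Lambda> by (subst divide_ennreal) (auto simp: w_def ennreal_mult[symmetric])
    also have "\<dots> \<le> ?e y / (Umin M \<rho> x y * ennreal (\<rho> x y powr (s * q)))"
    proof (rule ennreal_divide_antimono)
      have "Umin M \<rho> x y \<le> ennreal (V x (\<rho> x y))" unfolding Umin_def using xX by (simp add: emeasure_ball)
      also have "\<dots> \<le> ennreal (V x (\<Lambda> * Q j))" using xX jy by (intro ennreal_leI V_mono) auto
      finally have "Umin M \<rho> x y * ennreal (\<rho> x y powr (s * q)) \<le> ennreal (V x (\<Lambda> * Q j)) * ennreal ((\<Lambda> * Q j) powr (s * q))"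
        using jy s q nonneg[OF xX y] by (intro mult_mono ennreal_leI powr_mono2) auto
      then show "Umin M \<rho> x y * ennreal (\<rho> x y powr (s * q)) \<le> ennreal (V x (\<Lambda> * Q j) * (\<Lambda> * Q j) powr (s * q))"
        by (simp add: ennreal_mult)
    qed
    also have "\<dots> = ?k y"
    proof -
      have "y \<noteq> x" using jy(1) Q(2)[of j] zero_iff[OF xX y] by auto
      moreover have "F x - F y = f x - f y" using fF[OF x] fF[OF jy(3)] by simp
      ultimately show ?thesis using jy by simp
    qed
    finally show ?thesis .
  qed
  have partial: "(\<Sum>i<n. ennreal (\<kappa> * (\<Lambda> * Q i) powr (- (s * q)))) \<le> seminorm_integral q \<Omega> s f x" for n
  proof -
    have "(\<Sum>i<n. ennreal (\<kappa> * (\<Lambda> * Q i) powr (- (s * q)))) \<le> (\<Sum>i<n. ennreal (w i) * (\<integral>\<^sup>+y. ?e y * indicator (A i) y \<partial>M))"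
    proof (rule sum_mono)
      fix i
      have "r \<le> \<Lambda> * Q i" using Q(1)[of i] Q\<Lambda>[of i] by linarith
      then have "ennreal (\<kappa> * V x (\<Lambda> * Q i)) \<le> (\<integral>\<^sup>+y. ?e y * indicator (A i) y \<partial>M)"
        unfolding \<kappa>_def using xX Q(1)[of i] Q(2)[of i] \<Lambda> N mass[of "Q i"] small
        by (intro annulus_difference_integral[where N = N]) (auto simp: A_def)
      then have "ennreal (w i) * ennreal (\<kappa> * V x (\<Lambda> * Q i)) \<le> ennreal (w i) * (\<integral>\<^sup>+y. ?e y * indicator (A i) y \<partial>M)"
        by (rule mult_left_mono) simp
      moreover have "w i * (\<kappa> * V x (\<Lambda> * Q i)) = \<kappa> * (\<Lambda> * Q i) powr (- (s * q))"
        using V[of i] Q(2)[of i] \<Lambda> by (simp add: w_def powr_minus divide_inverse)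
      ultimately show "ennreal (\<kappa> * (\<Lambda> * Q i) powr (- (s * q))) \<le> ennreal (w i) * (\<integral>\<^sup>+y. ?e y * indicator (A i) y \<partial>M)"
        using w[of i] \<kappa> by (simp add: ennreal_mult[symmetric])
    qed
    also have "\<dots> = (\<integral>\<^sup>+y. (\<Sum>i<n. ennreal (w i) * (?e y * indicator (A i) y)) \<partial>M)"
      by (simp add: nn_integral_sum nn_integral_cmult)
    also have "\<dots> \<le> seminorm_integral q \<Omega> s f x"
      unfolding seminorm_integral_def by (intro nn_integral_mono pointwise)
    finally show ?thesis .
  qed
  define z where "z = \<Lambda> powr (- (s * q))"
  have sq: "0 < s * q" using s q by simp
  have z: "0 < z" "z < 1" using \<Lambda> sq by (auto simp: z_def powr_less_one)
  have "(\<lambda>i. \<kappa> * (\<Lambda> * r) powr (- (s * q)) * z ^ i) sums (\<kappa> * (\<Lambda> * r) powr (- (s * q)) * (1 / (1 - z)))"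
    using z by (intro sums_mult geometric_sums) auto
  moreover have "\<kappa> * (\<Lambda> * r) powr (- (s * q)) * z ^ i = \<kappa> * (\<Lambda> * Q i) powr (- (s * q))" for i
  proof -
    have "\<Lambda> * Q i = (\<Lambda> * r) * \<Lambda> ^ i" by (simp add: Q_def)
    then have "(\<Lambda> * Q i) powr (- (s * q)) = (\<Lambda> * r) powr (- (s * q)) * (\<Lambda> ^ i) powr (- (s * q))"
      by (simp only: powr_mult)
    also have "(\<Lambda> ^ i) powr (- (s * q)) = z ^ i"
      using \<Lambda> by (simp add: z_def powr_realpow[symmetric] powr_powr mult.commute)
    finally show ?thesis by simp
  qed
  ultimately have "(\<Sum>i. ennreal (\<kappa> * (\<Lambda> * Q i) powr (- (s * q)))) = ennreal (\<kappa> * (\<Lambda> * r) powr (- (s * q)) * (1 / (1 - z)))"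
    using \<kappa> by (intro suminf_ennreal_eq) auto
  moreover have "(\<Sum>i. ennreal (\<kappa> * (\<Lambda> * Q i) powr (- (s * q)))) \<le> seminorm_integral q \<Omega> s f x"
    by (intro suminf_le_const partial) auto
  ultimately have J: "ennreal (\<kappa> * (\<Lambda> * r) powr (- (s * q)) * (1 / (1 - z))) \<le> seminorm_integral q \<Omega> s f x" by simp
  have "1 - z \<le> s * q * ln \<Lambda>"
    using \<Lambda> exp_ge_add_one_self[of "- (s * q * ln \<Lambda>)"] by (simp add: z_def powr_def)
  moreover have "0 < q * ln \<Lambda>" using q \<Lambda> by simp
  ultimately have "1 / (q * ln \<Lambda>) \<le> s * (1 / (1 - z))" using z by (simp add: field_simps)
  then have "(\<kappa> * (\<Lambda> * r) powr (- (s * q))) * (1 / (q * ln \<Lambda>)) \<le> (\<kappa> * (\<Lambda> * r) powr (- (s * q))) * (s * (1 / (1 - z)))"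
    using \<kappa> by (intro mult_left_mono) auto
  then have "(\<Lambda> * r) powr (- (s * q)) * \<kappa> / (q * ln \<Lambda>) \<le> s * (\<kappa> * (\<Lambda> * r) powr (- (s * q)) * (1 / (1 - z)))"
    by (simp add: mult_ac)
  then have "ennreal ((\<Lambda> * r) powr (- (s * q)) * \<kappa> / (q * ln \<Lambda>)) \<le> ennreal s * ennreal (\<kappa> * (\<Lambda> * r) powr (- (s * q)) * (1 / (1 - z)))"
    using s \<kappa> z by (simp add: ennreal_mult[symmetric] ennreal_leI)
  also have "\<dots> \<le> ennreal s * seminorm_integral q \<Omega> s f x" using J by (rule mult_left_mono) simp
  finally show ?thesis unfolding \<kappa>_def .
qed

text \<open>The threshold radius in the previous lemma depends on \<open>x\<close> and \<open>F\<close>, but it enters only through a factor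
  \<open>(\<Lambda> * r) powr (- (s * q))\<close>, which tends to one with \<open>s\<close>. The constant therefore depends on neither.\<close>

lemma seminorm_lower:
  assumes "WRD M \<rho>" "WMD M \<rho> \<Omega>" and \<Omega>: "\<Omega> \<in> sets M"
    and decay: "\<And>x e. x \<in> space M \<Longrightarrow> 0 < e \<Longrightarrow> \<exists>r0>0. \<forall>R\<ge>r0. \<phi> x R < e"
  obtains c where "0 < c" "\<And>F N f a x. F \<in> borel_measurable M \<Longrightarrow> 0 < N \<Longrightarrow> morrey (\<lambda>y. ennreal \<bar>F y\<bar>) N \<Longrightarrow>
    x \<in> \<Omega> \<Longrightarrow> (\<And>y. y \<in> \<Omega> \<Longrightarrow> F y = f y + a) \<Longrightarrow>
    eventually (\<lambda>s. ennreal (c * \<bar>F x\<bar> powr q) \<le> ennreal s * seminorm_integral q \<Omega> s f x) (at_right 0)"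
proof -
  obtain \<Lambda> c where \<Lambda>: "1 < \<Lambda>" and c: "0 < c" and mass:
    "\<And>x. x \<in> space M \<Longrightarrow> \<exists>r0>0. \<forall>r\<ge>r0. c * V x (\<Lambda> * r) \<le> measure M ((B x (\<Lambda> * r) - B x r) \<inter> \<Omega>)"
    using annulus_mass[OF assms(1,2) \<Omega>] by metis
  define c' where "c' = (1 / 2) * (c / (2 * 2 powr q)) / (q * ln \<Lambda>)"
  have q\<Lambda>: "0 < q * ln \<Lambda>" using q \<Lambda> by simp
  show ?thesis
  proof (rule that[of c'])
    show "0 < c'" using c q\<Lambda> by (simp add: c'_def)
    fix F :: "'a \<Rightarrow> real" and N a :: real and f :: "'a \<Rightarrow> real" and x
    assume F: "F \<in> borel_measurable M" and N: "0 < N" "morrey (\<lambda>y. ennreal \<bar>F y\<bar>) N"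
      and x: "x \<in> \<Omega>" and fF: "\<And>y. y \<in> \<Omega> \<Longrightarrow> F y = f y + a"
    have xX: "x \<in> space M" using x sets.sets_into_space[OF \<Omega>] by auto
    show "eventually (\<lambda>s. ennreal (c' * \<bar>F x\<bar> powr q) \<le> ennreal s * seminorm_integral q \<Omega> s f x) (at_right 0)"
    proof (cases "F x = 0")
      case False
      define \<kappa> where "\<kappa> = c * \<bar>F x\<bar> powr q / (2 * 2 powr q)"
      have \<kappa>: "0 < \<kappa>" using c False by (simp add: \<kappa>_def)
      define e where "e = (\<kappa> / C_avg) powr (1 / q) / N"
      have e: "0 < e" using \<kappa> C_avg_pos N by (simp add: e_def)
      obtain r0 where r0: "0 < r0" "\<And>r. r0 \<le> r \<Longrightarrow> c * V x (\<Lambda> * r) \<le> measure M ((B x (\<Lambda> * r) - B x r) \<inter> \<Omega>)"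
        using mass[OF xX] by auto
      obtain r1 where r1: "0 < r1" "\<And>R. r1 \<le> R \<Longrightarrow> \<phi> x R < e" using decay[OF xX e] by auto
      define r where "r = max r0 r1"
      have r: "0 < r" "r0 \<le> r" "r1 \<le> r" using r0(1) by (auto simp: r_def less_max_iff_disj)
      have small: "C_avg * (N * \<phi> x R) powr q \<le> \<kappa>" if "r \<le> R" for R
      proof -
        have "N * \<phi> x R \<le> N * e" using r1(2)[of R] that r N by (intro mult_left_mono) auto
        then have "(N * \<phi> x R) powr q \<le> (N * e) powr q"
          using q N \<phi>_pos[OF xX, of R] that r by (intro powr_mono2) auto
        also have "\<dots> = \<kappa> / C_avg" using N \<kappa> C_avg_pos q by (simp add: e_def powr_powr)
        finally show ?thesis using C_avg_pos by (simp add: field_simps)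
      qed
      have "((\<lambda>s. (\<Lambda> * r) powr (- (s * q))) \<longlongrightarrow> (\<Lambda> * r) powr (- (0 * q))) (at_right 0)"
        using \<Lambda> r by (intro tendsto_intros) auto
      then have "((\<lambda>s. (\<Lambda> * r) powr (- (s * q))) \<longlongrightarrow> 1) (at_right 0)" using \<Lambda> r by simp
      then have "eventually (\<lambda>s. 1 / 2 < (\<Lambda> * r) powr (- (s * q))) (at_right 0)"
        by (rule order_tendstoD) simp
      then show ?thesis using eventually_at_right_less[of 0]
      proof eventually_elim
        case (elim s)
        have "c' * \<bar>F x\<bar> powr q = (1 / 2) * \<kappa> / (q * ln \<Lambda>)" by (simp add: c'_def \<kappa>_def)
        also have "\<dots> \<le> (\<Lambda> * r) powr (- (s * q)) * \<kappa> / (q * ln \<Lambda>)"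
          using elim \<kappa> q\<Lambda> by (intro divide_right_mono mult_right_mono) auto
        finally have "ennreal (c' * \<bar>F x\<bar> powr q) \<le> ennreal ((\<Lambda> * r) powr (- (s * q)) * \<kappa> / (q * ln \<Lambda>))"
          by (rule ennreal_leI)
        also have "\<dots> \<le> ennreal s * seminorm_integral q \<Omega> s f x"
          unfolding \<kappa>_def using r0(2) small r elim
          by (intro seminorm_integral_lower[OF F N \<Omega> x fF \<Lambda> r(1) _ c]) (auto simp: \<kappa>_def)
        finally show ?case .
      qed
    qed simp
  qed
qed

text \<open>A bound that holds frequently holds along a sequence of parameters tending to zero. The infima over
  the tails of this sequence increase to a function above \<open>v\<close> and satisfy the same bound.\<close>

lemma morrey_Fatou:
  assumes u[measurable]: "\<And>s. 0 < s \<Longrightarrow> s < 1 \<Longrightarrow> u s \<in> borel_measurable M"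
    and freq: "frequently (\<lambda>s. morrey (u s) A) (at_right (0::real))"
    and le: "\<And>x. x \<in> space M \<Longrightarrow> eventually (\<lambda>s. v x \<le> u s x) (at_right 0)"
  shows "morrey v A"
proof -
  have "\<exists>s. 0 < s \<and> s < 1 / real (n + 1) \<and> morrey (u s) A" for n :: nat
  proof -
    have "eventually (\<lambda>s. 0 < s \<and> s < 1 / real (n + 1)) (at_right (0::real))"
      by (auto simp: eventually_at_right_field intro!: exI[of _ "1 / real (n + 1)"])
    from frequently_ex[OF frequently_eventually_frequently[OF freq this]] show ?thesis by blast
  qed
  then obtain S where S: "\<And>n. 0 < S n" "\<And>n. S n < 1 / real (n + 1)" "\<And>n. morrey (u (S n)) A" by metis
  have S1: "S n < 1" for n
    using S(2)[of n] by (rule less_le_trans) simp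
  have "S \<longlonglongrightarrow> 0"
  proof (rule tendsto_sandwich[of "\<lambda>_. 0" _ _ "\<lambda>n. 1 / real (n + 1)"])
    show "(\<lambda>n. 1 / real (n + 1)) \<longlonglongrightarrow> 0" using LIMSEQ_inverse_real_of_nat by (simp add: inverse_eq_divide)
  qed (use S in \<open>auto intro!: always_eventually less_imp_le\<close>)
  then have lim: "filterlim S (at_right 0) sequentially"
    using S(1)[THEN less_imp_neq, THEN not_sym] S(1) by (auto simp: filterlim_at intro!: always_eventually)
  define h where "h m x = (INF n\<in>{m..}. u (S n) x)" for m x
  have uS[measurable]: "u (S n) \<in> borel_measurable M" for n using u[OF S(1) S1] .
  have h[measurable]: "h m \<in> borel_measurable M" for m
    unfolding h_def[abs_def] by (intro borel_measurable_INF) auto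
  have "morrey (\<lambda>x. SUP m. h m x) A"
  proof (rule morrey_SUP[OF h])
    show "incseq (\<lambda>m. h m x)" for x
      unfolding h_def incseq_def by (auto intro!: INF_superset_mono)
    show "morrey (h m) A" for m
      unfolding h_def by (rule morrey_mono[OF S(3) uS[of m]]) (auto intro!: INF_lower)
  qed
  then show ?thesis
  proof (rule morrey_mono)
    fix x assume x: "x \<in> space M"
    have "eventually (\<lambda>n. v x \<le> u (S n) x) sequentially"
      using le[OF x] lim by (rule eventually_compose_filterlim)
    then obtain m where "\<And>n. m \<le> n \<Longrightarrow> v x \<le> u (S n) x" by (auto simp: eventually_sequentially)
    then have "v x \<le> h m x" unfolding h_def by (intro INF_greatest) auto
    also have "\<dots> \<le> (SUP m. h m x)" by (intro SUP_upper) auto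
    finally show "v x \<le> (SUP m. h m x)" .
  qed measurable
qed

end

section \<open>The two-sided estimate\<close>

text \<open>Reduces an inequality between possibly infinite quantities to finite bounds, which is the form
  in which \<open>morrey\<close> can be used.\<close>

lemma ennreal_le_mult_if_bounds:
  fixes x y :: ennreal and D :: real
  assumes D: "0 < D" and le: "\<And>N. 0 < N \<Longrightarrow> x < ennreal N \<Longrightarrow> y \<le> ennreal (D * N)"
  shows "y \<le> ennreal D * x"
proof (cases x)
  case (real n)
  show ?thesis
  proof (cases y)
    case (real l)
    have "l / D \<le> n"
    proof (rule dense_ge)
      fix N assume "n < N"
      then have "ennreal l \<le> ennreal (D * N)"
        using le[of N] \<open>0 \<le> n\<close> \<open>x = ennreal n\<close> real by (simp add: ennreal_less_iff)
      then have "l \<le> D * N" using D \<open>n < N\<close> \<open>0 \<le> n\<close> by (subst (asm) ennreal_le_iff) auto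
      then show "l / D \<le> N" using D by (simp add: field_simps)
    qed
    then have "l \<le> D * n" using D by (simp add: field_simps)
    then show ?thesis using \<open>x = ennreal n\<close> \<open>0 \<le> n\<close> real D by (simp add: ennreal_mult[symmetric] ennreal_leI)
  next
    case top
    have "y \<le> ennreal (D * (n + 1))" using le[of "n + 1"] real by (simp add: ennreal_less_iff)
    then show ?thesis using top by (simp add: top_unique)
  qed
next
  case top
  then show ?thesis using D by (simp add: ennreal_mult_top)
qed

context lorentz_morrey
begin

text \<open>If \<open>\<phi> x\<close> had values above \<open>e\<close> at arbitrarily large radii, almost monotonicity would bound it away
  from zero everywhere and the integral of \<open>\<phi> x t / t\<close> would diverge logarithmically.\<close>

lemma \<phi>_tends_to_zero:
  assumes int: "0 < C\<phi>" "\<And>x r. x \<in> space M \<Longrightarrow> 0 < r \<Longrightarrow>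
      (\<integral>\<^sup>+t\<in>{r<..}. ennreal (\<phi> x t / t) \<partial>lborel) \<le> ennreal (C\<phi> * \<phi> x r)"
    and x: "x \<in> space M" and e: "0 < e"
  shows "\<exists>r0>0. \<forall>R\<ge>r0. \<phi> x R < e"
proof (rule ccontr)
  assume no: "\<not> ?thesis"
  have large: "\<exists>R\<ge>t. e \<le> \<phi> x R" if "0 < t" for t
  proof -
    have "\<not> (\<forall>R\<ge>t. \<phi> x R < e)" using no that by blast
    then show ?thesis by (auto simp: not_less)
  qed
  define c where "c = e / Cd"
  have c: "0 < c" using e Cd by (simp add: c_def)
  have lower: "c \<le> \<phi> x t" if t: "0 < t" for t
  proof -
    obtain R where "t \<le> R" "e \<le> \<phi> x R" using large[OF t] by auto
    then have "e \<le> Cd * \<phi> x t" using \<phi>_decreasing[OF x t] by force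
    then show ?thesis using Cd by (simp add: c_def field_simps)
  qed
  define Z where "Z = (C\<phi> * \<phi> x (1 / 2) + 1) / c"
  have Z: "0 < Z" using int(1) c \<phi>_pos[OF x, of "1 / 2"] by (simp add: Z_def add_pos_pos)
  have "ennreal (c * ln (exp Z) - c * ln 1) = (\<integral>\<^sup>+t. ennreal (c / t) * indicator {1..exp Z} t \<partial>lborel)"
    using c Z by (intro nn_integral_FTC_Icc[symmetric]) (auto intro!: derivative_eq_intros)
  also have "\<dots> \<le> (\<integral>\<^sup>+t\<in>{1 / 2<..}. ennreal (\<phi> x t / t) \<partial>lborel)"
    using lower by (intro nn_integral_mono) (auto split: split_indicator intro!: ennreal_leI divide_right_mono)
  also have "\<dots> \<le> ennreal (C\<phi> * \<phi> x (1 / 2))" using int(2)[OF x, of "1 / 2"] by simp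
  finally have "c * Z \<le> C\<phi> * \<phi> x (1 / 2)"
    using int(1) \<phi>_pos[OF x, of "1 / 2"] by (subst (asm) ennreal_le_iff) auto
  then show False using c by (simp add: Z_def)
qed

lemma gagliardo_extension:
  assumes \<Omega>: "\<Omega> \<in> sets M" and "gagliardo_measurable M \<rho> \<Omega> q f" "0 < s" "s < 1"
  defines "G \<equiv> (\<lambda>x. gagliardo M \<rho> \<Omega> s q f x * indicator \<Omega> x)"
  shows "G \<in> borel_measurable M"
    and "Sob \<Omega> s f = LM (\<lambda>x. enn2ereal (G x))"
proof -
  have "gagliardo M \<rho> \<Omega> s q f \<in> borel_measurable (restrict_space M \<Omega>)"
    using assms by (auto simp: gagliardo_measurable_def)
  then show G: "G \<in> borel_measurable M"
    using \<Omega> by (subst (asm) borel_measurable_restrict_space_iff_ennreal) (auto simp: G_def)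
  have eq: "(\<lambda>x. enn2ereal (gagliardo M \<rho> \<Omega> s q f x) * indicator \<Omega> x) = (\<lambda>x. enn2ereal (G x))"
    by (auto simp: fun_eq_iff G_def zero_ennreal.rep_eq split: split_indicator)
  show "Sob \<Omega> s f = LM (\<lambda>x. enn2ereal (G x))"
    unfolding LM_sobolev_norm_def eq[symmetric] using G
    by (intro LM_norm_on_eq \<Omega>) (simp add: eq)
qed

lemma function_extension:
  fixes f :: "'a \<Rightarrow> real" and a :: real
  assumes \<Omega>: "\<Omega> \<in> sets M" and f: "f \<in> borel_measurable (restrict_space M \<Omega>)"
  defines "F \<equiv> (\<lambda>x. (f x + a) * indicator \<Omega> x :: real)"
  shows "F \<in> borel_measurable M"
    and "LM_on \<Omega> (\<lambda>x. ereal (f x + a)) = LM (\<lambda>x. ereal (F x))"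
proof -
  have "(\<lambda>x. f x + a) \<in> borel_measurable (restrict_space M \<Omega>)" using f by measurable
  then show F: "F \<in> borel_measurable M"
    using \<Omega> by (subst (asm) borel_measurable_restrict_space_iff) (auto simp: F_def mult.commute)
  have eq: "(\<lambda>x. ereal (f x + a) * indicator \<Omega> x) = (\<lambda>x. ereal (F x))"
    by (auto simp: fun_eq_iff F_def split: split_indicator)
  show "LM_on \<Omega> (\<lambda>x. ereal (f x + a)) = LM (\<lambda>x. ereal (F x))"
    unfolding eq[symmetric] using F by (intro LM_norm_on_eq \<Omega>) (simp add: eq)
qed

text \<open>The term that comes from the diagonal is finite for \<open>s0\<close> and carries the factor \<open>s powr (1 / q)\<close>, so it
  is absorbed for small \<open>s\<close>, where the smallness may depend on \<open>f\<close>. What remains is \<open>|F|\<close> and its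
  smeared version, both of Morrey size \<open>N\<close>.\<close>

lemma sobolev_upper:
  obtains D where "0 < D" "\<And>\<Omega> f a N s0. \<Omega> \<in> sets M \<Longrightarrow> f \<in> borel_measurable (restrict_space M \<Omega>) \<Longrightarrow>
    gagliardo_measurable M \<rho> \<Omega> q f \<Longrightarrow> 0 < s0 \<Longrightarrow> s0 < 1 \<Longrightarrow> Sob \<Omega> s0 f < \<infinity> \<Longrightarrow>
    0 < N \<Longrightarrow> LM_on \<Omega> (\<lambda>x. ereal (f x + a)) \<le> ennreal N \<Longrightarrow>
    eventually (\<lambda>s. ennreal (s powr (1 / q)) * Sob \<Omega> s f \<le> ennreal (D * N)) (at_right 0)"
proof -
  obtain Cs where Cs: "0 < Cs" "\<And>a g N. 0 < a \<Longrightarrow> g \<in> borel_measurable M \<Longrightarrow> 0 < N \<Longrightarrow> morrey g N \<Longrightarrow>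
    morrey (\<lambda>x. ennpowr (smear a (\<lambda>y. ennpowr (g y) q) x) (1 / q)) (Cs * N)"
    using smear_morrey by metis
  define C3 where "C3 = max 1 Cs * C_to_morrey"
  define Cm where "Cm = (2 powr (p1 / p) * 2) powr (1 / p1)"
  define C where "C = 2 powr q * vratio (3 * K) / (1 - 2 powr (- q))"
  define k1 where "k1 = 2 * C powr (1 / q) * (Cm * C3)"
  define k2 where "k2 = 2 * 3 powr (1 / q) * Cm"
  define D where "D = 4 * C_from_morrey * k2 * k1"
  have "2 powr (- q) < (1::real)" using q by (subst powr_less_one) auto
  then have C: "0 < C" using vratio_pos by (simp add: C_def)
  have Cm: "0 < Cm" by (simp add: Cm_def)
  have C3: "0 < C3" using C_to_morrey_pos by (simp add: C3_def)
  have k1: "0 < k1" using C Cm C3 by (simp add: k1_def)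
  have k2: "0 < k2" using Cm by (simp add: k2_def)
  have D: "0 < D" using k1 k2 C_from_morrey_pos by (simp add: D_def)
  show ?thesis
  proof (rule that[OF D])
    fix \<Omega> and f :: "'a \<Rightarrow> real" and a N s0 :: real
    assume \<Omega>: "\<Omega> \<in> sets M" and f: "f \<in> borel_measurable (restrict_space M \<Omega>)"
      and gm: "gagliardo_measurable M \<rho> \<Omega> q f" and s0: "0 < s0" "s0 < 1"
      and fin: "Sob \<Omega> s0 f < \<infinity>"
      and N: "0 < N" and fN: "LM_on \<Omega> (\<lambda>x. ereal (f x + a)) \<le> ennreal N"
    define F where "F = (\<lambda>x. (f x + a) * indicator \<Omega> x :: real)"
    have fF: "F y = f y + a" if "y \<in> \<Omega>" for y using that by (simp add: F_def)
    have F[measurable]: "F \<in> borel_measurable M" unfolding F_def by (rule function_extension[OF \<Omega> f])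
    have "LM (\<lambda>x. ereal (F x)) \<le> ennreal N"
      using fN unfolding F_def function_extension(2)[OF \<Omega> f] .
    then have mF: "morrey (\<lambda>x. ennreal \<bar>F x\<bar>) (C_to_morrey * N)"
      using morrey_if_LM_norm_le[of "\<lambda>x. ereal (F x)" N] N by simp
    define G where "G s x = gagliardo M \<rho> \<Omega> s q f x * indicator \<Omega> x" for s x
    have G[measurable]: "G s \<in> borel_measurable M" if "0 < s" "s < 1" for s
      unfolding G_def[abs_def] using gagliardo_extension(1)[OF \<Omega> gm that] .
    have LM_G: "Sob \<Omega> s f = LM (\<lambda>x. enn2ereal (G s x))" if "0 < s" "s < 1" for s
      unfolding G_def[abs_def] using gagliardo_extension(2)[OF \<Omega> gm that] .
    note [measurable] = G[OF s0]
    \<comment> \<open>the summand \<open>1\<close> only makes the bound positive\<close>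
    define N0 where "N0 = enn2real (Sob \<Omega> s0 f) + 1"
    have N0: "0 < N0" by (simp add: N0_def add_nonneg_pos)
    have "Sob \<Omega> s0 f = ennreal (enn2real (Sob \<Omega> s0 f))"
      using fin by simp
    also have "\<dots> \<le> ennreal N0" by (rule ennreal_leI) (simp add: N0_def)
    finally have "LM (\<lambda>x. enn2ereal (G s0 x)) \<le> ennreal N0" using LM_G[OF s0] by simp
    then have mG0: "morrey (G s0) (C_to_morrey * N0)"
      using morrey_if_LM_norm_le[of "\<lambda>x. enn2ereal (G s0 x)" N0] N0 by simp
    have bound: "ennreal (s powr (1 / q)) * Sob \<Omega> s f \<le> ennreal (D * N)"
      if s: "0 < s" "s < s0" and sN: "2 * s powr (1 / q) * (C_to_morrey * N0) < k1 * N" for s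
    proof -
      have s1: "s < 1" "0 < s * q" using s s0 q by auto
      note [measurable] = G[OF s(1) s1(1)]
      let ?S = "\<lambda>x. smear (s * q) (\<lambda>y. ennpowr (ennreal \<bar>F y\<bar>) q) x"
      let ?u = "\<lambda>x. max (ennreal \<bar>F x\<bar>) (ennpowr (?S x) (1 / q))"
      let ?v = "\<lambda>x. max (ennreal (s powr (1 / q)) * G s0 x) (ennreal (C powr (1 / q)) * ?u x)"
      have "morrey ?u (Cm * (C3 * N))" unfolding Cm_def
      proof (rule morrey_max)
        show "morrey (\<lambda>x. ennreal \<bar>F x\<bar>) (C3 * N)"
          using mF C_to_morrey_pos N by - (rule morrey_weaken, auto simp: C3_def)
        show "morrey (\<lambda>x. ennpowr (?S x) (1 / q)) (C3 * N)"
        proof (rule morrey_weaken)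
          show "morrey (\<lambda>x. ennpowr (?S x) (1 / q)) (Cs * (C_to_morrey * N))"
            using Cs(2)[OF s1(2) _ _ mF] N C_to_morrey_pos by simp
          show "Cs * (C_to_morrey * N) \<le> C3 * N"
            using C_to_morrey_pos N by (simp add: C3_def mult.assoc)
        qed (use Cs C_to_morrey_pos N in auto)
      qed (use C3 N in auto)
      then have "morrey (\<lambda>x. ennreal (C powr (1 / q)) * ?u x) (2 * C powr (1 / q) * (Cm * (C3 * N)))"
        using C Cm C3 N by (intro morrey_scale) auto
      then have m1: "morrey (\<lambda>x. ennreal (C powr (1 / q)) * ?u x) (k1 * N)"
        by (simp add: k1_def mult.assoc)
      have "morrey (\<lambda>x. ennreal (s powr (1 / q)) * G s0 x) (2 * s powr (1 / q) * (C_to_morrey * N0))"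
        using mG0 s C_to_morrey_pos N0 by (intro morrey_scale) auto
      then have m2: "morrey (\<lambda>x. ennreal (s powr (1 / q)) * G s0 x) (k1 * N)"
        by (rule morrey_weaken) (use sN s C_to_morrey_pos N0 in auto)
      have "morrey ?v (Cm * (k1 * N))" unfolding Cm_def
        using m1 m2 k1 N by (intro morrey_max) auto
      then have "morrey (\<lambda>x. ennreal (3 powr (1 / q)) * ?v x) (2 * 3 powr (1 / q) * (Cm * (k1 * N)))"
        using k1 Cm N by (intro morrey_scale) auto
      then have m3: "morrey (\<lambda>x. ennreal (3 powr (1 / q)) * ?v x) (k2 * (k1 * N))"
        by (simp add: k2_def mult.assoc)
      have "morrey (\<lambda>x. ennreal (s powr (1 / q)) * G s x) (k2 * (k1 * N))"
      proof (rule morrey_mono[OF m3])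
        fix x assume x: "x \<in> space M"
        show "ennreal (s powr (1 / q)) * G s x \<le> ennreal (3 powr (1 / q)) * ?v x"
        proof (cases "x \<in> \<Omega>")
          case True
          let ?J = "seminorm_integral q \<Omega>"
          let ?a = "ennreal s * ?J s0 f x" and ?b = "max (ennpowr (ennreal \<bar>F x\<bar>) q) (?S x)"
          have "ennreal s * ?J s f x \<le> ?a + ennreal C * (ennpowr (ennreal \<bar>F x\<bar>) q + ?S x)"
            unfolding C_def using s s0 q \<Omega> True
            by (intro seminorm_integral_upper[where a = a]) (auto simp: fF dest: sets.sets_into_space)
          also have "\<dots> \<le> max ?a (ennreal C * ?b) + ennreal C * (?b + ?b)"
            by (intro add_mono mult_left_mono) auto
          also have "\<dots> \<le> max ?a (ennreal C * ?b) + (max ?a (ennreal C * ?b) + max ?a (ennreal C * ?b))"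
            unfolding distrib_left by (intro add_mono) auto
          also have "\<dots> = ennreal 3 * max ?a (ennreal C * ?b)"
          proof -
            have "ennreal 3 = 1 + (1 + 1)" by simp
            then show ?thesis by (simp only: distrib_right mult_1)
          qed
          finally have "ennpowr (ennreal s * ?J s f x) (1 / q) \<le> ennpowr (ennreal 3 * max ?a (ennreal C * ?b)) (1 / q)"
            using q by (intro ennpowr_mono) auto
          also have "\<dots> = ennreal (3 powr (1 / q)) * ennpowr (max ?a (ennreal C * ?b)) (1 / q)"
            by (rule ennpowr_mult) simp
          also have "ennpowr (max ?a (ennreal C * ?b)) (1 / q) = ?v x"
          proof -
            have q': "0 < 1 / q" using q by simp
            have "ennpowr ?a (1 / q) = ennreal (s powr (1 / q)) * G s0 x"
              using s True by (simp add: ennpowr_mult G_def gagliardo_eq)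
            moreover have "ennpowr (ennreal C * ?b) (1 / q) = ennreal (C powr (1 / q)) * ennpowr ?b (1 / q)"
              using C by (rule ennpowr_mult)
            moreover have "ennpowr ?b (1 / q) = ?u x"
              using q by (simp add: ennpowr_max[OF q'] ennpowr_ennpowr powr_powr)
            ultimately show ?thesis by (simp only: ennpowr_max[OF q'])
          qed
          finally show ?thesis using s True by (simp add: ennpowr_mult G_def gagliardo_eq)
        qed (simp add: G_def)
      qed measurable
      then have "morrey (\<lambda>x. ennreal ((1 / s) powr (1 / q)) * (ennreal (s powr (1 / q)) * G s x)) (2 * (1 / s) powr (1 / q) * (k2 * (k1 * N)))"
        using s k1 k2 N by (intro morrey_scale) auto
      moreover have "ennreal ((1 / s) powr (1 / q)) * (ennreal (s powr (1 / q)) * y) = y" for y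
        using s by (simp add: mult.assoc[symmetric] ennreal_mult[symmetric] powr_mult[symmetric])
      ultimately have "morrey (G s) (2 * (1 / s) powr (1 / q) * (k2 * (k1 * N)))" by simp
      then have "LM (\<lambda>x. enn2ereal (G s x)) \<le> ennreal (C_from_morrey * (2 * (1 / s) powr (1 / q) * (k2 * (k1 * N))))"
        using s k1 k2 N by (intro LM_norm_le_if_morrey) auto
      then have "ennreal (s powr (1 / q)) * Sob \<Omega> s f
        \<le> ennreal (s powr (1 / q)) * ennreal (C_from_morrey * (2 * (1 / s) powr (1 / q) * (k2 * (k1 * N))))"
        unfolding LM_G[OF s(1) s1(1)] by (rule mult_left_mono) simp
      also have "\<dots> = ennreal (s powr (1 / q) * (C_from_morrey * (2 * (1 / s) powr (1 / q) * (k2 * (k1 * N)))))"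
        using s k1 k2 N C_from_morrey_pos by (intro ennreal_mult[symmetric]) auto
      also have "s powr (1 / q) * (C_from_morrey * (2 * (1 / s) powr (1 / q) * (k2 * (k1 * N)))) = (s powr (1 / q) * (1 / s) powr (1 / q)) * (2 * C_from_morrey * k2 * k1 * N)"
        by (simp only: mult_ac)
      also have "s powr (1 / q) * (1 / s) powr (1 / q) = 1"
        using s by (simp add: powr_mult[symmetric])
      also have "ennreal (1 * (2 * C_from_morrey * k2 * k1 * N)) \<le> ennreal (D * N)"
        using C_from_morrey_pos k1 k2 N by (intro ennreal_leI) (simp add: D_def)
      finally show ?thesis .
    qed
    have "((\<lambda>s::real. s powr (1 / q)) \<longlongrightarrow> 0) (at_right 0)"
    proof (rule tendsto_zero_powrI[where b = "1 / q"])
      show "eventually (\<lambda>s::real. 0 \<le> s) (at_right 0)"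
        using eventually_at_right_less[of "0::real"] by eventually_elim simp
    qed (use q in \<open>auto intro: tendsto_ident_at\<close>)
    then have "((\<lambda>s. 2 * s powr (1 / q) * (C_to_morrey * N0)) \<longlongrightarrow> 2 * 0 * (C_to_morrey * N0)) (at_right 0)"
      by (intro tendsto_intros)
    then have "eventually (\<lambda>s. 2 * s powr (1 / q) * (C_to_morrey * N0) < k1 * N) (at_right 0)"
      using k1 N by (intro order_tendstoD) auto
    then show "eventually (\<lambda>s. ennreal (s powr (1 / q)) * Sob \<Omega> s f \<le> ennreal (D * N)) (at_right 0)"
      using eventually_at_right_less[of 0] eventually_at_right_real[OF s0(1)]
      by eventually_elim (rule bound, auto)
  qed
qed

text \<open>Finiteness of the quasi-norm of \<open>f + a\<close> enters only qualitatively, to make averages over large balls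
  small; the bound itself comes from the pointwise lower estimate and the Fatou property.\<close>

lemma sobolev_lower:
  assumes "WRD M \<rho>" "WMD M \<rho> \<Omega>" and \<Omega>: "\<Omega> \<in> sets M"
    and decay: "\<And>x e. x \<in> space M \<Longrightarrow> 0 < e \<Longrightarrow> \<exists>r0>0. \<forall>R\<ge>r0. \<phi> x R < e"
  obtains D where "0 < D" "\<And>f a N. f \<in> borel_measurable (restrict_space M \<Omega>) \<Longrightarrow>
    gagliardo_measurable M \<rho> \<Omega> q f \<Longrightarrow> LM_on \<Omega> (\<lambda>x. ereal (f x + a)) < \<infinity> \<Longrightarrow>
    0 < N \<Longrightarrow> frequently (\<lambda>s. ennreal (s powr (1 / q)) * Sob \<Omega> s f \<le> ennreal N) (at_right 0) \<Longrightarrow>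
    LM_on \<Omega> (\<lambda>x. ereal (f x + a)) \<le> ennreal (D * N)"
proof -
  obtain c where c: "0 < c" and low: "\<And>F N f a x. F \<in> borel_measurable M \<Longrightarrow> 0 < N \<Longrightarrow> morrey (\<lambda>y. ennreal \<bar>F y\<bar>) N \<Longrightarrow>
    x \<in> \<Omega> \<Longrightarrow> (\<And>y. y \<in> \<Omega> \<Longrightarrow> F y = f y + a) \<Longrightarrow>
    eventually (\<lambda>s. ennreal (c * \<bar>F x\<bar> powr q) \<le> ennreal s * seminorm_integral q \<Omega> s f x) (at_right 0)"
    using seminorm_lower[OF assms(1,2) \<Omega> decay] by blast
  define D where "D = C_from_morrey * (2 * (1 / c) powr (1 / q) * (2 * C_to_morrey))"
  have D: "0 < D" using C_from_morrey_pos C_to_morrey_pos c by (simp add: D_def)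
  show ?thesis
  proof (rule that[OF D])
    fix f :: "'a \<Rightarrow> real" and a N :: real
    assume f: "f \<in> borel_measurable (restrict_space M \<Omega>)" and gm: "gagliardo_measurable M \<rho> \<Omega> q f"
      and fin: "LM_on \<Omega> (\<lambda>x. ereal (f x + a)) < \<infinity>" and N: "0 < N"
      and freq: "frequently (\<lambda>s. ennreal (s powr (1 / q)) * Sob \<Omega> s f \<le> ennreal N) (at_right 0)"
    define F where "F = (\<lambda>x. (f x + a) * indicator \<Omega> x :: real)"
    have fF: "F y = f y + a" if "y \<in> \<Omega>" for y using that by (simp add: F_def)
    have F[measurable]: "F \<in> borel_measurable M" unfolding F_def by (rule function_extension[OF \<Omega> f])
    have LM_F: "LM_on \<Omega> (\<lambda>x. ereal (f x + a)) = LM (\<lambda>x. ereal (F x))"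
      unfolding F_def function_extension(2)[OF \<Omega> f] ..
    define N0 where "N0 = enn2real (LM (\<lambda>x. ereal (F x))) + 1"
    have N0: "0 < N0" by (simp add: N0_def add_nonneg_pos)
    have "LM (\<lambda>x. ereal (F x)) = ennreal (enn2real (LM (\<lambda>x. ereal (F x))))"
      using fin LM_F by simp
    also have "\<dots> \<le> ennreal N0" by (rule ennreal_leI) (simp add: N0_def)
    finally have mF: "morrey (\<lambda>x. ennreal \<bar>F x\<bar>) (C_to_morrey * N0)"
      using morrey_if_LM_norm_le[of "\<lambda>x. ereal (F x)" N0] N0 by simp
    define G where "G s x = gagliardo M \<rho> \<Omega> s q f x * indicator \<Omega> x" for s x
    have G[measurable]: "G s \<in> borel_measurable M" if "0 < s" "s < 1" for s
      unfolding G_def[abs_def] using gagliardo_extension(1)[OF \<Omega> gm that] .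
    have LM_G: "Sob \<Omega> s f = LM (\<lambda>x. enn2ereal (G s x))" if "0 < s" "s < 1" for s
      unfolding G_def[abs_def] using gagliardo_extension(2)[OF \<Omega> gm that] .
    let ?u = "\<lambda>s x. ennreal (s powr (1 / q)) * G s x"
    let ?v = "\<lambda>x. ennreal (c powr (1 / q)) * ennreal \<bar>F x\<bar>"
    have "morrey ?v (2 * C_to_morrey * N)"
    proof (rule morrey_Fatou[of ?u])
      have "eventually (\<lambda>s. 0 < s \<and> s < 1) (at_right (0::real))"
        using eventually_at_right_less[of "0::real"] eventually_at_right_real[of 0 "1::real"] by (auto elim: eventually_elim2)
      from frequently_eventually_frequently[OF freq this]
      show "frequently (\<lambda>s. morrey (?u s) (2 * C_to_morrey * N)) (at_right 0)"
      proof (rule frequently_elim1)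
        fix s assume *: "ennreal (s powr (1 / q)) * Sob \<Omega> s f \<le> ennreal N \<and> 0 < s \<and> s < 1"
        then have s: "0 < s" "s < 1" by auto
        note [measurable] = G[OF s]
        have inv: "ennreal ((1 / s) powr (1 / q)) * (ennreal (s powr (1 / q)) * y) = y" for y
          using s by (simp add: mult.assoc[symmetric] ennreal_mult[symmetric] powr_mult[symmetric])
        have "ennreal ((1 / s) powr (1 / q)) * (ennreal (s powr (1 / q)) * Sob \<Omega> s f) \<le> ennreal ((1 / s) powr (1 / q)) * ennreal N"
          using * by (intro mult_left_mono) auto
        then have "LM (\<lambda>x. enn2ereal (G s x)) \<le> ennreal ((1 / s) powr (1 / q) * N)"
          using s N unfolding inv LM_G[OF s] by (simp add: ennreal_mult)
        then have "morrey (G s) (C_to_morrey * ((1 / s) powr (1 / q) * N))"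
          using morrey_if_LM_norm_le[of "\<lambda>x. enn2ereal (G s x)" "(1 / s) powr (1 / q) * N"] s N by simp
        then have "morrey (?u s) (2 * s powr (1 / q) * (C_to_morrey * ((1 / s) powr (1 / q) * N)))"
          using s N C_to_morrey_pos by (intro morrey_scale) auto
        also have "2 * s powr (1 / q) * (C_to_morrey * ((1 / s) powr (1 / q) * N)) = (s powr (1 / q) * (1 / s) powr (1 / q)) * (2 * C_to_morrey * N)"
          by (simp only: mult_ac)
        also have "s powr (1 / q) * (1 / s) powr (1 / q) = 1" using s by (simp add: powr_mult[symmetric])
        finally show "morrey (?u s) (2 * C_to_morrey * N)" by simp
      qed
      fix x assume x: "x \<in> space M"
      show "eventually (\<lambda>s. ?v x \<le> ?u s x) (at_right 0)"
      proof (cases "x \<in> \<Omega>")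
        case True
        have "eventually (\<lambda>s. ennreal (c * \<bar>F x\<bar> powr q) \<le> ennreal s * seminorm_integral q \<Omega> s f x) (at_right 0)"
          using mF N0 C_to_morrey_pos True by (intro low[where a = a and N = "C_to_morrey * N0"]) (auto simp: fF)
        then show ?thesis using eventually_at_right_less[of "0::real"]
        proof eventually_elim
          case (elim s)
          have "ennpowr (ennreal (c * \<bar>F x\<bar> powr q)) (1 / q) \<le> ennpowr (ennreal s * seminorm_integral q \<Omega> s f x) (1 / q)"
            using elim q by (intro ennpowr_mono) auto
          moreover have "ennpowr (ennreal (c * \<bar>F x\<bar> powr q)) (1 / q) = ?v x"
          proof -
            have "(c * \<bar>F x\<bar> powr q) powr (1 / q) = c powr (1 / q) * \<bar>F x\<bar>"
              using q by (simp add: powr_mult powr_powr)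
            then show ?thesis using c by (simp add: ennreal_mult[symmetric])
          qed
          moreover have "ennpowr (ennreal s * seminorm_integral q \<Omega> s f x) (1 / q) = ?u s x"
            using elim True by (simp add: ennpowr_mult G_def gagliardo_eq)
          ultimately show ?case by simp
        qed
      qed (simp add: F_def)
    qed measurable
    then have "morrey (\<lambda>x. ennreal ((1 / c) powr (1 / q)) * ?v x) (2 * (1 / c) powr (1 / q) * (2 * C_to_morrey * N))"
      using c N C_to_morrey_pos by (intro morrey_scale) auto
    moreover have "ennreal ((1 / c) powr (1 / q)) * (ennreal (c powr (1 / q)) * y) = y" for y
      using c by (simp add: mult.assoc[symmetric] ennreal_mult[symmetric] powr_mult[symmetric])
    ultimately have "morrey (\<lambda>x. ennreal \<bar>F x\<bar>) (2 * (1 / c) powr (1 / q) * (2 * C_to_morrey * N))" by simp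
    then have "LM (\<lambda>x. ereal (F x)) \<le> ennreal (C_from_morrey * (2 * (1 / c) powr (1 / q) * (2 * C_to_morrey * N)))"
      using c N C_to_morrey_pos by (intro LM_norm_le_if_morrey) auto
    then show "LM_on \<Omega> (\<lambda>x. ereal (f x + a)) \<le> ennreal (D * N)"
      unfolding LM_F by (simp add: D_def mult_ac)
  qed
qed

end

theorem theorem4p26:
  fixes M :: "'a measure" and \<rho> :: "'a \<Rightarrow> 'a \<Rightarrow> real" and \<Omega> :: "'a set"
    and p p1 q :: real and \<phi> :: "'a \<Rightarrow> real \<Rightarrow> real"
  assumes "homogeneous_type M \<rho>"
    and "WRD M \<rho>"
    and "qopen M \<rho> \<Omega>"
    and "WMD M \<rho> \<Omega>"
    and "0 < p" and "0 < p1" and "0 < q" and "q < min p p1"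
    and "\<phi> \<in> Gdec M \<rho> p"
    and "nearness M \<rho> \<phi>"
    and "\<exists>C\<phi>>0. \<forall>x\<in>space M. \<forall>r>0.
      (\<integral>\<^sup>+t\<in>{r<..}. ennreal (\<phi> x t / t) \<partial>lborel) \<le> ennreal (C\<phi> * \<phi> x r)"
    and "(\<exists>D\<ge>1. \<forall>x\<in>space M. \<forall>r>0.
            1 / D \<le> \<phi> x r * measure M (qball M \<rho> x r) powr (1 / p) \<and>
            \<phi> x r * measure M (qball M \<rho> x r) powr (1 / p) \<le> D) \<or>
         ((\<forall>x0\<in>space M. \<forall>r0>0.
            filterlim (\<lambda>r. INF x\<in>qball M \<rho> x0 r0. \<phi> x r) at_top (at_right 0)) \<and>
          (\<forall>x\<in>space M.
            filterlim (\<lambda>r. \<phi> x r * measure M (qball M \<rho> x r) powr (1 / p)) at_top at_top))"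
  shows "\<exists>C D :: real. 0 < C \<and> 0 < D \<and>
    (\<forall>f \<in> LM_quotient M \<rho> p p1 \<phi> \<Omega> \<inter> (\<Union>s\<in>{0<..<1}. LM_sobolev M \<rho> p p1 \<phi> \<Omega> s q).
      gagliardo_measurable M \<rho> \<Omega> q f \<longrightarrow>
      ennreal C * LM_quotient_norm M \<rho> p p1 \<phi> \<Omega> f
        \<le> Liminf (at_right 0) (\<lambda>s. ennreal (s powr (1 / q)) * LM_sobolev_norm M \<rho> p p1 \<phi> \<Omega> s q f) \<and>
      Liminf (at_right 0) (\<lambda>s. ennreal (s powr (1 / q)) * LM_sobolev_norm M \<rho> p p1 \<phi> \<Omega> s q f)
        \<le> Limsup (at_right 0) (\<lambda>s. ennreal (s powr (1 / q)) * LM_sobolev_norm M \<rho> p p1 \<phi> \<Omega> s q f) \<and>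
      Limsup (at_right 0) (\<lambda>s. ennreal (s powr (1 / q)) * LM_sobolev_norm M \<rho> p p1 \<phi> \<Omega> s q f)
        \<le> ennreal D * LM_quotient_norm M \<rho> p p1 \<phi> \<Omega> f)"
proof -
  obtain K L where "doubling_space M \<rho> K L"
    using homogeneous_type_imp_doubling_space[OF assms(1)] .
  then interpret doubling_space M \<rho> K L .
  have \<phi>pos: "\<And>x r. x \<in> space M \<Longrightarrow> 0 < r \<Longrightarrow> 0 < \<phi> x r" and dec: "almost_decreasing (space M) \<phi>"
    using assms(9) by (auto simp: Gdec_def)
  obtain C1 where C1: "0 < C1" "\<And>x r s. x \<in> space M \<Longrightarrow> 0 < r \<Longrightarrow> r < s \<Longrightarrow> \<phi> x s \<le> C1 * \<phi> x r"
    using dec unfolding almost_decreasing_def by blast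
  obtain C2 where C2: "0 < C2" "\<And>x y r. x \<in> space M \<Longrightarrow> y \<in> space M \<Longrightarrow> 0 < r \<Longrightarrow> \<rho> x y \<le> r \<Longrightarrow> \<phi> x r / \<phi> y r \<le> C2"
    using assms(10) unfolding nearness_def by blast
  interpret lorentz_morrey M \<rho> K L p p1 q \<phi> "max 1 C1" "max 1 C2"
  proof
    show "\<phi> x s \<le> max 1 C1 * \<phi> x r" if "x \<in> space M" "0 < r" "r \<le> s" for x r s
    proof (cases "r = s")
      case True
      then show ?thesis using mult_right_mono[of 1 "max 1 C1" "\<phi> x r"] \<phi>pos[OF that(1,2)] by simp
    next
      case False
      then have "\<phi> x s \<le> C1 * \<phi> x r" using C1(2) that by simp
      also have "\<dots> \<le> max 1 C1 * \<phi> x r" using \<phi>pos[OF that(1,2)] by (intro mult_right_mono) auto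
      finally show ?thesis .
    qed
    show "\<phi> x r \<le> max 1 C2 * \<phi> y r" if "x \<in> space M" "y \<in> space M" "0 < r" "\<rho> x y \<le> r" for x y r
    proof -
      have "\<phi> x r \<le> C2 * \<phi> y r" using C2(2)[OF that] \<phi>pos[OF that(2,3)] by (simp add: divide_le_eq)
      also have "\<dots> \<le> max 1 C2 * \<phi> y r" using \<phi>pos[OF that(2,3)] by (intro mult_right_mono) auto
      finally show ?thesis .
    qed
  qed (use assms \<phi>pos in auto)
  have \<Omega>: "\<Omega> \<in> sets M" using assms(3) by (rule qopen_sets)
  obtain C\<phi> where C\<phi>: "0 < C\<phi>" "\<And>x r. x \<in> space M \<Longrightarrow> 0 < r \<Longrightarrow>
      (\<integral>\<^sup>+t\<in>{r<..}. ennreal (\<phi> x t / t) \<partial>lborel) \<le> ennreal (C\<phi> * \<phi> x r)"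
    using assms(11) by blast
  obtain Du where Du: "0 < Du" "\<And>\<Omega> f a N s0. \<Omega> \<in> sets M \<Longrightarrow> f \<in> borel_measurable (restrict_space M \<Omega>) \<Longrightarrow>
    gagliardo_measurable M \<rho> \<Omega> q f \<Longrightarrow> 0 < s0 \<Longrightarrow> s0 < 1 \<Longrightarrow> Sob \<Omega> s0 f < \<infinity> \<Longrightarrow>
    0 < N \<Longrightarrow> LM_on \<Omega> (\<lambda>x. ereal (f x + a)) \<le> ennreal N \<Longrightarrow>
    eventually (\<lambda>s. ennreal (s powr (1 / q)) * Sob \<Omega> s f \<le> ennreal (Du * N)) (at_right 0)"
    using sobolev_upper by blast
  obtain Dl where Dl: "0 < Dl" "\<And>f a N. f \<in> borel_measurable (restrict_space M \<Omega>) \<Longrightarrow>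
    gagliardo_measurable M \<rho> \<Omega> q f \<Longrightarrow> LM_on \<Omega> (\<lambda>x. ereal (f x + a)) < \<infinity> \<Longrightarrow>
    0 < N \<Longrightarrow> frequently (\<lambda>s. ennreal (s powr (1 / q)) * Sob \<Omega> s f \<le> ennreal N) (at_right 0) \<Longrightarrow>
    LM_on \<Omega> (\<lambda>x. ereal (f x + a)) \<le> ennreal (Dl * N)"
    using sobolev_lower[OF assms(2,4) \<Omega> \<phi>_tends_to_zero[OF C\<phi>]] by blast
  show ?thesis
  proof (rule exI[of _ "1 / Dl"], rule exI[of _ Du], intro conjI ballI impI)
    show "0 < 1 / Dl" "0 < Du" using Dl Du by auto
    fix f assume fW: "f \<in> LM_quotient M \<rho> p p1 \<phi> \<Omega> \<inter> (\<Union>s\<in>{0<..<1}. LM_sobolev M \<rho> p p1 \<phi> \<Omega> s q)"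
      and gm: "gagliardo_measurable M \<rho> \<Omega> q f"
    let ?X = "\<lambda>s. ennreal (s powr (1 / q)) * Sob \<Omega> s f"
    let ?n = "\<lambda>a. LM_on \<Omega> (\<lambda>x. ereal (f x + a))"
    have quot: "LM_quotient_norm M \<rho> p p1 \<phi> \<Omega> f = (INF a. ?n a)" by (simp add: LM_quotient_norm_def)
    have f: "f \<in> borel_measurable (restrict_space M \<Omega>)" and "LM_quotient_norm M \<rho> p p1 \<phi> \<Omega> f < \<infinity>"
      using fW by (auto simp: LM_quotient_def)
    then obtain a where a: "?n a < \<infinity>" unfolding quot by (auto simp: INF_less_iff)
    obtain s0 where s0: "0 < s0" "s0 < 1" "Sob \<Omega> s0 f < \<infinity>"
      using fW by (auto simp: LM_sobolev_def)
    have "?n a \<le> ennreal Dl * Liminf (at_right 0) ?X"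
    proof (rule ennreal_le_mult_if_bounds[OF Dl(1)])
      fix N assume N: "0 < N" "Liminf (at_right 0) ?X < ennreal N"
      have "\<not> eventually (\<lambda>s. ennreal N \<le> ?X s) (at_right 0)"
        using N(2) Liminf_bounded[of "ennreal N" ?X "at_right 0"] by (auto dest: leD)
      then have "frequently (\<lambda>s. ?X s \<le> ennreal N) (at_right 0)"
        unfolding not_eventually by (rule frequently_elim1) simp
      then show "?n a \<le> ennreal (Dl * N)" by (rule Dl(2)[OF f gm a N(1)])
    qed
    then have "LM_quotient_norm M \<rho> p p1 \<phi> \<Omega> f \<le> ennreal Dl * Liminf (at_right 0) ?X"
      unfolding quot by (rule INF_lower2[rotated]) simp
    then have "ennreal (1 / Dl) * LM_quotient_norm M \<rho> p p1 \<phi> \<Omega> f \<le> ennreal (1 / Dl) * (ennreal Dl * Liminf (at_right 0) ?X)"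
      by (rule mult_left_mono) simp
    also have "\<dots> = Liminf (at_right 0) ?X"
      using Dl(1) by (simp add: mult.assoc[symmetric] ennreal_mult[symmetric])
    finally show "ennreal (1 / Dl) * LM_quotient_norm M \<rho> p p1 \<phi> \<Omega> f \<le> Liminf (at_right 0) ?X" .
    show "Liminf (at_right 0) ?X \<le> Limsup (at_right 0) ?X"
      by (rule Liminf_le_Limsup) simp
    show "Limsup (at_right 0) ?X \<le> ennreal Du * LM_quotient_norm M \<rho> p p1 \<phi> \<Omega> f"
    proof (rule ennreal_le_mult_if_bounds[OF Du(1)])
      fix N assume N: "0 < N" "LM_quotient_norm M \<rho> p p1 \<phi> \<Omega> f < ennreal N"
      then obtain b where "?n b \<le> ennreal N" unfolding quot by (auto simp: INF_less_iff intro: less_imp_le)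
      then show "Limsup (at_right 0) ?X \<le> ennreal (Du * N)"
        by (intro Limsup_bounded Du(2)[OF \<Omega> f gm s0 N(1)])
    qed
  qed
qed

end
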